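(* There are cohomogeneity one Riemannian metrics on $\mathbb{C}\mathbb{P}^n$ which admit a density $f$ such that $\sec_f>0$ but which do not have $\sec\ge 0$.
   Context: A density is a smooth function $f$ on the manifold. A metric has cohomogeneity one if it admits an isometric action of a compact Lie group whose principal orbits have codimension one. For an orthonormal pair $(U,V)$ of tangent vectors, $\sec_f^V(U)=\sec(U,V)+\mathrm{Hess}\,f(V,V)$, and $\sec_f>0$ means $\sec_f^V(U)>0$ for every orthonormal pair $(U,V)$ at every point. $\sec\ge0$ means nonnegative sectional curvature. Here $n\ge1$ is an arbitrary integer. *)

theory Defs
  imports "HOL-Analysis.Analysis" "HOL-Algebra.Group_Action"
begin

section \<open>Smooth functions\<close>

text \<open>For Euclidean spaces and open \<open>S\<close> this is class $C^k$.\<close>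

primrec Ck_on :: "nat \<Rightarrow> 'e::euclidean_space set \<Rightarrow> ('e \<Rightarrow> 'f::euclidean_space) \<Rightarrow> bool" where
  "Ck_on 0 S f \<longleftrightarrow> continuous_on S f"
| "Ck_on (Suc k) S f \<longleftrightarrow>
     (\<forall>x\<in>S. f differentiable (at x)) \<and> (\<forall>v. Ck_on k S (\<lambda>x. frechet_derivative f (at x) v))"

text \<open>Smoothness on an arbitrary subset means local extendability to smooth functions on open
  sets. On open sets this is the usual notion, and on relatively open subsets of a linear subspace
  it is the usual notion for that subspace.\<close>

definition smooth_on :: "'e::euclidean_space set \<Rightarrow> ('e \<Rightarrow> 'f::euclidean_space) \<Rightarrow> bool" where
  "smooth_on S f \<longleftrightarrow>
     (\<forall>x\<in>S. \<exists>U F. open U \<and> x \<in> U \<and> (\<forall>k. Ck_on k U F) \<and> (\<forall>y\<in>S \<inter> U. F y = f y))"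


section \<open>Smooth manifolds\<close>

text \<open>A chart is a domain together with a coordinate map, which is only relevant on the domain.
  Charts take values in a linear subspace \<open>E\<close> of the type \<open>'e\<close>, so that manifolds
  of every dimension up to \<open>DIM('e)\<close> can be described.\<close>

type_synonym ('a, 'e) chart = "'a set \<times> ('a \<Rightarrow> 'e)"
type_synonym ('a, 'e) atlas = "('a, 'e) chart set"

definition points :: "('a, 'e) atlas \<Rightarrow> 'a set" where
  "points A = \<Union>(fst ` A)"

definition smooth_atlas :: "'e::euclidean_space set \<Rightarrow> ('a, 'e) atlas \<Rightarrow> bool" where
  "smooth_atlas E A \<longleftrightarrow> subspace E \<and> (\<forall>(U, \<phi>)\<in>A. inj_on \<phi> U) \<and>
     (\<forall>(U, \<phi>)\<in>A. \<forall>(V, \<psi>)\<in>A. openin (top_of_set E) (\<phi> ` (U \<inter> V)) \<and>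
        smooth_on (\<phi> ` (U \<inter> V)) (\<psi> \<circ> inv_into U \<phi>))"

definition atlas_open :: "'e::euclidean_space set \<Rightarrow> ('a, 'e) atlas \<Rightarrow> 'a set \<Rightarrow> bool" where
  "atlas_open E A W \<longleftrightarrow>
     W \<subseteq> points A \<and> (\<forall>(U, \<phi>)\<in>A. openin (top_of_set E) (\<phi> ` (W \<inter> U)))"

definition atlas_topology :: "'e::euclidean_space set \<Rightarrow> ('a, 'e) atlas \<Rightarrow> 'a topology" where
  "atlas_topology E A = topology (atlas_open E A)"

lemma openin_atlas_topology:
  assumes "smooth_atlas E A"
  shows "openin (atlas_topology E A) = atlas_open E A"
proof -
  have inj: "inj_on \<phi> U" if "(U, \<phi>) \<in> A" for U \<phi>
    using assms that unfolding smooth_atlas_def by blast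
  have "istopology (atlas_open E A)"
    unfolding istopology_def
  proof (intro conjI allI impI)
    fix S T assume S: "atlas_open E A S" and T: "atlas_open E A T"
    have "openin (top_of_set E) (\<phi> ` (S \<inter> T \<inter> U))" if c: "(U, \<phi>) \<in> A" for U \<phi>
    proof -
      have "\<phi> ` (S \<inter> T \<inter> U) = \<phi> ` (S \<inter> U) \<inter> \<phi> ` (T \<inter> U)"
        using inj_on_image_Int[OF inj[OF c], of "S \<inter> U" "T \<inter> U"]
        by (simp add: Int_ac)
      moreover have "openin (top_of_set E) (\<phi> ` (S \<inter> U))" "openin (top_of_set E) (\<phi> ` (T \<inter> U))"
        using S T c unfolding atlas_open_def by blast+
      ultimately show ?thesis by (simp add: openin_Int)
    qed
    then show "atlas_open E A (S \<inter> T)"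
      using S unfolding atlas_open_def by blast
  next
    fix \<K> assume K: "\<forall>K\<in>\<K>. atlas_open E A K"
    have "openin (top_of_set E) (\<phi> ` (\<Union>\<K> \<inter> U))" if c: "(U, \<phi>) \<in> A" for U \<phi>
    proof -
      have "\<phi> ` (\<Union>\<K> \<inter> U) = \<Union>((\<lambda>K. \<phi> ` (K \<inter> U)) ` \<K>)" by blast
      moreover have "openin (top_of_set E) (\<phi> ` (K \<inter> U))" if "K \<in> \<K>" for K
        using K that c unfolding atlas_open_def by blast
      ultimately show ?thesis by auto
    qed
    then show "atlas_open E A (\<Union>\<K>)"
      using K unfolding atlas_open_def by blast
  qed
  then show ?thesis
    unfolding atlas_topology_def by (rule topology_inverse')
qed

definition smooth_manifold :: "'e::euclidean_space set \<Rightarrow> ('a, 'e) atlas \<Rightarrow> bool" where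
  "smooth_manifold E A \<longleftrightarrow> smooth_atlas E A \<and> Hausdorff_space (atlas_topology E A) \<and>
     (\<exists>\<B>. countable \<B> \<and> (\<forall>B\<in>\<B>. openin (atlas_topology E A) B) \<and>
        (\<forall>W x. openin (atlas_topology E A) W \<and> x \<in> W \<longrightarrow> (\<exists>B\<in>\<B>. x \<in> B \<and> B \<subseteq> W)))"

text \<open>The openness condition makes smooth maps continuous; \<open>E\<close> is the model space of the
  source.\<close>

definition smooth_map ::
  "'e::euclidean_space set \<Rightarrow> ('a, 'e) atlas \<Rightarrow> ('b, 'f::euclidean_space) atlas \<Rightarrow> ('a \<Rightarrow> 'b) \<Rightarrow> bool"
  where
  "smooth_map E A B F \<longleftrightarrow> F ` points A \<subseteq> points B \<and>
     (\<forall>(U, \<phi>)\<in>A. \<forall>(V, \<psi>)\<in>B. openin (top_of_set E) (\<phi> ` (U \<inter> F -` V)) \<and>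
        smooth_on (\<phi> ` (U \<inter> F -` V)) (\<psi> \<circ> F \<circ> inv_into U \<phi>))"

definition prod_atlas :: "('a, 'e) atlas \<Rightarrow> ('b, 'f) atlas \<Rightarrow> ('a \<times> 'b, 'e \<times> 'f) atlas" where
  "prod_atlas A B = {(U \<times> V, map_prod \<phi> \<psi>) | U \<phi> V \<psi>. (U, \<phi>) \<in> A \<and> (V, \<psi>) \<in> B}"

text \<open>Embedded submanifolds, described by slice charts belonging to the maximal atlas; here the
  ambient manifold is modelled on the whole type.\<close>

definition embedded_submanifold :: "nat \<Rightarrow> ('a, 'e::euclidean_space) atlas \<Rightarrow> 'a set \<Rightarrow> bool" where
  "embedded_submanifold k A S \<longleftrightarrow> S \<subseteq> points A \<and>
     (\<forall>p\<in>S. \<exists>W \<theta> L. p \<in> W \<and> W \<subseteq> points A \<and> smooth_atlas UNIV (insert (W, \<theta>) A) \<and>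
        subspace L \<and> dim L = k \<and> \<theta> ` (W \<inter> S) = \<theta> ` W \<inter> L)"


section \<open>Riemannian metrics and curvature\<close>

text \<open>The coordinates in a chart around \<open>p\<close> identify the tangent space at \<open>p\<close>
  with \<open>'e\<close>. A metric \<open>g\<close> assigns to a chart \<open>(U, \<phi>)\<close>, a coordinate
  point \<open>x \<in> \<phi> ` U\<close> and two coordinate vectors their inner product.\<close>

type_synonym ('a, 'e) metric = "('a, 'e) chart \<Rightarrow> 'e \<Rightarrow> 'e \<Rightarrow> 'e \<Rightarrow> real"

definition metric_preserving ::
  "('a, 'e::euclidean_space) atlas \<Rightarrow> ('a, 'e) metric \<Rightarrow> ('a \<Rightarrow> 'a) \<Rightarrow> bool" where
  "metric_preserving A g F \<longleftrightarrow>
     (\<forall>(U, \<phi>)\<in>A. \<forall>(V, \<psi>)\<in>A. \<forall>p\<in>U. F p \<in> V \<longrightarrow>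
        (\<forall>u v. let D = frechet_derivative (\<psi> \<circ> F \<circ> inv_into U \<phi>) (at (\<phi> p))
               in g (V, \<psi>) (\<psi> (F p)) (D u) (D v) = g (U, \<phi>) (\<phi> p) u v))"

text \<open>For the identity map, the last condition is the tensor transformation law under change of
  charts.\<close>

definition riemannian_metric ::
  "('a, 'e::euclidean_space) atlas \<Rightarrow> ('a, 'e) metric \<Rightarrow> bool" where
  "riemannian_metric A g \<longleftrightarrow>
     (\<forall>(U, \<phi>)\<in>A.
        (\<forall>x\<in>\<phi> ` U. bilinear (g (U, \<phi>) x) \<and>
           (\<forall>u v. g (U, \<phi>) x u v = g (U, \<phi>) x v u) \<and>
           (\<forall>u. u \<noteq> 0 \<longrightarrow> g (U, \<phi>) x u u > 0)) \<and>
        (\<forall>u v. smooth_on (\<phi> ` U) (\<lambda>x. g (U, \<phi>) x u v))) \<and>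
     metric_preserving A g id"

text \<open>In the following local formulas \<open>h\<close> is the metric in one chart. With constant
  (hence commuting) coordinate vector fields, the Koszul formula determines the Levi-Civita
  connection as \<open>\<nabla>\<^sub>u v = christoffel h x u v\<close>.\<close>

definition christoffel ::
  "('e::euclidean_space \<Rightarrow> 'e \<Rightarrow> 'e \<Rightarrow> real) \<Rightarrow> 'e \<Rightarrow> 'e \<Rightarrow> 'e \<Rightarrow> 'e" where
  "christoffel h x u v = (THE z. \<forall>w. 2 * h x z w =
       frechet_derivative (\<lambda>y. h y v w) (at x) u
     + frechet_derivative (\<lambda>y. h y u w) (at x) v
     - frechet_derivative (\<lambda>y. h y u v) (at x) w)"

text \<open>\<open>R(u, v) w = \<nabla>\<^sub>u \<nabla>\<^sub>v w - \<nabla>\<^sub>v \<nabla>\<^sub>u w\<close> for constant coordinate fields.\<close>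

definition curvature_tensor ::
  "('e::euclidean_space \<Rightarrow> 'e \<Rightarrow> 'e \<Rightarrow> real) \<Rightarrow> 'e \<Rightarrow> 'e \<Rightarrow> 'e \<Rightarrow> 'e \<Rightarrow> 'e" where
  "curvature_tensor h x u v w =
       frechet_derivative (\<lambda>y. christoffel h y v w) (at x) u
     - frechet_derivative (\<lambda>y. christoffel h y u w) (at x) v
     + christoffel h x u (christoffel h x v w)
     - christoffel h x v (christoffel h x u w)"

definition sectional_curvature ::
  "('e::euclidean_space \<Rightarrow> 'e \<Rightarrow> 'e \<Rightarrow> real) \<Rightarrow> 'e \<Rightarrow> 'e \<Rightarrow> 'e \<Rightarrow> real" where
  "sectional_curvature h x u v =
     h x (curvature_tensor h x u v v) u / (h x u u * h x v v - (h x u v)\<^sup>2)"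

definition hessian ::
  "('e::euclidean_space \<Rightarrow> 'e \<Rightarrow> 'e \<Rightarrow> real) \<Rightarrow> ('e \<Rightarrow> real) \<Rightarrow> 'e \<Rightarrow> 'e \<Rightarrow> 'e \<Rightarrow> real" where
  "hessian h f x u v =
       frechet_derivative (\<lambda>y. frechet_derivative f (at y) v) (at x) u
     - frechet_derivative f (at x) (christoffel h x u v)"

definition sec_nonneg :: "('a, 'e::euclidean_space) atlas \<Rightarrow> ('a, 'e) metric \<Rightarrow> bool" where
  "sec_nonneg A g \<longleftrightarrow>
     (\<forall>(U, \<phi>)\<in>A. \<forall>x\<in>\<phi> ` U. \<forall>u v. u \<noteq> v \<and> independent {u, v} \<longrightarrow>
        sectional_curvature (g (U, \<phi>)) x u v \<ge> 0)"

definition smooth_density :: "('a, 'e::euclidean_space) atlas \<Rightarrow> ('a \<Rightarrow> real) \<Rightarrow> bool" where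
  "smooth_density A f \<longleftrightarrow> (\<forall>(U, \<phi>)\<in>A. smooth_on (\<phi> ` U) (f \<circ> inv_into U \<phi>))"

text \<open>Weighted sectional curvature, \<open>weighted_sec h f x v u\<close> being
  \<open>sec\<^sub>f\<^sup>v(u)\<close>; it is not symmetric in \<open>u\<close> and \<open>v\<close>.\<close>

definition weighted_sec ::
  "('e::euclidean_space \<Rightarrow> 'e \<Rightarrow> 'e \<Rightarrow> real) \<Rightarrow> ('e \<Rightarrow> real) \<Rightarrow> 'e \<Rightarrow> 'e \<Rightarrow> 'e \<Rightarrow> real" where
  "weighted_sec h f x v u = sectional_curvature h x u v + hessian h f x v v"

definition weighted_sec_pos ::
  "('a, 'e::euclidean_space) atlas \<Rightarrow> ('a, 'e) metric \<Rightarrow> ('a \<Rightarrow> real) \<Rightarrow> bool" where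
  "weighted_sec_pos A g f \<longleftrightarrow>
     (\<forall>(U, \<phi>)\<in>A. \<forall>x\<in>\<phi> ` U. \<forall>u v.
        g (U, \<phi>) x u u = 1 \<and> g (U, \<phi>) x v v = 1 \<and> g (U, \<phi>) x u v = 0 \<longrightarrow>
        weighted_sec (g (U, \<phi>)) (f \<circ> inv_into U \<phi>) x v u > 0)"


section \<open>Lie groups and cohomogeneity one\<close>

definition lie_group :: "'g monoid \<Rightarrow> 'k::euclidean_space set \<Rightarrow> ('g, 'k) atlas \<Rightarrow> bool" where
  "lie_group G E B \<longleftrightarrow> group G \<and> smooth_manifold E B \<and> points B = carrier G \<and>
     smooth_map (E \<times> E) (prod_atlas B B) B (\<lambda>(a, b). a \<otimes>\<^bsub>G\<^esub> b) \<and>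
     smooth_map E B B (\<lambda>a. inv\<^bsub>G\<^esub> a)"

definition smooth_action ::
  "'g monoid \<Rightarrow> 'k::euclidean_space set \<Rightarrow> ('g, 'k) atlas \<Rightarrow>
   ('a, 'e::euclidean_space) atlas \<Rightarrow> ('g \<Rightarrow> 'a \<Rightarrow> 'a) \<Rightarrow> bool" where
  "smooth_action G E B A act \<longleftrightarrow> group_action G (points A) act \<and>
     smooth_map (E \<times> UNIV) (prod_atlas B A) A (\<lambda>(a, p). act a p)"

text \<open>The orbit of \<open>p\<close> is principal if the isotropy group of \<open>p\<close> is conjugate
  to a subgroup of every isotropy group (for actions on connected manifolds).\<close>

definition principal_point :: "'g monoid \<Rightarrow> 'a set \<Rightarrow> ('g \<Rightarrow> 'a \<Rightarrow> 'a) \<Rightarrow> 'a \<Rightarrow> bool" where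
  "principal_point G M act p \<longleftrightarrow> p \<in> M \<and>
     (\<forall>q\<in>M. \<exists>a\<in>carrier G.
        (\<lambda>b. a \<otimes>\<^bsub>G\<^esub> b \<otimes>\<^bsub>G\<^esub> inv\<^bsub>G\<^esub> a) ` stabilizer G act p \<subseteq> stabilizer G act q)"

text \<open>HOL cannot quantify over types inside a formula, so the type \<open>'k\<close> from which the
  elements and the coordinates of the group are taken is a parameter. The manifold topology on the
  carrier need not be the one of \<open>'k\<close>. For nontrivial \<open>'k\<close>, whose cardinality is that
  of the continuum, every Lie group of dimension at most \<open>DIM('k)\<close> is isomorphic to one
  occurring here. One may divide by the kernel of the action, and a compact Lie group acting
  effectively and isometrically on a connected \<open>m\<close>-manifold has dimension at most
  \<open>m (m + 1) / 2\<close>; so if \<open>DIM('k)\<close> is at least that number, nothing is lost.\<close>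

definition cohomogeneity_one ::
  "'k::euclidean_space itself \<Rightarrow> ('a, 'e::euclidean_space) atlas \<Rightarrow> ('a, 'e) metric \<Rightarrow> bool" where
  "cohomogeneity_one T A g \<longleftrightarrow>
     (\<exists>(G :: 'k monoid) (E :: 'k set) (B :: ('k, 'k) atlas) act.
        lie_group G E B \<and> compact_space (atlas_topology E B) \<and>
        smooth_action G E B A act \<and>
        (\<forall>a\<in>carrier G. metric_preserving A g (act a)) \<and>
        (\<exists>p. principal_point G (points A) act p) \<and>
        (\<forall>p. principal_point G (points A) act p \<longrightarrow>
           embedded_submanifold (DIM('e) - 1) A (orbit G act p)))"


section \<open>Complex projective space\<close>

text \<open>Points are complex lines through the origin of the space of homogeneous coordinates
  \<open>complex ^ 'n option\<close>, whose complex dimension is \<open>CARD('n) + 1\<close>.\<close>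

definition cline :: "complex ^ ('m::finite) \<Rightarrow> (complex ^ 'm) set" where
  "cline z = range (\<lambda>c. c *s z)"

definition cp_chart_dom :: "('n::finite) option \<Rightarrow> (complex ^ ('n option)) set set" where
  "cp_chart_dom i = {cline z | z. z $ i \<noteq> 0}"

text \<open>The affine coordinates \<open>z\<^sub>j / z\<^sub>i\<close>, \<open>j \<noteq> i\<close>. For \<open>i = Some k\<close> they are indexed
  by \<open>'n\<close> by letting the index \<open>k\<close> stand for the homogeneous coordinate
  \<open>None\<close>.\<close>

definition cp_chart :: "('n::finite) option \<Rightarrow> (complex ^ ('n option)) set \<Rightarrow> complex ^ 'n" where
  "cp_chart i L = (let z = (THE z. z \<in> L \<and> z $ i = 1)
                   in \<chi> j. z $ (if Some j = i then None else Some j))"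

definition CP :: "((complex ^ (('n::finite) option)) set, complex ^ 'n) atlas" where
  "CP = range (\<lambda>i. (cp_chart_dom i, cp_chart i))"

text \<open>Here the real manifold dimension is \<open>m = 2 n\<close> with \<open>n = CARD('n)\<close>, and the type
  \<open>complex ^ 'n option ^ 'n option\<close> of matrices has real dimension
  \<open>2 (n + 1)\<^sup>2 \<ge> m (m + 1) / 2\<close>, so it is a suitable parameter of
  \<open>cohomogeneity_one\<close> for \<open>CP\<close>.\<close>

lemma points_CP: "points CP = {cline z | z. z \<noteq> 0}"
  unfolding points_def CP_def cp_chart_dom_def by (auto simp: vec_eq_iff)

lemma cp_chart_cline:
  assumes "z $ i \<noteq> 0"
  shows "cp_chart i (cline z) = (\<chi> j. z $ (if Some j = i then None else Some j) / z $ i)"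
proof -
  have "(THE w. w \<in> cline z \<and> w $ i = 1) = (1 / z $ i) *s z"
    using assms by (intro the_equality) (auto simp: cline_def vec_eq_iff field_simps)
  then show ?thesis
    by (simp add: cp_chart_def vec_eq_iff)
qed

end

theory Submission
  imports Defs
begin

text \<open>Let \<open>g\<^sub>0\<close> be the Fubini-Study metric with \<open>1 \<le> sec \<le> 4\<close>, and let
  \<open>s \<in> [0, 1]\<close> be the squared sine of the distance from the point \<open>p = [1 : 0 : \<dots> : 0]\<close>. The
  gradient of \<open>s\<close> has norm squared \<open>4 s (1 - s)\<close> and its Hessian lies between
  \<open>2 (1 - 2 s)\<close> and \<open>2 (1 - s)\<close>. Hence the conformal metric \<open>exp (2 a s) g\<^sub>0\<close> has, up to
  the factor \<open>exp (- 2 a s)\<close>, sectional curvatures at least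
  \<open>\<kappa> - 4 a (1 - s) - 4 a\<^sup>2 s (1 - s)\<close>, where \<open>\<kappa>\<close> is the least curvature of \<open>g\<^sub>0\<close>
  (so \<open>\<kappa> = 4\<close> for \<open>n = 1\<close> and \<open>\<kappa> = 1\<close> otherwise), with equality at \<open>p\<close>. For
  \<open>4 a\<close> slightly larger than \<open>\<kappa>\<close> the only planes that are not positively curved lie near \<open>p\<close>,
  where \<open>s\<close> is strictly convex, so that a small multiple of \<open>s\<close> is a density with positive weighted
  curvature. The metric is invariant under \<open>U(n)\<close>, whose principal orbits are the distance
  spheres around \<open>p\<close>.\<close>

section \<open>Calculus of smooth functions\<close>

text \<open>The conformal factor and the density depend on the same function \<open>s\<close>, and a
  unit vector of the new metric has squared Fubini-Study length \<open>exp (- 2 a s)\<close>. This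
  factor comes out of the curvature term and of the Hessian term alike, so positivity becomes a
  quadratic inequality in \<open>s\<close> on the unit interval. Two obstacles shape the
  development. The Levi-Civita connection is given in real coordinates by a definite description;
  instead of expanding it in a basis, the Hermitian product supplies closed candidates for
  connection, gradient and curvature, and a symmetric metric connection is unique. Tangent vectors
  are lifted to homogeneous coordinates, where the form is degenerate along the line itself, so that
  computations need no case split over charts. The other obstacle is that cohomogeneity one demands
  explicit manifold structures: Cayley transforms map pieces of the group onto its Lie algebra, a
  linear model space, and inversions flatten the distance spheres.\<close>

lemma Ck_on_subset: "Ck_on k S f \<Longrightarrow> T \<subseteq> S \<Longrightarrow> Ck_on k T f"
  by (induction k arbitrary: f) (auto intro: continuous_on_subset)

text \<open>\<open>Ck_on\<close> takes derivatives in the full space, and at points of an open set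
  these depend only on the values in that set; the induction then applies to the
  derivatives.\<close>

lemma Ck_on_cong:
  assumes "open S" "\<And>x. x \<in> S \<Longrightarrow> f x = g x" "Ck_on k S f"
  shows "Ck_on k S g"
  using assms(2-)
proof (induction k arbitrary: f g)
  case 0
  then show ?case by (simp cong: continuous_on_cong)
next
  case (Suc k)
  have d: "(g has_derivative frechet_derivative f (at x)) (at x)" if "x \<in> S" for x
  proof (rule has_derivative_transform_within_open)
    show "(f has_derivative frechet_derivative f (at x)) (at x)"
      using Suc.prems(2) that frechet_derivative_works by auto
  qed (use assms(1) that Suc.prems(1) in auto)
  have "frechet_derivative f (at x) v = frechet_derivative g (at x) v" if "x \<in> S" for x v
    using frechet_derivative_at[OF d[OF that]] by simp
  then have "Ck_on k S (\<lambda>x. frechet_derivative g (at x) v)" for v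
    using Suc.IH[of "\<lambda>x. frechet_derivative f (at x) v" "\<lambda>x. frechet_derivative g (at x) v"]
      Suc.prems(2) by simp
  then show ?case
    using d differentiable_def by fastforce
qed

text \<open>The closure properties below come with explicit derivative formulas; this rule lets any
  such formula \<open>f'\<close> stand in for \<open>frechet_derivative\<close>.\<close>

lemma Ck_on_SucI:
  assumes "open S" and d: "\<And>x. x \<in> S \<Longrightarrow> (f has_derivative f' x) (at x)"
    and "\<And>v. Ck_on k S (\<lambda>x. f' x v)"
  shows "Ck_on (Suc k) S f"
proof -
  have "frechet_derivative f (at x) v = f' x v" if "x \<in> S" for x v
    using frechet_derivative_at[OF d[OF that]] by simp
  then have "Ck_on k S (\<lambda>x. frechet_derivative f (at x) v)" for v
    using Ck_on_cong[OF assms(1) _ assms(3)[of v]] by simp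
  then show ?thesis
    using d differentiable_def by fastforce
qed

lemma Ck_on_has_derivative:
  "Ck_on (Suc k) S f \<Longrightarrow> x \<in> S \<Longrightarrow> (f has_derivative frechet_derivative f (at x)) (at x)"
  using frechet_derivative_works by auto

lemma Ck_on_lower: "Ck_on (Suc k) S f \<Longrightarrow> Ck_on k S f"
proof (induction k arbitrary: f)
  case 0
  then show ?case
    by (auto intro!: continuous_at_imp_continuous_on differentiable_imp_continuous_within)
next
  case (Suc k)
  then show ?case by (metis Ck_on.simps(2))
qed

lemma Ck_on_const: "Ck_on k S (\<lambda>x. c)"
  by (induction k arbitrary: c) auto

lemma Ck_on_bounded_linear:
  assumes "bounded_linear L" "open S" shows "Ck_on k S L"
proof (cases k)
  case 0
  then show ?thesis using assms(1) by (simp add: linear_continuous_on)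
next
  case (Suc j)
  have "Ck_on (Suc j) S L"
    by (rule Ck_on_SucI[of _ _ "\<lambda>x. L"])
      (use assms in \<open>auto intro: bounded_linear_imp_has_derivative Ck_on_const\<close>)
  then show ?thesis using Suc by simp
qed

lemma Ck_on_add:
  assumes "open S" "Ck_on k S f" "Ck_on k S g"
  shows "Ck_on k S (\<lambda>x. f x + g x)"
  using assms(2-)
proof (induction k arbitrary: f g)
  case 0
  then show ?case by (simp add: continuous_on_add)
next
  case (Suc k)
  show ?case
  proof (rule Ck_on_SucI[OF assms(1)])
    show "((\<lambda>x. f x + g x) has_derivative
        (\<lambda>v. frechet_derivative f (at x) v + frechet_derivative g (at x) v)) (at x)" if "x \<in> S" for x
      using Suc.prems that by (intro has_derivative_add Ck_on_has_derivative)
    show "Ck_on k S (\<lambda>x. frechet_derivative f (at x) v + frechet_derivative g (at x) v)" for v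
      using Suc by simp
  qed
qed

lemma Ck_on_sum:
  assumes "open S" "\<And>i. i \<in> I \<Longrightarrow> Ck_on k S (f i)"
  shows "Ck_on k S (\<lambda>x. \<Sum>i\<in>I. f i x)"
  using assms(2)
  by (induction I rule: infinite_finite_induct) (auto intro: Ck_on_const Ck_on_add[OF assms(1)])

text \<open>The product rule yields two summands of the same bilinear shape, hence the induction
  over all \<open>f\<close> and \<open>g\<close>. Products, scalings, inner products and the
  Hermitian product are instances.\<close>

lemma Ck_on_bilinear:
  assumes B: "bounded_bilinear B" and S: "open S" and "Ck_on k S f" "Ck_on k S g"
  shows "Ck_on k S (\<lambda>x. B (f x) (g x))"
  using assms(3-)
proof (induction k arbitrary: f g)
  case 0
  then show ?case by (simp add: bounded_bilinear.continuous_on[OF B])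
next
  case (Suc k)
  show ?case
  proof (rule Ck_on_SucI[OF S])
    show "((\<lambda>x. B (f x) (g x)) has_derivative
        (\<lambda>v. B (f x) (frechet_derivative g (at x) v) + B (frechet_derivative f (at x) v) (g x))) (at x)"
      if "x \<in> S" for x
      using Suc.prems that
      by (intro bounded_bilinear.FDERIV[OF B] Ck_on_has_derivative)
    show "Ck_on k S
        (\<lambda>x. B (f x) (frechet_derivative g (at x) v) + B (frechet_derivative f (at x) v) (g x))" for v
      using Suc.prems Ck_on_lower[OF Suc.prems(1)] Ck_on_lower[OF Suc.prems(2)]
      by (intro Ck_on_add[OF S] Suc.IH) simp_all
  qed
qed

lemma Ck_on_compose:
  assumes S: "open S" and T: "open T" and "f ` S \<subseteq> T" "Ck_on k S f" "Ck_on k T g"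
  shows "Ck_on k S (\<lambda>x. g (f x))"
  using assms(4-)
proof (induction k arbitrary: g)
  case 0
  then show ?case using assms(3) by (auto intro: continuous_on_compose2)
next
  case (Suc k)
  let ?D = "frechet_derivative"
  show ?case
  proof (rule Ck_on_SucI[OF S])
    fix x assume x: "x \<in> S"
    have g: "(g has_derivative ?D g (at (f x))) (at (f x))"
      using Ck_on_has_derivative[OF Suc.prems(2)] x assms(3) by blast
    have d: "((\<lambda>x. g (f x)) has_derivative (\<lambda>v. ?D g (at (f x)) (?D f (at x) v))) (at x)"
      using diff_chain_at[OF Ck_on_has_derivative[OF Suc.prems(1) x] g] by (simp add: o_def)
    \<comment> \<open>The induction hypothesis covers the derivative of \<open>g\<close> only in a
      fixed direction \<open>b\<close>. Expanding over the basis leaves the moving direction in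
      scalar coefficients.\<close>
    have e: "?D g (at (f x)) w = (\<Sum>b\<in>Basis. (w \<bullet> b) *\<^sub>R ?D g (at (f x)) b)" for w
    proof -
      have l: "linear (?D g (at (f x)))" using g by (rule has_derivative_linear)
      have "?D g (at (f x)) (\<Sum>b\<in>Basis. (w \<bullet> b) *\<^sub>R b) = (\<Sum>b\<in>Basis. (w \<bullet> b) *\<^sub>R ?D g (at (f x)) b)"
        by (simp add: linear_sum[OF l] linear_scale[OF l])
      then show ?thesis by (simp add: euclidean_representation)
    qed
    show "((\<lambda>x. g (f x)) has_derivative
        (\<lambda>v. \<Sum>b\<in>Basis. (?D f (at x) v \<bullet> b) *\<^sub>R ?D g (at (f x)) b)) (at x)"
      by (rule has_derivative_eq_rhs[OF d]) (rule ext, rule e)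
  next
    fix v
    show "Ck_on k S (\<lambda>x. \<Sum>b\<in>Basis. (?D f (at x) v \<bullet> b) *\<^sub>R ?D g (at (f x)) b)"
    proof (rule Ck_on_sum[OF S], rule Ck_on_bilinear[OF bounded_bilinear_scaleR S])
      fix b :: 'b
      show "Ck_on k S (\<lambda>x. ?D f (at x) v \<bullet> b)"
        using Suc.prems
        by (intro Ck_on_bilinear[OF bounded_bilinear_inner S] Ck_on_const) simp
      show "Ck_on k S (\<lambda>x. ?D g (at (f x)) b)"
        using Suc.prems Ck_on_lower[OF Suc.prems(1)] by (intro Suc.IH) simp_all
    qed
  qed
qed

lemma Ck_on_inverse:
  fixes f :: "'e::euclidean_space \<Rightarrow> 'a::{real_normed_field, euclidean_space}"
  assumes S: "open S" and "\<And>x. x \<in> S \<Longrightarrow> f x \<noteq> 0" "Ck_on k S f"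
  shows "Ck_on k S (\<lambda>x. inverse (f x))"
  using assms(3)
proof (induction k)
  case 0
  then show ?case using assms(2) by (auto intro: continuous_on_inverse)
next
  case (Suc k)
  let ?D = "frechet_derivative"
  show ?case
  proof (rule Ck_on_SucI[OF S])
    show "((\<lambda>x. inverse (f x)) has_derivative
        (\<lambda>v. - (inverse (f x) * ?D f (at x) v * inverse (f x)))) (at x)" if "x \<in> S" for x
      using Suc.prems assms(2) that
      by (intro Deriv.has_derivative_inverse Ck_on_has_derivative) auto
    show "Ck_on k S (\<lambda>x. - (inverse (f x) * ?D f (at x) v * inverse (f x)))" for v
    proof -
      have i: "Ck_on k S (\<lambda>x. inverse (f x))" using Suc Ck_on_lower by blast
      have "Ck_on k S (\<lambda>x. ((- 1) * inverse (f x)) * ?D f (at x) v * inverse (f x))"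
        using Suc.prems i
        by (intro Ck_on_bilinear[OF bounded_bilinear_mult S] Ck_on_const) simp_all
      then show ?thesis by simp
    qed
  qed
qed

lemma Ck_on_exp:
  fixes f :: "'e::euclidean_space \<Rightarrow> real"
  assumes S: "open S" and "Ck_on k S f"
  shows "Ck_on k S (\<lambda>x. exp (f x))"
  using assms(2)
proof (induction k)
  case 0
  then show ?case by (auto intro: continuous_on_exp)
next
  case (Suc k)
  let ?D = "frechet_derivative"
  show ?case
  proof (rule Ck_on_SucI[OF S])
    show "((\<lambda>x. exp (f x)) has_derivative (\<lambda>v. ?D f (at x) v * exp (f x))) (at x)" if "x \<in> S" for x
      by (rule has_derivative_eq_rhs, rule has_derivative_exp[OF Ck_on_has_derivative[OF Suc.prems that]])
        (auto simp: mult.commute)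
    show "Ck_on k S (\<lambda>x. ?D f (at x) v * exp (f x))" for v
      using Suc Ck_on_lower[OF Suc.prems]
      by (intro Ck_on_bilinear[OF bounded_bilinear_mult S]) simp_all
  qed
qed

section \<open>Smoothness on arbitrary subsets by local extension\<close>

lemma smooth_onE:
  assumes "smooth_on S f" "x \<in> S"
  obtains U F where "open U" "x \<in> U" "\<And>k. Ck_on k U F" "\<And>y. y \<in> S \<Longrightarrow> y \<in> U \<Longrightarrow> F y = f y"
proof -
  have "\<exists>U F. open U \<and> x \<in> U \<and> (\<forall>k. Ck_on k U F) \<and> (\<forall>y\<in>S \<inter> U. F y = f y)"
    using assms(1)[unfolded smooth_on_def] assms(2) by (rule bspec)
  then obtain U F where "open U" "x \<in> U" "\<forall>k. Ck_on k U F" "\<forall>y\<in>S \<inter> U. F y = f y"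
    by (elim exE conjE)
  then show thesis by (intro that[of U F]) auto
qed

lemma smooth_onI:
  assumes "\<And>x. x \<in> S \<Longrightarrow>
    \<exists>U F. open U \<and> x \<in> U \<and> (\<forall>k. Ck_on k U F) \<and> (\<forall>y\<in>S \<inter> U. F y = f y)"
  shows "smooth_on S f"
  unfolding smooth_on_def by (rule ballI) (rule assms)

lemma smooth_on_open: "open S \<Longrightarrow> (\<And>k. Ck_on k S f) \<Longrightarrow> smooth_on S f"
  by (rule smooth_onI) (rule exI[of _ S], rule exI[of _ f], auto)

lemma smooth_on_cong:
  "smooth_on S f \<Longrightarrow> (\<And>x. x \<in> S \<Longrightarrow> f x = g x) \<Longrightarrow> smooth_on S g"
  unfolding smooth_on_def by auto

lemma smooth_on_subset:
  assumes "smooth_on S f" "T \<subseteq> S" shows "smooth_on T f"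
proof (rule smooth_onI)
  fix x assume "x \<in> T"
  then have x: "x \<in> S" using assms(2) by blast
  obtain U F where "open U" "x \<in> U" "\<And>k. Ck_on k U F" "\<And>y. y \<in> S \<Longrightarrow> y \<in> U \<Longrightarrow> F y = f y"
    by (rule smooth_onE[OF assms(1) x]) blast
  then show "\<exists>U F. open U \<and> x \<in> U \<and> (\<forall>k. Ck_on k U F) \<and> (\<forall>y\<in>T \<inter> U. F y = f y)"
    using assms(2) by (intro exI[of _ U] exI[of _ F]) auto
qed

lemma smooth_on_imp_continuous_on:
  assumes "smooth_on S f" shows "continuous_on S f"
  unfolding continuous_on_eq_continuous_within
proof
  fix x assume x: "x \<in> S"
  obtain U F where U: "open U" "x \<in> U" "\<And>k. Ck_on k U F"
    "\<And>y. y \<in> S \<Longrightarrow> y \<in> U \<Longrightarrow> F y = f y"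
    by (rule smooth_onE[OF assms x]) blast
  have "continuous (at x within S) F"
    using U(3)[of 0] U(1,2) by (simp add: continuous_on_eq_continuous_at continuous_at_imp_continuous_within)
  then show "continuous (at x within S) f"
    by (rule continuous_transform_within_openin[where S = "S \<inter> U"])
      (use U x in \<open>auto simp: openin_open_Int\<close>)
qed

lemma smooth_on_const: "smooth_on S (\<lambda>x. c)"
  by (rule smooth_on_subset[OF smooth_on_open[OF open_UNIV]]) (auto intro: Ck_on_const)

lemma smooth_on_compose:
  assumes f: "smooth_on S f" and g: "smooth_on T g" and "f ` S \<subseteq> T"
  shows "smooth_on S (\<lambda>x. g (f x))"
proof (rule smooth_onI)
  fix x assume x: "x \<in> S"
  obtain U F where U: "open U" "x \<in> U" "\<And>k. Ck_on k U F" "\<And>y. y \<in> S \<Longrightarrow> y \<in> U \<Longrightarrow> F y = f y"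
    by (rule smooth_onE[OF f x]) blast
  have "f x \<in> T" using x assms(3) by blast
  then obtain V G where V: "open V" "f x \<in> V" "\<And>k. Ck_on k V G"
    "\<And>y. y \<in> T \<Longrightarrow> y \<in> V \<Longrightarrow> G y = g y"
    by (rule smooth_onE[OF g]) blast
  \<comment> \<open>The extension \<open>F\<close> may leave \<open>V\<close> off the set
    \<open>S\<close>, so its domain is cut down to the preimage.\<close>
  let ?W = "U \<inter> F -` V"
  have W: "open ?W"
    using U(1) U(3)[of 0] V(1) by (simp add: continuous_on_open_vimage Int_commute)
  have "Ck_on k ?W (\<lambda>x. G (F x))" for k
    by (rule Ck_on_compose[OF W V(1)]) (auto intro: Ck_on_subset[OF U(3)] V(3))
  then show "\<exists>U H. open U \<and> x \<in> U \<and> (\<forall>k. Ck_on k U H) \<and> (\<forall>y\<in>S \<inter> U. H y = g (f y))"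
    using W U V x assms(3) by (intro exI[of _ ?W] exI[of _ "\<lambda>x. G (F x)"]) auto
qed

lemma smooth_on_bounded_linear:
  assumes "bounded_linear L" "smooth_on S f"
  shows "smooth_on S (\<lambda>x. L (f x))"
proof (rule smooth_on_compose[OF assms(2)])
  show "smooth_on UNIV L"
    by (intro smooth_on_open Ck_on_bounded_linear assms(1) open_UNIV)
qed auto

lemma smooth_on_ident: "smooth_on S (\<lambda>x. x)"
  by (rule smooth_on_subset[OF smooth_on_open[OF open_UNIV]])
    (auto intro: Ck_on_bounded_linear bounded_linear_ident)

lemma smooth_on_bilinear:
  assumes B: "bounded_bilinear B" and f: "smooth_on S f" and g: "smooth_on S g"
  shows "smooth_on S (\<lambda>x. B (f x) (g x))"
proof (rule smooth_onI)
  fix x assume x: "x \<in> S"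
  obtain U F where U: "open U" "x \<in> U" "\<And>k. Ck_on k U F" "\<And>y. y \<in> S \<Longrightarrow> y \<in> U \<Longrightarrow> F y = f y"
    by (rule smooth_onE[OF f x]) blast
  obtain V G where V: "open V" "x \<in> V" "\<And>k. Ck_on k V G" "\<And>y. y \<in> S \<Longrightarrow> y \<in> V \<Longrightarrow> G y = g y"
    by (rule smooth_onE[OF g x]) blast
  have "Ck_on k (U \<inter> V) (\<lambda>x. B (F x) (G x))" for k
    by (rule Ck_on_bilinear[OF B]) (auto simp: U V open_Int intro: Ck_on_subset[OF U(3)] Ck_on_subset[OF V(3)])
  then show "\<exists>U H. open U \<and> x \<in> U \<and> (\<forall>k. Ck_on k U H) \<and> (\<forall>y\<in>S \<inter> U. H y = B (f y) (g y))"
    using U V by (intro exI[of _ "U \<inter> V"] exI[of _ "\<lambda>x. B (F x) (G x)"]) auto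
qed

lemma smooth_on_add:
  assumes f: "smooth_on S f" and g: "smooth_on S g"
  shows "smooth_on S (\<lambda>x. f x + g x)"
proof (rule smooth_onI)
  fix x assume x: "x \<in> S"
  obtain U F where U: "open U" "x \<in> U" "\<And>k. Ck_on k U F" "\<And>y. y \<in> S \<Longrightarrow> y \<in> U \<Longrightarrow> F y = f y"
    by (rule smooth_onE[OF f x]) blast
  obtain V G where V: "open V" "x \<in> V" "\<And>k. Ck_on k V G" "\<And>y. y \<in> S \<Longrightarrow> y \<in> V \<Longrightarrow> G y = g y"
    by (rule smooth_onE[OF g x]) blast
  have "Ck_on k (U \<inter> V) (\<lambda>x. F x + G x)" for k
    by (rule Ck_on_add) (auto simp: U V open_Int intro: Ck_on_subset[OF U(3)] Ck_on_subset[OF V(3)])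
  then show "\<exists>U H. open U \<and> x \<in> U \<and> (\<forall>k. Ck_on k U H) \<and> (\<forall>y\<in>S \<inter> U. H y = f y + g y)"
    using U V by (intro exI[of _ "U \<inter> V"] exI[of _ "\<lambda>x. F x + G x"]) auto
qed

lemma smooth_on_inverse:
  fixes f :: "'e::euclidean_space \<Rightarrow> 'a::{real_normed_field, euclidean_space}"
  assumes "smooth_on S f" "\<And>x. x \<in> S \<Longrightarrow> f x \<noteq> 0"
  shows "smooth_on S (\<lambda>x. inverse (f x))"
proof (rule smooth_on_compose[OF assms(1)])
  show "smooth_on (- {0}) (inverse :: 'a \<Rightarrow> 'a)"
    by (intro smooth_on_open Ck_on_inverse Ck_on_bounded_linear[OF bounded_linear_ident]) auto
qed (use assms(2) in auto)

lemma smooth_on_exp: "smooth_on S f \<Longrightarrow> smooth_on S (\<lambda>x. exp (f x :: real))"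
proof (erule smooth_on_compose)
  show "smooth_on UNIV (exp :: real \<Rightarrow> real)"
    by (intro smooth_on_open Ck_on_exp Ck_on_bounded_linear[OF bounded_linear_ident]) auto
qed auto

lemma smooth_on_mult:
  fixes f g :: "'e::euclidean_space \<Rightarrow> 'a::{real_normed_field, euclidean_space}"
  shows "smooth_on S f \<Longrightarrow> smooth_on S g \<Longrightarrow> smooth_on S (\<lambda>x. f x * g x)"
  by (rule smooth_on_bilinear[OF bounded_bilinear_mult])

lemma smooth_on_scaleR: "smooth_on S f \<Longrightarrow> smooth_on S g \<Longrightarrow> smooth_on S (\<lambda>x. f x *\<^sub>R g x)"
  by (rule smooth_on_bilinear[OF bounded_bilinear_scaleR])

lemma smooth_on_inner: "smooth_on S f \<Longrightarrow> smooth_on S g \<Longrightarrow> smooth_on S (\<lambda>x. f x \<bullet> g x)"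
  by (rule smooth_on_bilinear[OF bounded_bilinear_inner])

lemma smooth_on_uminus: "smooth_on S f \<Longrightarrow> smooth_on S (\<lambda>x. - f x)"
  using smooth_on_bounded_linear[OF bounded_linear_minus[OF bounded_linear_ident]] .

lemma smooth_on_diff: "smooth_on S f \<Longrightarrow> smooth_on S g \<Longrightarrow> smooth_on S (\<lambda>x. f x - g x)"
  using smooth_on_add[OF _ smooth_on_uminus, of S f g] by simp

lemma smooth_on_divide:
  fixes f g :: "'e::euclidean_space \<Rightarrow> 'a::{real_normed_field, euclidean_space}"
  shows "smooth_on S f \<Longrightarrow> smooth_on S g \<Longrightarrow> (\<And>x. x \<in> S \<Longrightarrow> g x \<noteq> 0) \<Longrightarrow> smooth_on S (\<lambda>x. f x / g x)"
  unfolding divide_inverse by (intro smooth_on_mult smooth_on_inverse)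

lemma smooth_on_sum:
  "(\<And>i. i \<in> I \<Longrightarrow> smooth_on S (f i)) \<Longrightarrow> smooth_on S (\<lambda>x. \<Sum>i\<in>I. f i x)"
  by (induction I rule: infinite_finite_induct) (auto intro: smooth_on_const smooth_on_add)

lemma smooth_on_prod:
  fixes f :: "'i \<Rightarrow> 'e::euclidean_space \<Rightarrow> 'a::{real_normed_field, euclidean_space}"
  shows "(\<And>i. i \<in> I \<Longrightarrow> smooth_on S (f i)) \<Longrightarrow> smooth_on S (\<lambda>x. \<Prod>i\<in>I. f i x)"
  by (induction I rule: infinite_finite_induct) (auto intro: smooth_on_const smooth_on_mult)

lemma smooth_on_Pair:
  assumes "smooth_on S f" "smooth_on S g" shows "smooth_on S (\<lambda>x. (f x, g x))"
proof -
  have "bounded_linear (\<lambda>a::'b. (a, 0::'c))" "bounded_linear (\<lambda>b::'c. (0::'b, b))"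
    by (auto intro!: bounded_linear_Pair bounded_linear_ident bounded_linear_zero)
  then have "smooth_on S (\<lambda>x. (f x, 0) + (0, g x))"
    using assms by (intro smooth_on_add) (rule smooth_on_bounded_linear; assumption)+
  then show ?thesis by simp
qed

lemma smooth_on_vec:
  fixes f :: "'e::euclidean_space \<Rightarrow> 'i::finite \<Rightarrow> 'a::euclidean_space"
  assumes "\<And>i. smooth_on S (\<lambda>x. f x i)" shows "smooth_on S (\<lambda>x. \<chi> i. f x i)"
proof -
  have "bounded_linear (\<lambda>a::'a. axis i a :: 'a ^ 'i)" for i
    by (rule linear_conv_bounded_linear[THEN iffD1], rule linearI) (auto simp: vec_eq_iff axis_def)
  then have "smooth_on S (\<lambda>x. \<Sum>i\<in>UNIV. axis i (f x i))"
    by (intro smooth_on_sum) (rule smooth_on_bounded_linear, assumption, rule assms)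
  moreover have "(\<Sum>i\<in>UNIV. axis i (f x i)) = (\<chi> i. f x i)" for x
    by (simp add: vec_eq_iff axis_def if_distrib cong: if_cong)
  ultimately show ?thesis by simp
qed

lemma smooth_on_nth: "smooth_on S f \<Longrightarrow> smooth_on S (\<lambda>x. f x $ i)"
  by (rule smooth_on_bounded_linear[OF bounded_linear_vec_nth])

lemma smooth_on_cnj: "smooth_on S f \<Longrightarrow> smooth_on S (\<lambda>x. cnj (f x))"
  by (rule smooth_on_bounded_linear[OF bounded_linear_cnj])

lemma smooth_on_Re: "smooth_on S f \<Longrightarrow> smooth_on S (\<lambda>x. Re (f x))"
  by (rule smooth_on_bounded_linear[OF bounded_linear_Re])

lemma smooth_on_of_real: "smooth_on S f \<Longrightarrow> smooth_on S (\<lambda>x. complex_of_real (f x))"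
  by (rule smooth_on_bounded_linear[OF bounded_linear_of_real])

lemma smooth_on_fst: "smooth_on S f \<Longrightarrow> smooth_on S (\<lambda>x. fst (f x))"
  by (rule smooth_on_bounded_linear[OF bounded_linear_fst])

lemma smooth_on_snd: "smooth_on S f \<Longrightarrow> smooth_on S (\<lambda>x. snd (f x))"
  by (rule smooth_on_bounded_linear[OF bounded_linear_snd])

lemma smooth_on_power2: "smooth_on S f \<Longrightarrow> smooth_on S (\<lambda>x. (f x :: real)\<^sup>2)"
  unfolding power2_eq_square by (rule smooth_on_mult)

lemmas smooth_on_intros = smooth_on_const smooth_on_ident smooth_on_add smooth_on_diff
  smooth_on_uminus smooth_on_mult smooth_on_scaleR smooth_on_inner smooth_on_sum smooth_on_prod
  smooth_on_Pair smooth_on_vec smooth_on_nth smooth_on_cnj smooth_on_Re smooth_on_of_real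
  smooth_on_fst smooth_on_snd smooth_on_power2 smooth_on_exp

section \<open>Smoothness of matrix products, determinants and inverses\<close>

lemma smooth_on_vector_smult:
  fixes f :: "'e::euclidean_space \<Rightarrow> complex" and g :: "'e \<Rightarrow> complex ^ 'm::finite"
  shows "smooth_on S f \<Longrightarrow> smooth_on S g \<Longrightarrow> smooth_on S (\<lambda>x. f x *s g x)"
  unfolding vector_scalar_mult_def by (intro smooth_on_intros)

lemma smooth_on_matrix_mult:
  fixes f :: "'e::euclidean_space \<Rightarrow> complex ^ 'm::finite ^ 'l::finite" and g :: "'e \<Rightarrow> complex ^ 'n::finite ^ 'm"
  shows "smooth_on S f \<Longrightarrow> smooth_on S g \<Longrightarrow> smooth_on S (\<lambda>x. f x ** g x)"
  unfolding matrix_matrix_mult_def by (intro smooth_on_intros)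

lemma smooth_on_matrix_vector_mult:
  fixes f :: "'e::euclidean_space \<Rightarrow> complex ^ 'm::finite ^ 'l::finite" and g :: "'e \<Rightarrow> complex ^ 'm"
  shows "smooth_on S f \<Longrightarrow> smooth_on S g \<Longrightarrow> smooth_on S (\<lambda>x. f x *v g x)"
  unfolding matrix_vector_mult_def by (intro smooth_on_intros)

lemma smooth_on_det:
  fixes f :: "'e::euclidean_space \<Rightarrow> complex ^ 'm::finite ^ 'm"
  shows "smooth_on S f \<Longrightarrow> smooth_on S (\<lambda>x. det (f x))"
  unfolding det_def by (intro smooth_on_intros)

lemma matrix_inv_right:
  fixes A :: "'a::field ^ 'n ^ 'n"
  assumes "det A \<noteq> 0" shows "A ** matrix_inv A = mat 1"
  using assms unfolding invertible_det_nz[symmetric] invertible_def matrix_inv_def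
  by (rule someI_ex[THEN conjunct1])

text \<open>Cramer's rule gives the entries of the inverse as quotients of determinants, and
  determinants are polynomials in the entries.\<close>

lemma smooth_on_matrix_inv:
  fixes f :: "'e::euclidean_space \<Rightarrow> complex ^ 'm::finite ^ 'm"
  assumes f: "smooth_on S f" and nz: "\<And>x. x \<in> S \<Longrightarrow> det (f x) \<noteq> 0"
  shows "smooth_on S (\<lambda>x. matrix_inv (f x))"
proof (rule smooth_on_cong)
  let ?M = "\<lambda>x k j. \<chi> i l. if l = k then axis j 1 $ i else f x $ i $ l"
  show "smooth_on S (\<lambda>x. \<chi> k j. det (?M x k j) / det (f x))"
  proof (intro smooth_on_vec smooth_on_divide smooth_on_det f nz)
    fix k i l and j :: 'm
    show "smooth_on S (\<lambda>x. if l = k then axis j 1 $ i else f x $ i $ l)"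
      by (cases "l = k") (simp_all add: smooth_on_const smooth_on_nth f)
  qed
next
  fix x assume x: "x \<in> S"
  have inv: "f x ** matrix_inv (f x) = mat 1"
    by (rule matrix_inv_right[OF nz[OF x]])
  have col: "column j A = A *v axis j 1" for A :: "complex ^ 'm ^ 'm" and j
    by (simp add: vec_eq_iff column_def matrix_vector_mult_def axis_def if_distrib cong: if_cong)
  have "f x *v column j (matrix_inv (f x)) = axis j 1" for j
    unfolding col matrix_vector_mul_assoc inv by (rule matrix_vector_mul_lid)
  then have "column j (matrix_inv (f x)) =
     (\<chi> k. det (\<chi> i l. if l = k then axis j 1 $ i else f x $ i $ l) / det (f x))" for j
    using cramer[OF nz[OF x]] by blast
  then show "(\<chi> k j. det (\<chi> i l. if l = k then axis j 1 $ i else f x $ i $ l) / det (f x)) = matrix_inv (f x)"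
    by (simp add: vec_eq_iff column_def)
qed

section \<open>Hermitian forms and the affine charts\<close>

definition herm :: "complex ^ ('m::finite) \<Rightarrow> complex ^ 'm \<Rightarrow> complex" where
  "herm x y = (\<Sum>m\<in>UNIV. cnj (x $ m) * y $ m)"

lemma herm_add_left: "herm (x + y) z = herm x z + herm y z"
  by (simp add: herm_def algebra_simps sum.distrib)

lemma herm_add_right: "herm z (x + y) = herm z x + herm z y"
  by (simp add: herm_def algebra_simps sum.distrib)

lemma herm_diff_left: "herm (x - y) z = herm x z - herm y z"
  by (simp add: herm_def algebra_simps sum_subtractf)

lemma herm_diff_right: "herm z (x - y) = herm z x - herm z y"
  by (simp add: herm_def algebra_simps sum_subtractf)

lemma herm_minus_left: "herm (- x) z = - herm x z"
  by (simp add: herm_def sum_negf)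

lemma herm_minus_right: "herm z (- x) = - herm z x"
  by (simp add: herm_def sum_negf)

lemma herm_smult_left: "herm (c *s x) z = cnj c * herm x z"
  by (simp add: herm_def sum_distrib_left algebra_simps)

lemma herm_smult_right: "herm z (c *s x) = c * herm z x"
  by (simp add: herm_def sum_distrib_left algebra_simps)

lemma scaleR_eq_smult: "r *\<^sub>R (x :: complex ^ 'm) = complex_of_real r *s x"
  by (simp add: vec_eq_iff scaleR_conv_of_real[where 'a = complex])

lemma herm_scaleR_left: "herm (r *\<^sub>R x) z = of_real r * herm x z"
  by (simp only: scaleR_eq_smult herm_smult_left) simp

lemma herm_scaleR_right: "herm z (r *\<^sub>R x) = of_real r * herm z x"
  by (simp only: scaleR_eq_smult herm_smult_right)

lemma herm_zero [simp]: "herm 0 z = 0" "herm z 0 = 0"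
  by (simp_all add: herm_def)

lemmas herm_simps = herm_add_left herm_add_right herm_diff_left herm_diff_right
  herm_minus_left herm_minus_right herm_smult_left herm_smult_right

lemma cnj_herm: "cnj (herm x y) = herm y x"
  by (simp add: herm_def algebra_simps)

lemma Re_herm: "Re (herm x y) = x \<bullet> y"
  by (simp add: herm_def inner_vec_def inner_complex_def)

lemma herm_self: "herm x x = of_real ((norm x)\<^sup>2)"
proof -
  have "Im (herm x x) = 0" using arg_cong[OF cnj_herm[of x x], of Im] by simp
  then show ?thesis by (simp add: complex_eq_iff Re_herm power2_norm_eq_inner)
qed

lemma herm_axis_left: "herm (axis i 1) y = y $ i"
  by (simp add: herm_def axis_def if_distrib[of cnj] if_distrib[of "\<lambda>c. c * _"] cong: if_cong)

lemma herm_axis_right: "herm y (axis i 1) = cnj (y $ i)"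
  by (metis cnj_herm herm_axis_left)

lemma norm_herm_le: "cmod (herm x y) \<le> norm x * norm y"
proof (cases "herm x y = 0")
  case False
  \<comment> \<open>Multiplying \<open>y\<close> by the unit scalar \<open>c\<close> makes the
    Hermitian product real and nonnegative, so that the real Cauchy-Schwarz inequality
    applies.\<close>
  define c where "c = cnj (herm x y) / cmod (herm x y)"
  have c: "cmod c = 1" using False by (simp add: c_def norm_divide)
  have "cnj (herm x y) * herm x y = of_real ((cmod (herm x y))\<^sup>2)"
    by (simp only: complex_norm_square mult.commute)
  then have "c * herm x y = of_real ((cmod (herm x y))\<^sup>2) / cmod (herm x y)"
    by (simp add: c_def)
  also have "\<dots> = cmod (herm x y)" by (simp add: power2_eq_square False)
  finally have "cmod (herm x y) = x \<bullet> (c *s y)"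
    by (simp add: Re_herm[symmetric] herm_smult_right)
  also have "\<dots> \<le> norm x * norm (c *s y)" by (rule norm_cauchy_schwarz)
  also have "norm (c *s y) = norm y"
    using c by (simp add: norm_vec_def norm_mult L2_set_def)
  finally show ?thesis .
qed simp

lemma bounded_bilinear_herm: "bounded_bilinear herm"
proof
  show "\<exists>K. \<forall>a b. norm (herm a b) \<le> norm a * norm b * K"
    by (intro exI[of _ 1]) (simp add: norm_herm_le)
qed (simp_all add: herm_simps herm_scaleR_left herm_scaleR_right scaleR_conv_of_real[where 'a = complex])

lemma smooth_on_herm: "smooth_on S f \<Longrightarrow> smooth_on S g \<Longrightarrow> smooth_on S (\<lambda>x. herm (f x) (g x))"
  by (rule smooth_on_bilinear[OF bounded_bilinear_herm])

text \<open>The index convention of \<open>cp_chart\<close>: for \<open>i = Some k\<close> the affine index \<open>k\<close> stands for the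
  homogeneous coordinate \<open>None\<close>.\<close>

definition chart_idx :: "'n option \<Rightarrow> 'n \<Rightarrow> 'n option" where
  "chart_idx i j = (if Some j = i then None else Some j)"

text \<open>The branch \<open>None\<close> of the \<open>case\<close> is reached only for
  \<open>i = Some k\<close>, since for \<open>i = None\<close> the test \<open>m = i\<close> has
  already returned 0; hence \<open>the i\<close> is the affine index that stands for
  \<open>None\<close>.\<close>

definition insert_coord :: "('n::finite) option \<Rightarrow> complex ^ 'n \<Rightarrow> complex ^ 'n option" where
  "insert_coord i u = (\<chi> m. if m = i then 0 else u $ (case m of None \<Rightarrow> the i | Some j \<Rightarrow> j))"

definition drop_coord :: "('n::finite) option \<Rightarrow> complex ^ 'n option \<Rightarrow> complex ^ 'n" where
  "drop_coord i z = (\<chi> j. z $ chart_idx i j)"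

text \<open>Homogeneous coordinates normalized by the coordinate \<open>i\<close>. The map is affine
  with linear part \<open>insert_coord i\<close>, which therefore lifts tangent vectors.\<close>

definition alift :: "('n::finite) option \<Rightarrow> complex ^ 'n \<Rightarrow> complex ^ 'n option" where
  "alift i w = axis i 1 + insert_coord i w"

lemma chart_idx_neq: "chart_idx i j \<noteq> i"
  by (auto simp: chart_idx_def)

lemma inj_chart_idx: "inj (chart_idx i)"
  by (auto simp: inj_def chart_idx_def split: if_splits)

lemma range_chart_idx: "range (chart_idx i) = - {i}"
proof (intro equalityI subsetI)
  fix m assume "m \<in> - {i}"
  then show "m \<in> range (chart_idx i)"
    by (cases m; cases i) (auto simp: chart_idx_def image_iff)
qed (auto simp: chart_idx_neq)

lemma sum_chart_idx:
  fixes f :: "('n::finite) option \<Rightarrow> 'a::comm_monoid_add"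
  shows "(\<Sum>m\<in>UNIV. f m) = f i + (\<Sum>j\<in>UNIV. f (chart_idx i j))"
proof -
  have "(\<Sum>m\<in>UNIV. f m) = f i + (\<Sum>m\<in>- {i}. f m)"
    by (subst sum.remove[of UNIV i]) (simp_all add: Compl_eq_Diff_UNIV)
  then show ?thesis
    by (simp add: range_chart_idx[symmetric] sum.reindex inj_chart_idx)
qed

lemma insert_coord_idx [simp]: "insert_coord i u $ chart_idx i j = u $ j"
  by (auto simp: insert_coord_def chart_idx_def)

lemma insert_coord_same [simp]: "insert_coord i u $ i = 0"
  by (simp add: insert_coord_def)

lemma vec_eq_chart_idx:
  "x = y \<longleftrightarrow> x $ i = y $ i \<and> (\<forall>j. x $ chart_idx i j = y $ chart_idx i j)"
proof -
  have "m = i \<or> m \<in> range (chart_idx i)" for m by (auto simp: range_chart_idx)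
  then show ?thesis unfolding vec_eq_iff by (metis rangeE)
qed

lemma drop_insert_coord [simp]: "drop_coord i (insert_coord i u) = u"
  by (simp add: drop_coord_def vec_eq_iff)

lemma insert_drop_coord: "insert_coord i (drop_coord i z) = z - z $ i *s axis i 1"
  by (subst vec_eq_chart_idx[of _ _ i]) (simp add: drop_coord_def axis_def chart_idx_neq)

lemma alift_same [simp]: "alift i w $ i = 1"
  by (simp add: alift_def)

lemma alift_nonzero [simp]: "alift i w \<noteq> 0"
  by (metis alift_same zero_index zero_neq_one)

lemma drop_axis [simp]: "drop_coord i (axis i c) = 0"
  by (simp add: drop_coord_def vec_eq_iff axis_def chart_idx_neq)

lemma drop_coord_zero [simp]: "drop_coord i 0 = 0"
  by (simp add: drop_coord_def vec_eq_iff)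

lemma drop_coord_add: "drop_coord i (x + y) = drop_coord i x + drop_coord i y"
  by (simp add: drop_coord_def vec_eq_iff)

lemma drop_coord_smult: "drop_coord i (c *s x) = c *s drop_coord i x"
  by (simp add: drop_coord_def vec_eq_iff)

lemma drop_coord_alift [simp]: "drop_coord i (alift i w) = w"
  by (simp add: alift_def drop_coord_add)

lemma insert_coord_add: "insert_coord i (x + y) = insert_coord i x + insert_coord i y"
  by (simp add: insert_coord_def vec_eq_iff)

lemma insert_coord_minus: "insert_coord i (- x) = - insert_coord i x"
  by (simp add: insert_coord_def vec_eq_iff)

lemma insert_coord_smult: "insert_coord i (c *s x) = c *s insert_coord i x"
  by (simp add: insert_coord_def vec_eq_iff)

lemma insert_coord_scaleR: "insert_coord i (r *\<^sub>R x) = r *\<^sub>R insert_coord i x"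
  by (simp add: insert_coord_def vec_eq_iff)

lemma bounded_linear_insert_coord: "bounded_linear (insert_coord i)"
  by (rule linear_conv_bounded_linear[THEN iffD1], rule linearI)
    (simp_all add: insert_coord_add insert_coord_scaleR)

lemma bounded_linear_drop_coord: "bounded_linear (drop_coord i)"
  by (rule linear_conv_bounded_linear[THEN iffD1], rule linearI)
    (simp_all add: drop_coord_def vec_eq_iff)

lemma herm_insert_coord: "herm (insert_coord i u) (insert_coord i v) = herm u v"
  by (simp add: herm_def sum_chart_idx[of _ i])

lemma herm_alift_insert: "herm (alift i w) (insert_coord i v) = herm w v"
  by (simp add: alift_def herm_simps herm_axis_left herm_insert_coord)

lemma herm_insert_alift: "herm (insert_coord i v) (alift i w) = herm v w"
  by (metis cnj_herm herm_alift_insert)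

lemma herm_alift: "herm (alift i w) (alift i w) = 1 + herm w w"
  by (simp add: alift_def herm_simps herm_axis_left herm_axis_right herm_insert_coord)

lemma norm_alift: "(norm (alift i w))\<^sup>2 = 1 + (norm w)\<^sup>2"
proof -
  have "Re (herm (alift i w) (alift i w)) = Re (1 + herm w w)" by (simp add: herm_alift)
  then show ?thesis by (simp add: Re_herm power2_norm_eq_inner)
qed

lemma alift_drop_coord: "z $ i \<noteq> 0 \<Longrightarrow> alift i (drop_coord i ((1 / z $ i) *s z)) = (1 / z $ i) *s z"
  by (simp add: alift_def insert_drop_coord)

lemma smooth_on_alift: "smooth_on S f \<Longrightarrow> smooth_on S (\<lambda>x. alift i (f x))"
  unfolding alift_def
  by (intro smooth_on_intros smooth_on_bounded_linear[OF bounded_linear_insert_coord])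

lemma smooth_on_drop_coord: "smooth_on S f \<Longrightarrow> smooth_on S (\<lambda>x. drop_coord i (f x))"
  by (rule smooth_on_bounded_linear[OF bounded_linear_drop_coord])

section \<open>Complex lines and their affine coordinates\<close>

lemma mem_cline: "z \<in> cline z"
  unfolding cline_def by (rule range_eqI[of _ _ 1]) simp

lemma cline_smult:
  assumes "c \<noteq> 0" shows "cline (c *s z) = cline z"
proof
  show "cline (c *s z) \<subseteq> cline z" by (auto simp: cline_def)
  have "d *s z = (d / c) *s (c *s z)" for d using assms by simp
  then show "cline z \<subseteq> cline (c *s z)" unfolding cline_def by blast
qed

lemma cline_eq_iff:
  assumes "z \<noteq> 0" shows "cline z = cline y \<longleftrightarrow> (\<exists>c. c \<noteq> 0 \<and> y = c *s z)"
proof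
  assume eq: "cline z = cline y"
  obtain c where c: "y = c *s z" using mem_cline[of y] eq unfolding cline_def by auto
  have "c \<noteq> 0"
  proof
    assume "c = 0"
    then have "cline y = {0}" using c by (auto simp: cline_def)
    then show False using eq mem_cline[of z] assms by simp
  qed
  then show "\<exists>c. c \<noteq> 0 \<and> y = c *s z" using c by blast
qed (auto simp: cline_smult)

lemma cp_chart_cline': "z $ i \<noteq> 0 \<Longrightarrow> cp_chart i (cline z) = drop_coord i ((1 / z $ i) *s z)"
  by (simp add: cp_chart_cline drop_coord_def chart_idx_def vec_eq_iff)

lemma cp_chart_alift [simp]: "cp_chart i (cline (alift i w)) = w"
  by (subst cp_chart_cline') simp_all

lemma cline_mem_chart_dom: "z \<noteq> 0 \<Longrightarrow> cline z \<in> cp_chart_dom i \<longleftrightarrow> z $ i \<noteq> 0"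
  unfolding cp_chart_dom_def by (auto simp: cline_eq_iff)

lemma cline_alift_mem: "cline (alift i w) \<in> cp_chart_dom i"
  by (simp add: cline_mem_chart_dom)

lemma cp_chart_domE:
  assumes "L \<in> cp_chart_dom i" obtains w where "L = cline (alift i w)"
proof -
  obtain z where z: "L = cline z" "z $ i \<noteq> 0" using assms by (auto simp: cp_chart_dom_def)
  then have "L = cline (alift i (drop_coord i ((1 / z $ i) *s z)))"
    by (simp add: alift_drop_coord cline_smult)
  then show thesis by (rule that)
qed

lemma inj_on_cp_chart: "inj_on (cp_chart i) (cp_chart_dom i)"
  by (rule inj_onI) (metis cp_chart_domE cp_chart_alift)

lemma cp_chart_image: "cp_chart i ` cp_chart_dom i = UNIV"
  using cline_alift_mem cp_chart_alift by (metis image_iff surjI UNIV_eq_I)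

lemma inv_into_cp_chart: "inv_into (cp_chart_dom i) (cp_chart i) w = cline (alift i w)"
  by (rule inv_into_f_eq[OF inj_on_cp_chart]) (simp_all add: cline_alift_mem)

section \<open>The metrics\<close>

text \<open>The Hermitian Fubini-Study form pulled back to nonzero homogeneous vectors. It
  degenerates along the complex line of \<open>z\<close>, so that lifts of tangent vectors need to
  be known only up to multiples of \<open>z\<close>.\<close>

definition fubini_form :: "complex ^ ('m::finite) \<Rightarrow> complex ^ 'm \<Rightarrow> complex ^ 'm \<Rightarrow> complex" where
  "fubini_form z u v = (herm z z * herm u v - herm u z * herm z v) / (herm z z)\<^sup>2"

definition fubini_study :: "complex ^ ('n::finite) \<Rightarrow> complex ^ 'n \<Rightarrow> complex ^ 'n \<Rightarrow> real" where
  "fubini_study w u v = Re (((1 + herm w w) * herm u v - herm u w * herm w v) / (1 + herm w w)\<^sup>2)"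

lemma fubini_study_alift:
  "fubini_study w u v = Re (fubini_form (alift i w) (insert_coord i u) (insert_coord i v))"
  by (simp add: fubini_study_def fubini_form_def herm_insert_coord herm_alift_insert
      herm_insert_alift herm_alift)

lemma herm_self_nonzero [simp]: "herm z z = 0 \<longleftrightarrow> z = 0"
  by (simp add: herm_self)

text \<open>Numerator and denominator both scale by \<open>(cnj c * c)^2\<close>, and the multiples
  of \<open>z\<close> cancel. The derivative of a renormalized lift differs from a linear map in
  just this way, so changes of charts and projective maps are covered at once.\<close>

lemma fubini_form_smult:
  assumes "c \<noteq> 0" "z \<noteq> 0"
  shows "fubini_form (c *s z) (c *s u + d *s z) (c *s v + e *s z) = fubini_form z u v"
proof -
  let ?z' = "c *s z" and ?u' = "c *s u + d *s z" and ?v' = "c *s v + e *s z" and ?k = "(cnj c * c)\<^sup>2"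
  have "herm ?z' ?z' * herm ?u' ?v' - herm ?u' ?z' * herm ?z' ?v' =
     ?k * (herm z z * herm u v - herm u z * herm z v)"
    unfolding herm_simps by (simp add: algebra_simps power2_eq_square)
  moreover have "(herm ?z' ?z')\<^sup>2 = ?k * (herm z z)\<^sup>2"
    unfolding herm_simps by (simp add: algebra_simps power2_eq_square)
  moreover have "?k \<noteq> 0" using assms by simp
  ultimately show ?thesis unfolding fubini_form_def by simp
qed

lemma fubini_form_unitary:
  assumes "\<And>x y. herm (A *v x) (A *v y) = herm x y"
  shows "fubini_form (A *v z) (A *v u) (A *v v) = fubini_form z u v"
  by (simp add: fubini_form_def assms)

text \<open>The squared sine of the distance from the line spanned by the basis vector \<open>None\<close>.\<close>

definition height :: "complex ^ ('n::finite) option \<Rightarrow> real" where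
  "height z = 1 - (cmod (z $ None))\<^sup>2 / (norm z)\<^sup>2"

text \<open>By \<open>height_smult\<close> all nonzero representatives give the same value, so the
  choice does no harm.\<close>

definition line_height :: "(complex ^ ('n::finite) option) set \<Rightarrow> real" where
  "line_height L = height (SOME z. z \<in> L \<and> z \<noteq> 0)"

lemma norm_smult: "norm (c *s (x :: complex ^ 'm::finite)) = cmod c * norm x"
  by (simp add: norm_vec_def norm_mult L2_set_right_distrib)

lemma height_smult: "c \<noteq> 0 \<Longrightarrow> height (c *s z) = height z"
  by (simp add: height_def norm_smult norm_mult power_mult_distrib)

lemma line_height_cline:
  assumes "z \<noteq> 0" shows "line_height (cline z) = height z"
proof -
  have "\<exists>y. y \<in> cline z \<and> y \<noteq> 0" using assms mem_cline by blast
  then have "(SOME y. y \<in> cline z \<and> y \<noteq> 0) \<in> cline z \<and> (SOME y. y \<in> cline z \<and> y \<noteq> 0) \<noteq> 0"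
    by (rule someI_ex)
  then obtain c where "(SOME y. y \<in> cline z \<and> y \<noteq> 0) = c *s z" "c \<noteq> 0"
    by (auto simp: cline_def)
  then show ?thesis by (simp add: line_height_def height_smult)
qed

text \<open>The chart \<open>c\<close> serves to find the point whose height is taken;
  \<open>fubini_study\<close> has the same formula in all affine charts.\<close>

definition conformal_metric ::
  "real \<Rightarrow> ((complex ^ (('n::finite) option)) set, complex ^ 'n) metric" where
  "conformal_metric a c x u v =
     exp (2 * a * line_height (inv_into (fst c) (snd c) x)) * fubini_study x u v"

lemma conformal_metric_chart:
  "conformal_metric a (cp_chart_dom i, cp_chart i) x u v =
     exp (2 * a * height (alift i x)) * fubini_study x u v"
  by (simp add: conformal_metric_def inv_into_cp_chart line_height_cline)

lemma fubini_study_sym: "fubini_study w u v = fubini_study w v u"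
proof -
  have "cnj (((1 + herm w w) * herm u v - herm u w * herm w v) / (1 + herm w w)\<^sup>2) =
     ((1 + herm w w) * herm v u - herm v w * herm w u) / (1 + herm w w)\<^sup>2"
    by (simp add: cnj_herm mult.commute)
  then show ?thesis unfolding fubini_study_def by (metis cnj.sel(1))
qed

lemma one_plus_herm: "1 + herm w w = of_real (1 + (norm w)\<^sup>2)"
  by (simp add: herm_self)

lemma one_plus_norm_pos: "1 + (norm w)\<^sup>2 > (0::real)" "1 + (norm w)\<^sup>2 \<noteq> (0::real)"
  using add_pos_nonneg[of 1 "(norm w)\<^sup>2"] by auto

lemma one_plus_herm_nonzero [simp]: "1 + herm w w \<noteq> 0"
  unfolding one_plus_herm of_real_eq_0_iff by (rule one_plus_norm_pos)

lemma bilinear_fubini_study: "bilinear (fubini_study w)"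
proof -
  define B where "B u v = ((1 + herm w w) * herm u v - herm u w * herm w v) / (1 + herm w w)\<^sup>2" for u v
  have "B (x + y) v = B x v + B y v" "B v (x + y) = B v x + B v y"
    "B (r *\<^sub>R x) v = of_real r * B x v" "B v (r *\<^sub>R x) = of_real r * B v x" for x y v r
    by (simp_all add: B_def herm_simps herm_scaleR_left herm_scaleR_right algebra_simps
        add_divide_distrib diff_divide_distrib)
  moreover have "fubini_study w u v = Re (B u v)" for u v
    by (simp add: fubini_study_def B_def)
  ultimately show ?thesis unfolding bilinear_def by (auto intro!: linearI)
qed

lemma fubini_study_self:
  "fubini_study w u u = ((1 + (norm w)\<^sup>2) * (norm u)\<^sup>2 - (cmod (herm w u))\<^sup>2) / (1 + (norm w)\<^sup>2)\<^sup>2"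
proof -
  have "herm u w * herm w u = of_real ((cmod (herm w u))\<^sup>2)"
    unfolding cnj_herm[of w u, symmetric] complex_norm_square by (rule mult.commute)
  then have "((1 + herm w w) * herm u u - herm u w * herm w u) / (1 + herm w w)\<^sup>2 =
     of_real (((1 + (norm w)\<^sup>2) * (norm u)\<^sup>2 - (cmod (herm w u))\<^sup>2) / (1 + (norm w)\<^sup>2)\<^sup>2)"
    unfolding one_plus_herm herm_self[of u] by simp
  then show ?thesis by (simp only: fubini_study_def Re_complex_of_real)
qed

text \<open>Cauchy-Schwarz for \<open>herm\<close> leaves at least \<open>(norm u)^2\<close> in the
  numerator.\<close>

lemma fubini_study_pos: assumes "u \<noteq> 0" shows "fubini_study w u u > 0"
proof -
  have "(cmod (herm w u))\<^sup>2 \<le> (norm w * norm u)\<^sup>2"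
    by (intro power_mono norm_herm_le) simp
  then have "(1 + (norm w)\<^sup>2) * (norm u)\<^sup>2 - (cmod (herm w u))\<^sup>2 \<ge> (norm u)\<^sup>2"
    by (simp add: algebra_simps power_mult_distrib)
  moreover have "(norm u)\<^sup>2 > 0" using assms by simp
  ultimately show ?thesis
    unfolding fubini_study_self using one_plus_norm_pos by (intro divide_pos_pos) (linarith, simp)
qed

lemma smooth_on_height: "smooth_on S (\<lambda>x. height (alift i x))"
proof -
  have "height (alift i x) = 1 - Re (cnj (alift i x $ None) * alift i x $ None) / (1 + x \<bullet> x)" for x
    unfolding height_def norm_alift
    by (simp add: cmod_power2 power2_norm_eq_inner flip: power2_eq_square)
  moreover have "1 + x \<bullet> x \<noteq> 0" for x :: "complex ^ 'a"
    by (metis one_plus_norm_pos(2) power2_norm_eq_inner)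
  ultimately show ?thesis
    by (simp only:) (intro smooth_on_divide smooth_on_intros smooth_on_alift)
qed

lemma smooth_on_fubini_study: "smooth_on S (\<lambda>x. fubini_study x u v)"
  unfolding fubini_study_def
  by (intro smooth_on_Re smooth_on_divide smooth_on_intros smooth_on_herm)
    (simp_all add: power2_eq_square smooth_on_intros smooth_on_herm)

lemma height_density: "smooth_density CP (\<lambda>L. d * line_height L)"
  unfolding smooth_density_def CP_def
  by (auto simp: o_def inv_into_cp_chart line_height_cline
      intro!: smooth_on_mult smooth_on_const smooth_on_height)

section \<open>Unitary maps as isometries in affine coordinates\<close>

lemma bounded_bilinear_smult:
  "bounded_bilinear ((*s) :: complex \<Rightarrow> complex ^ 'm::finite \<Rightarrow> complex ^ 'm)"
proof
  show "\<exists>K. \<forall>a b. norm (a *s b :: complex ^ 'm) \<le> norm a * norm b * K"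
    by (intro exI[of _ 1]) (simp add: norm_smult)
qed (simp_all add: vec_eq_iff algebra_simps)

lemma bounded_linear_matrix_vector:
  "bounded_linear ((*v) (A :: complex ^ 'm::finite ^ 'l::finite))"
  by (rule linear_conv_bounded_linear[THEN iffD1], rule linearI)
    (simp_all add: scaleR_eq_smult vector_scalar_commute matrix_vector_right_distrib)

lemma has_derivative_alift: "(alift i has_derivative insert_coord i) (at w)"
  unfolding alift_def[abs_def]
  by (auto intro!: derivative_eq_intros bounded_linear_imp_has_derivative bounded_linear_insert_coord)

text \<open>Quotient rule for the normalization by the coordinate \<open>j\<close>. The second term
  is a multiple of the image vector, hence tangent to its line.\<close>

lemma has_derivative_projective:
  fixes A :: "complex ^ ('n::finite) option ^ 'n option"
  assumes nz: "(A *v alift i w) $ j \<noteq> 0"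
  shows "((\<lambda>w. drop_coord j ((1 / (A *v alift i w) $ j) *s (A *v alift i w))) has_derivative
    (\<lambda>u. drop_coord j ((1 / (A *v alift i w) $ j) *s (A *v insert_coord i u)
       - ((A *v insert_coord i u) $ j / ((A *v alift i w) $ j)\<^sup>2) *s (A *v alift i w)))) (at w)"
proof -
  have 1: "((\<lambda>w. A *v alift i w) has_derivative (\<lambda>u. A *v insert_coord i u)) (at w)"
    by (rule bounded_linear.has_derivative[OF bounded_linear_matrix_vector has_derivative_alift])
  have 2: "((\<lambda>w. (A *v alift i w) $ j) has_derivative (\<lambda>u. (A *v insert_coord i u) $ j)) (at w)"
    by (rule bounded_linear.has_derivative[OF bounded_linear_vec_nth 1])
  have 3: "((\<lambda>w. 1 / (A *v alift i w) $ j) has_derivative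
      (\<lambda>u. - (A *v insert_coord i u) $ j / ((A *v alift i w) $ j)\<^sup>2)) (at w)"
    by (rule has_derivative_eq_rhs, rule has_derivative_divide[OF has_derivative_const 2 nz])
      (use nz in \<open>auto simp: field_simps power2_eq_square\<close>)
  show ?thesis
    by (rule has_derivative_eq_rhs,
        rule bounded_linear.has_derivative[OF bounded_linear_drop_coord
          bounded_bilinear.FDERIV[OF bounded_bilinear_smult 3 1]])
      (simp add: fun_eq_iff vec_eq_iff drop_coord_def)
qed

text \<open>Undoing \<open>drop_coord\<close> turns \<open>D u\<close> into a multiple of
  \<open>A\<close> applied to the lifted vector plus a multiple of \<open>A *v alift i w\<close>;
  \<open>fubini_form_smult\<close> absorbs both, and \<open>A\<close> preserves
  \<open>herm\<close>.\<close>

lemma fubini_study_projective: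
  fixes A :: "complex ^ ('n::finite) option ^ 'n option"
  assumes A: "\<And>x y. herm (A *v x) (A *v y) = herm x y" and nz: "(A *v alift i w) $ j \<noteq> 0"
    and D: "\<And>u. D u = drop_coord j ((1 / (A *v alift i w) $ j) *s (A *v insert_coord i u)
       - ((A *v insert_coord i u) $ j / ((A *v alift i w) $ j)\<^sup>2) *s (A *v alift i w))"
  shows "fubini_study (drop_coord j ((1 / (A *v alift i w) $ j) *s (A *v alift i w))) (D u) (D v)
    = fubini_study w u v"
proof -
  let ?y = "A *v alift i w"
  have i: "insert_coord j (D u) = (1 / ?y $ j) *s (A *v insert_coord i u)
       + (- ((A *v insert_coord i u) $ j / (?y $ j)\<^sup>2)) *s ?y" for u
    unfolding D insert_drop_coord using nz by (simp add: vec_eq_iff power2_eq_square)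
  have "?y \<noteq> 0" using nz by (metis zero_index)
  then show ?thesis
    unfolding fubini_study_alift[of w _ _ i]
    unfolding fubini_study_alift[of _ _ _ j] alift_drop_coord[OF nz] i
    using nz by (simp only: fubini_form_smult divide_eq_0_iff one_neq_zero simp_thms not_False_eq_True
      fubini_form_unitary[OF A])
qed

lemma norm_unitary:
  assumes "\<And>x y. herm (A *v x) (A *v y) = herm x y" shows "norm (A *v x) = norm x"
proof -
  have "(norm (A *v x))\<^sup>2 = (norm x)\<^sup>2"
    using arg_cong[OF assms[of x x], of Re] by (simp add: Re_herm power2_norm_eq_inner)
  then show ?thesis by simp
qed

text \<open>\<open>F\<close> is any map that acts on lines like \<open>A\<close>: the identity
  matrix yields the transformation law of the metric between charts, the group elements yield
  isometries. Preserving the modulus of the coordinate \<open>None\<close> keeps the conformal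
  factor.\<close>

lemma metric_preserving_unitary:
  fixes A :: "complex ^ ('n::finite) option ^ 'n option"
  assumes A: "\<And>x y. herm (A *v x) (A *v y) = herm x y"
    and None: "\<And>x. cmod ((A *v x) $ None) = cmod (x $ None)"
    and F: "\<And>z. z \<noteq> 0 \<Longrightarrow> F (cline z) = cline (A *v z)"
  shows "metric_preserving CP (conformal_metric a) F"
  unfolding metric_preserving_def
proof (clarsimp simp: CP_def Let_def)
  fix i j and L u v
  assume L: "L \<in> cp_chart_dom i" and FL: "F L \<in> cp_chart_dom j"
  let ?f = "cp_chart j \<circ> F \<circ> inv_into (cp_chart_dom i) (cp_chart i)"
  obtain w where w: "L = cline (alift i w)" using L by (rule cp_chart_domE)
  have A0: "A *v x \<noteq> 0" if "x \<noteq> 0" for x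
    using norm_unitary[OF A, of x] that by (metis norm_eq_zero)
  have nz: "(A *v alift i w) $ j \<noteq> 0"
    using FL by (simp add: w F cline_mem_chart_dom A0)
  have f: "?f x = drop_coord j ((1 / (A *v alift i x) $ j) *s (A *v alift i x))"
    if "(A *v alift i x) $ j \<noteq> 0" for x
    using that by (simp add: inv_into_cp_chart F cp_chart_cline')
  define D where "D u = drop_coord j ((1 / (A *v alift i w) $ j) *s (A *v insert_coord i u)
       - ((A *v insert_coord i u) $ j / ((A *v alift i w) $ j)\<^sup>2) *s (A *v alift i w))" for u
  \<comment> \<open>The formula for \<open>?f\<close> is available only where the coordinate
    \<open>j\<close> of the image is nonzero, which is an open condition.\<close>
  have "(?f has_derivative D) (at w)"
  proof (rule has_derivative_transform_within_open)
    show "((\<lambda>w. drop_coord j ((1 / (A *v alift i w) $ j) *s (A *v alift i w))) has_derivative D) (at w)"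
      unfolding D_def[abs_def] using has_derivative_projective[OF nz] .
    have "continuous_on UNIV (\<lambda>x. (A *v alift i x) $ j)"
      by (intro smooth_on_imp_continuous_on smooth_on_nth smooth_on_matrix_vector_mult smooth_on_const
          smooth_on_alift smooth_on_ident)
    then show "open {x. (A *v alift i x) $ j \<noteq> 0}"
      by (intro open_Collect_neq continuous_on_const)
  qed (use nz f in auto)
  then have D: "frechet_derivative ?f (at w) = D"
    by (metis frechet_derivative_at)
  have h: "height (z) = height (alift i w)"
    if "z = (1 / (A *v alift i w) $ j) *s (A *v alift i w)" for z
    using nz by (simp add: that height_smult) (simp add: height_def norm_unitary[OF A] None)
  have FL': "cp_chart j (F L) = drop_coord j ((1 / (A *v alift i w) $ j) *s (A *v alift i w))"
    using nz by (simp add: w F cp_chart_cline')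
  have L': "cp_chart i L = w" by (simp add: w)
  show "conformal_metric a (cp_chart_dom j, cp_chart j) (cp_chart j (F L))
          (frechet_derivative ?f (at (cp_chart i L)) u) (frechet_derivative ?f (at (cp_chart i L)) v) =
        conformal_metric a (cp_chart_dom i, cp_chart i) (cp_chart i L) u v"
    unfolding L' D FL' conformal_metric_chart alift_drop_coord[OF nz] h[OF refl]
    by (simp only: fubini_study_projective[OF A nz D_def])
qed

lemma riemannian_conformal_metric: "riemannian_metric CP (conformal_metric a)"
proof -
  have "bilinear (\<lambda>u v. c * fubini_study x u v)" for c and x :: "complex ^ 'n"
    using bilinear_fubini_study[of x]
    by (auto simp: bilinear_def linear_iff algebra_simps)
  then have "bilinear (conformal_metric a (cp_chart_dom i, cp_chart i) x)"
    for i and x :: "complex ^ 'n"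
    unfolding conformal_metric_chart[abs_def] .
  moreover have "smooth_on S (\<lambda>x. conformal_metric a (cp_chart_dom i, cp_chart i) x u v)"
    for S i and u v :: "complex ^ 'n"
    unfolding conformal_metric_chart
    by (intro smooth_on_mult smooth_on_exp smooth_on_const smooth_on_height smooth_on_fubini_study)
  moreover have "metric_preserving CP (conformal_metric a :: (_, complex ^ 'n) metric) id"
    by (rule metric_preserving_unitary[of "mat 1"]) auto
  ultimately show ?thesis
    unfolding riemannian_metric_def CP_def
    by (auto simp: conformal_metric_chart fubini_study_sym fubini_study_pos)
qed

section \<open>Curvature under a conformal change\<close>

text \<open>For a symmetric connection compatible with the metric the right side of the Koszul
  formula collapses to \<open>2 * h x (\<Gamma> u v) w\<close>, and positivity makes the solution
  unique. A guessed connection thus only has to be verified.\<close>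

lemma christoffel_eqI:
  fixes h :: "'e::euclidean_space \<Rightarrow> 'e \<Rightarrow> 'e \<Rightarrow> real"
  assumes bil: "bilinear (h x)" and sym: "\<And>u v. h x u v = h x v u"
    and pos: "\<And>u. u \<noteq> 0 \<Longrightarrow> h x u u > 0"
    and d: "\<And>v w. ((\<lambda>y. h y v w) has_derivative (\<lambda>u. h x (\<Gamma> u v) w + h x v (\<Gamma> u w))) (at x)"
    and \<Gamma>: "\<And>u v. \<Gamma> u v = \<Gamma> v u"
  shows "christoffel h x u v = \<Gamma> u v"
  unfolding christoffel_def
proof (rule the_equality)
  have D: "frechet_derivative (\<lambda>y. h y v w) (at x) = (\<lambda>u. h x (\<Gamma> u v) w + h x v (\<Gamma> u w))" for v w
    using frechet_derivative_at[OF d] by simp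
  have e: "frechet_derivative (\<lambda>y. h y v w) (at x) u + frechet_derivative (\<lambda>y. h y u w) (at x) v
      - frechet_derivative (\<lambda>y. h y u v) (at x) w = 2 * h x (\<Gamma> u v) w" for w
    unfolding D using sym \<Gamma> by (simp add: \<Gamma>[of v u] \<Gamma>[of w u] \<Gamma>[of w v] sym)
  then show "\<forall>w. 2 * h x (\<Gamma> u v) w = frechet_derivative (\<lambda>y. h y v w) (at x) u
      + frechet_derivative (\<lambda>y. h y u w) (at x) v - frechet_derivative (\<lambda>y. h y u v) (at x) w"
    by simp
  fix z
  assume "\<forall>w. 2 * h x z w = frechet_derivative (\<lambda>y. h y v w) (at x) u
      + frechet_derivative (\<lambda>y. h y u w) (at x) v - frechet_derivative (\<lambda>y. h y u v) (at x) w"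
  then have "h x z (z - \<Gamma> u v) = h x (\<Gamma> u v) (z - \<Gamma> u v)" unfolding e by simp
  then have "h x (z - \<Gamma> u v) (z - \<Gamma> u v) = 0" by (simp add: bilinear_lsub[OF bil])
  then show "z = \<Gamma> u v" using pos[of "z - \<Gamma> u v"] by fastforce
qed

text \<open>The setting of one chart whose image is the whole space. Since the gradient field
  \<open>L\<close> of \<open>s\<close> is linear, its ordinary derivative is \<open>L\<close>
  itself.\<close>

locale conformal_change =
  fixes g :: "'e::euclidean_space \<Rightarrow> 'e \<Rightarrow> 'e \<Rightarrow> real"
    and \<Gamma> :: "'e \<Rightarrow> 'e \<Rightarrow> 'e \<Rightarrow> 'e"
    and D\<Gamma> :: "'e \<Rightarrow> 'e \<Rightarrow> 'e \<Rightarrow> 'e \<Rightarrow> 'e"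
    and s :: "'e \<Rightarrow> real" and L :: "'e \<Rightarrow> 'e" and a :: real
  assumes bil: "bilinear (g x)" and sym: "g x u v = g x v u" and pos: "u \<noteq> 0 \<Longrightarrow> g x u u > 0"
    and dg: "((\<lambda>y. g y v w) has_derivative (\<lambda>u. g x (\<Gamma> x u v) w + g x v (\<Gamma> x u w))) (at x)"
    and \<Gamma>_sym: "\<Gamma> x u v = \<Gamma> x v u" and \<Gamma>_bil: "bilinear (\<Gamma> x)"
    and d\<Gamma>: "((\<lambda>y. \<Gamma> y v w) has_derivative (\<lambda>u. D\<Gamma> x u v w)) (at x)"
    and ds: "(s has_derivative (\<lambda>v. g x (L x) v)) (at x)"
    and L: "linear L"
begin

lemmas g_simps = bilinear_ladd[OF bil] bilinear_radd[OF bil] bilinear_lsub[OF bil]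
  bilinear_rsub[OF bil] bilinear_lmul[OF bil] bilinear_rmul[OF bil] bilinear_lneg[OF bil]
  bilinear_rneg[OF bil]

lemmas \<Gamma>_simps = bilinear_ladd[OF \<Gamma>_bil] bilinear_radd[OF \<Gamma>_bil] bilinear_lsub[OF \<Gamma>_bil]
  bilinear_rsub[OF \<Gamma>_bil] bilinear_lmul[OF \<Gamma>_bil] bilinear_rmul[OF \<Gamma>_bil]

definition gc :: "'e \<Rightarrow> 'e \<Rightarrow> 'e \<Rightarrow> real" where
  "gc x u v = exp (2 * a * s x) * g x u v"

text \<open>The classical Levi-Civita connection of \<open>exp (2 * \<phi>) g\<close> for
  \<open>\<phi> = a s\<close>, whose gradient is \<open>a L\<close>.\<close>

definition \<Gamma>c :: "'e \<Rightarrow> 'e \<Rightarrow> 'e \<Rightarrow> 'e" where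
  "\<Gamma>c x u v = \<Gamma> x u v + a *\<^sub>R (g x (L x) u *\<^sub>R v + g x (L x) v *\<^sub>R u - g x u v *\<^sub>R L x)"

text \<open>The gradient field differentiated covariantly in the direction \<open>u\<close> and
  paired with \<open>v\<close>.\<close>

definition hess :: "'e \<Rightarrow> 'e \<Rightarrow> 'e \<Rightarrow> real" where
  "hess x u v = g x (L u + \<Gamma> x u (L x)) v"

definition curv :: "'e \<Rightarrow> 'e \<Rightarrow> 'e \<Rightarrow> 'e \<Rightarrow> 'e" where
  "curv x u v w = D\<Gamma> x u v w - D\<Gamma> x v u w + \<Gamma> x u (\<Gamma> x v w) - \<Gamma> x v (\<Gamma> x u w)"

lemma christoffel_gc: "christoffel gc x u v = \<Gamma>c x u v"
proof (rule christoffel_eqI)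
  show "bilinear (gc x)"
    unfolding gc_def[abs_def] using bil[of x] by (auto simp: bilinear_def linear_iff algebra_simps)
  show "((\<lambda>y. gc y v w) has_derivative (\<lambda>u. gc x (\<Gamma>c x u v) w + gc x v (\<Gamma>c x u w))) (at x)" for v w
  proof -
    have e: "((\<lambda>y. exp (2 * a * s y)) has_derivative
        (\<lambda>u. exp (2 * a * s x) * (2 * a * g x (L x) u))) (at x)"
      by (rule has_derivative_eq_rhs, rule has_derivative_exp[OF has_derivative_mult_right[OF ds]])
        (simp add: fun_eq_iff)
    have "((\<lambda>y. gc y v w) has_derivative
        (\<lambda>u. exp (2 * a * s x) * (g x (\<Gamma> x u v) w + g x v (\<Gamma> x u w))
          + (exp (2 * a * s x) * (2 * a * g x (L x) u)) * g x v w)) (at x)"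
      unfolding gc_def
      by (intro has_derivative_mult e dg)
    then show ?thesis
      by (rule has_derivative_eq_rhs)
        (simp add: fun_eq_iff gc_def \<Gamma>c_def g_simps algebra_simps sym[of x v "L x"], metis sym)
  qed
qed (simp_all add: gc_def \<Gamma>c_def sym pos \<Gamma>_sym algebra_simps)

text \<open>The assumption \<open>dg\<close> differentiates the metric only on constant vectors.
  Writing \<open>L y\<close> in the standard basis separates its variation from that of the metric,
  and \<open>rep\<close> reassembles the sums.\<close>

lemma d_grad:
  "((\<lambda>y. g y (L y) v) has_derivative
     (\<lambda>u. g x (L u) v + g x (\<Gamma> x u (L x)) v + g x (L x) (\<Gamma> x u v))) (at x)"
proof -
  have rep: "(\<Sum>b\<in>Basis. (z \<bullet> b) * f b) = f z" if "linear f" for f :: "'e \<Rightarrow> real" and z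
  proof -
    have "f (\<Sum>b\<in>Basis. (z \<bullet> b) *\<^sub>R b) = (\<Sum>b\<in>Basis. (z \<bullet> b) * f b)"
      by (simp add: linear_sum[OF that] linear_scale[OF that])
    then show ?thesis by (simp add: euclidean_representation)
  qed
  have lin: "linear (\<lambda>z. g x z v)" "linear (\<lambda>z. g x (\<Gamma> x u z) v)" "linear (\<lambda>z. g x z (\<Gamma> x u v))" for u x
    by (auto intro!: linearI simp: g_simps \<Gamma>_simps)
  have "((\<lambda>y. \<Sum>b\<in>Basis. (L y \<bullet> b) * g y b v) has_derivative
     (\<lambda>u. \<Sum>b\<in>Basis. (L x \<bullet> b) * (g x (\<Gamma> x u b) v + g x b (\<Gamma> x u v)) + (L u \<bullet> b) * g x b v)) (at x)"
    by (intro has_derivative_sum has_derivative_mult dg has_derivative_inner_left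
        bounded_linear_imp_has_derivative) (simp add: L linear_linear)
  then show ?thesis
    by (simp add: rep lin sum.distrib distrib_left algebra_simps)
qed

lemma d_\<Gamma>c:
  "((\<lambda>y. \<Gamma>c y v w) has_derivative (\<lambda>u. D\<Gamma> x u v w + a *\<^sub>R
     ((g x (L u) v + g x (\<Gamma> x u (L x)) v + g x (L x) (\<Gamma> x u v)) *\<^sub>R w
     + (g x (L u) w + g x (\<Gamma> x u (L x)) w + g x (L x) (\<Gamma> x u w)) *\<^sub>R v
     - (g x v w *\<^sub>R L u + (g x (\<Gamma> x u v) w + g x v (\<Gamma> x u w)) *\<^sub>R L x)))) (at x)"
  unfolding \<Gamma>c_def
  by (intro has_derivative_add d\<Gamma> has_derivative_scaleR_right has_derivative_diff
      has_derivative_scaleR_left d_grad has_derivative_scaleR dg bounded_linear_imp_has_derivative)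
    (simp add: L linear_linear)

text \<open>Inserting \<open>\<Gamma>c\<close> into the curvature tensor, the terms of first order
  in \<open>a\<close> combine to Hessians and those of second order to gradient terms. The pairing
  is with \<open>g\<close>, so the factor by which \<open>gc\<close> differs from \<open>g\<close>
  is still to be supplied.\<close>

lemma curvature_gc:
  assumes uv: "g x u v = 0"
  shows "g x (curvature_tensor gc x u v v) u = g x (curv x u v v) u
    - a * (g x v v * hess x u u + g x u u * hess x v v)
    + a\<^sup>2 * (g x v v * (g x (L x) u)\<^sup>2 + g x u u * (g x (L x) v)\<^sup>2 - g x (L x) (L x) * g x u u * g x v v)"
proof -
  have vu: "g x v u = 0" using uv sym by metis
  have D: "frechet_derivative (\<lambda>y. \<Gamma>c y v w) (at x) = (\<lambda>u. D\<Gamma> x u v w + a *\<^sub>R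
     ((g x (L u) v + g x (\<Gamma> x u (L x)) v + g x (L x) (\<Gamma> x u v)) *\<^sub>R w
     + (g x (L u) w + g x (\<Gamma> x u (L x)) w + g x (L x) (\<Gamma> x u w)) *\<^sub>R v
     - (g x v w *\<^sub>R L u + (g x (\<Gamma> x u v) w + g x v (\<Gamma> x u w)) *\<^sub>R L x)))" for v w
    using frechet_derivative_at[OF d_\<Gamma>c] by simp
  show ?thesis
    unfolding curvature_tensor_def christoffel_gc D
    unfolding \<Gamma>c_def curv_def hess_def
    by (simp add: g_simps \<Gamma>_simps uv vu \<Gamma>_sym[of x v u] sym[of x v "\<Gamma> x u v"] sym[of x u "\<Gamma> x v v"]
        sym[of x u "L x"] sym[of x v "L x"] algebra_simps power2_eq_square)
qed

text \<open>The two connections differ by the bracket in \<open>\<Gamma>c\<close>; the differential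
  of \<open>s\<close> applied to its value at \<open>v, v\<close> is the subtracted term.\<close>

lemma hessian_gc:
  "hessian gc (\<lambda>y. d * s y) x v v =
     d * (hess x v v - a * (2 * (g x (L x) v)\<^sup>2 - g x v v * g x (L x) (L x)))"
proof -
  have f: "frechet_derivative (\<lambda>y. d * s y) (at y) = (\<lambda>v. d * g y (L y) v)" for y
    using frechet_derivative_at[OF has_derivative_mult_right[OF ds]] by (metis)
  have "frechet_derivative (\<lambda>y. d * g y (L y) v) (at x) =
     (\<lambda>u. d * (g x (L u) v + g x (\<Gamma> x u (L x)) v + g x (L x) (\<Gamma> x u v)))"
    using frechet_derivative_at[OF has_derivative_mult_right[OF d_grad]] by metis
  then show ?thesis
    unfolding hessian_def f christoffel_gc
    by (simp add: \<Gamma>c_def hess_def g_simps algebra_simps power2_eq_square)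
qed

lemma cauchy_schwarz: "(g x u v)\<^sup>2 \<le> g x u u * g x v v"
proof (cases "v = 0")
  case False
  then have p: "g x v v > 0" by (rule pos)
  let ?w = "g x v v *\<^sub>R u - g x u v *\<^sub>R v"
  have "0 \<le> g x ?w ?w"
    using pos[of ?w x] by (cases "?w = 0") (auto simp: g_simps less_imp_le bilinear_lzero[OF bil])
  also have "\<dots> = g x v v * (g x u u * g x v v - (g x u v)\<^sup>2)"
    by (simp add: g_simps sym[of x v u] algebra_simps power2_eq_square)
  finally show ?thesis using p by (simp add: zero_le_mult_iff)
qed (simp add: bilinear_rzero[OF bil])

end

section \<open>The Fubini-Study metric in affine coordinates\<close>

text \<open>The complex form is kept beside its real part because its imaginary part, the Kaehler
  form up to sign, enters the curvature.\<close>

definition fubini_chart :: "complex ^ ('n::finite) \<Rightarrow> complex ^ 'n \<Rightarrow> complex ^ 'n \<Rightarrow> complex" where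
  "fubini_chart w u v = ((1 + herm w w) * herm u v - herm u w * herm w v) / (1 + herm w w)\<^sup>2"

text \<open>The connection of the Kaehler metric with potential \<open>log (1 + herm w w)\<close>.
  It is complex bilinear in \<open>u\<close> and \<open>v\<close>, as Kaehler metrics have it in
  holomorphic coordinates.\<close>

definition fubini_conn :: "complex ^ ('n::finite) \<Rightarrow> complex ^ 'n \<Rightarrow> complex ^ 'n \<Rightarrow> complex ^ 'n" where
  "fubini_conn w u v = (- (1 / (1 + herm w w))) *s (herm w u *s v + herm w v *s u)"

definition fubini_conn_deriv ::
  "complex ^ ('n::finite) \<Rightarrow> complex ^ 'n \<Rightarrow> complex ^ 'n \<Rightarrow> complex ^ 'n \<Rightarrow> complex ^ 'n" where
  "fubini_conn_deriv w u v x = (- (1 / (1 + herm w w))) *s (herm u v *s x + herm u x *s v)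
     + ((herm u w + herm w u) / (1 + herm w w)\<^sup>2) *s (herm w v *s x + herm w x *s v)"

lemma fubini_study_Re: "fubini_study w u v = Re (fubini_chart w u v)"
  by (simp add: fubini_study_def fubini_chart_def)

lemma fubini_chart_simps:
  "fubini_chart w (x + y) v = fubini_chart w x v + fubini_chart w y v"
  "fubini_chart w v (x + y) = fubini_chart w v x + fubini_chart w v y"
  "fubini_chart w (x - y) v = fubini_chart w x v - fubini_chart w y v"
  "fubini_chart w (c *s x) v = cnj c * fubini_chart w x v"
  "fubini_chart w v (c *s x) = c * fubini_chart w v x"
  by (simp_all add: fubini_chart_def herm_simps algebra_simps add_divide_distrib diff_divide_distrib)

lemma cnj_fubini_chart: "cnj (fubini_chart w u v) = fubini_chart w v u"
  by (simp add: fubini_chart_def cnj_herm mult.commute)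

lemma fubini_chart_alift:
  "fubini_chart w u v = fubini_form (alift i w) (insert_coord i u) (insert_coord i v)"
  by (simp add: fubini_chart_def fubini_form_def herm_insert_coord herm_alift_insert
      herm_insert_alift herm_alift)

lemma has_derivative_one_plus_herm:
  "((\<lambda>y. 1 + herm y y) has_derivative (\<lambda>u. herm w u + herm u w)) (at w)"
  by (rule has_derivative_eq_rhs,
      rule has_derivative_add[OF has_derivative_const
        bounded_bilinear.FDERIV[OF bounded_bilinear_herm has_derivative_ident has_derivative_ident]])
    (simp add: fun_eq_iff)

lemma has_derivative_herm_left: "((\<lambda>y. herm y v) has_derivative (\<lambda>u. herm u v)) (at w)"
  by (rule bounded_linear_imp_has_derivative,
      rule bounded_bilinear.bounded_linear_left[OF bounded_bilinear_herm])

lemma has_derivative_herm_right: "((\<lambda>y. herm v y) has_derivative (\<lambda>u. herm v u)) (at w)"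
  by (rule bounded_linear_imp_has_derivative,
      rule bounded_bilinear.bounded_linear_right[OF bounded_bilinear_herm])

text \<open>This compatibility singles out \<open>fubini_conn\<close> as the Levi-Civita connection.
  Both sides are fractions over powers of \<open>N = 1 + herm w w\<close>, which is real, and agree
  after clearing denominators.\<close>

lemma has_derivative_fubini_chart:
  "((\<lambda>y. fubini_chart y v x) has_derivative
     (\<lambda>u. fubini_chart w (fubini_conn w u v) x + fubini_chart w v (fubini_conn w u x))) (at w)"
proof -
  define N where "N = 1 + herm w w"
  have N: "N \<noteq> 0" unfolding N_def by simp
  have cN: "cnj N = N" by (simp add: N_def cnj_herm)
  have num: "((\<lambda>y. (1 + herm y y) * herm v x - herm v y * herm y x) has_derivative
      (\<lambda>u. (herm w u + herm u w) * herm v x - (herm v w * herm u x + herm v u * herm w x))) (at w)"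
    by (intro has_derivative_diff has_derivative_mult_left has_derivative_mult
        has_derivative_one_plus_herm has_derivative_herm_left has_derivative_herm_right)
  have den: "((\<lambda>y. (1 + herm y y)\<^sup>2) has_derivative (\<lambda>u. 2 * N * (herm w u + herm u w))) (at w)"
    unfolding power2_eq_square
    by (rule has_derivative_eq_rhs,
        rule has_derivative_mult[OF has_derivative_one_plus_herm has_derivative_one_plus_herm])
      (simp add: fun_eq_iff N_def algebra_simps)
  have "((\<lambda>y. fubini_chart y v x) has_derivative (\<lambda>u.
      (((herm w u + herm u w) * herm v x - (herm v w * herm u x + herm v u * herm w x)) * N\<^sup>2
        - (N * herm v x - herm v w * herm w x) * (2 * N * (herm w u + herm u w))) / (N\<^sup>2 * N\<^sup>2))) (at w)"
    unfolding fubini_chart_def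
    by (rule has_derivative_eq_rhs, rule has_derivative_divide'[OF num den])
      (simp_all add: N_def)
  then show ?thesis
  proof (rule has_derivative_eq_rhs)
    have 1: "fubini_chart w (fubini_conn w u v) x =
        - (herm u w * (N * herm v x - herm v w * herm w x) + herm v w * (N * herm u x - herm u w * herm w x)) / N ^ 3"
      for u
      using N unfolding fubini_conn_def fubini_chart_simps
      by (simp add: N_def[symmetric] cN cnj_herm fubini_chart_def divide_simps power2_eq_square power3_eq_cube
          algebra_simps)
    have 2: "fubini_chart w v (fubini_conn w u x) =
        - (herm w u * (N * herm v x - herm v w * herm w x) + herm w x * (N * herm v u - herm v w * herm w u)) / N ^ 3"
      for u
      using N unfolding fubini_conn_def fubini_chart_simps
      by (simp add: N_def[symmetric] fubini_chart_def divide_simps power2_eq_square power3_eq_cube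
          algebra_simps)
    show "(\<lambda>u. (((herm w u + herm u w) * herm v x - (herm v w * herm u x + herm v u * herm w x)) * N\<^sup>2
        - (N * herm v x - herm v w * herm w x) * (2 * N * (herm w u + herm u w))) / (N\<^sup>2 * N\<^sup>2)) =
      (\<lambda>u. fubini_chart w (fubini_conn w u v) x + fubini_chart w v (fubini_conn w u x))"
      unfolding 1 2 using N
      by (simp add: fun_eq_iff divide_simps power2_eq_square power3_eq_cube) (simp add: algebra_simps)
  qed
qed

lemma has_derivative_fubini_conn:
  "((\<lambda>y. fubini_conn y v x) has_derivative (\<lambda>u. fubini_conn_deriv w u v x)) (at w)"
proof -
  have 1: "((\<lambda>y. - (1 / (1 + herm y y))) has_derivative
      (\<lambda>u. (herm w u + herm u w) / (1 + herm w w)\<^sup>2)) (at w)"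
    by (rule has_derivative_eq_rhs,
        rule has_derivative_minus[OF has_derivative_divide'[OF has_derivative_const
            has_derivative_one_plus_herm]])
      (simp_all add: fun_eq_iff power2_eq_square minus_divide_left del: minus_divide_left[symmetric])
  have 2: "((\<lambda>y. herm y v *s x + herm y x *s v) has_derivative
      (\<lambda>u. herm u v *s x + herm u x *s v)) (at w)"
    by (intro has_derivative_add
        bounded_linear.has_derivative[OF bounded_bilinear.bounded_linear_left[OF bounded_bilinear_smult]]
        has_derivative_herm_left)
  show ?thesis
    unfolding fubini_conn_def
    by (rule has_derivative_eq_rhs, rule bounded_bilinear.FDERIV[OF bounded_bilinear_smult 1 2])
      (simp add: fun_eq_iff fubini_conn_deriv_def add.commute)
qed

text \<open>The gradient of the height generates a one-parameter group of diagonal projective maps, hence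
  it is linear in every affine chart.\<close>

definition grad_height :: "('n::finite) option \<Rightarrow> complex ^ 'n \<Rightarrow> complex ^ 'n" where
  "grad_height i w = (if i = None then 2 else 0) *s w
     - drop_coord i ((2 * insert_coord i w $ None) *s axis None 1)"

text \<open>In each chart one of the two terms is 0: for \<open>i = None\<close> the inserted vector
  has coordinate 0 at \<open>None\<close>, otherwise the first coefficient is 0.\<close>

lemma insert_grad_height:
  "insert_coord i (grad_height i w) =
     (if i = None then 2 else 0) *s insert_coord i w - (2 * insert_coord i w $ None) *s axis None 1"
proof (cases i)
  case None
  then show ?thesis by (simp add: grad_height_def insert_coord_smult)
next
  case (Some k)
  then show ?thesis
    by (simp add: grad_height_def insert_coord_minus insert_drop_coord) (simp add: axis_def)
qed

text \<open>Up to a multiple of \<open>alift i w\<close>, on which \<open>fubini_form\<close>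
  vanishes, the gradient is \<open>- 2 * z $ None\<close> times \<open>axis None 1\<close> with
  \<open>z = alift i w\<close>, whatever the chart. Later computations need no case split over
  \<open>i\<close>.\<close>

lemma insert_grad_height_alift:
  "insert_coord i (grad_height i w) =
     (if i = None then 2 else 0) *s alift i w - (2 * alift i w $ None) *s axis None 1"
  unfolding insert_grad_height alift_def
  by (cases i) (simp_all add: vec_eq_iff axis_def algebra_simps)

lemma linear_grad_height: "linear (grad_height i)"
  unfolding grad_height_def
  by (intro linearI)
    (simp_all add: insert_coord_add drop_coord_add insert_coord_scaleR drop_coord_smult scaleR_eq_smult insert_coord_smult
      vec_eq_iff algebra_simps)

lemma fubini_form_simps:
  "fubini_form z (x + y) v = fubini_form z x v + fubini_form z y v"
  "fubini_form z (x - y) v = fubini_form z x v - fubini_form z y v"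
  "fubini_form z v (x - y) = fubini_form z v x - fubini_form z v y"
  "fubini_form z (c *s x) v = cnj c * fubini_form z x v"
  "fubini_form z v (c *s x) = c * fubini_form z v x"
  by (simp_all add: fubini_form_def herm_simps algebra_simps add_divide_distrib diff_divide_distrib)

lemma fubini_form_radial: "fubini_form z z v = 0" "fubini_form z v z = 0"
  by (simp_all add: fubini_form_def mult.commute)

lemma fubini_form_axis:
  "fubini_form z (axis m 1) v = (herm z z * v $ m - z $ m * herm z v) / (herm z z)\<^sup>2"
  by (simp add: fubini_form_def herm_axis_left)

lemma fubini_form_axis_axis:
  "fubini_form z (axis m 1) (axis m 1) = (herm z z - z $ m * cnj (z $ m)) / (herm z z)\<^sup>2"
  by (simp add: fubini_form_def herm_axis_left herm_axis_right)

lemma fubini_chart_grad_height: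
  "fubini_chart w (grad_height i w) v =
     - 2 * cnj (alift i w $ None) * fubini_form (alift i w) (axis None 1) (insert_coord i v)"
  unfolding fubini_chart_alift[of _ _ _ i] insert_grad_height_alift
  by (simp add: fubini_form_simps fubini_form_radial)

lemma height_complex:
  "of_real (height z) = 1 - cnj (z $ None) * z $ None / herm z z"
  by (simp only: height_def herm_self of_real_diff of_real_divide of_real_1 complex_norm_square
      mult.commute)

lemma has_derivative_height:
  "((\<lambda>y. height (alift i y)) has_derivative (\<lambda>v. fubini_study w (grad_height i w) v)) (at w)"
proof -
  let ?c = "alift i w $ None" and ?N = "1 + herm w w"
  have h: "height (alift i y) = Re (1 - cnj (alift i y $ None) * alift i y $ None / (1 + herm y y))" for y
    by (simp only: height_complex[symmetric] herm_alift[of i y, symmetric] Re_complex_of_real)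
  have c: "((\<lambda>y. alift i y $ None) has_derivative (\<lambda>v. insert_coord i v $ None)) (at w)"
    by (rule bounded_linear.has_derivative[OF bounded_linear_vec_nth has_derivative_alift])
  have "((\<lambda>y. height (alift i y)) has_derivative (\<lambda>v. Re (0 -
     ((cnj ?c * insert_coord i v $ None + cnj (insert_coord i v $ None) * ?c) * ?N
       - cnj ?c * ?c * (herm w v + herm v w)) / (?N * ?N)))) (at w)"
    unfolding h
    by (intro bounded_linear.has_derivative[OF bounded_linear_Re] has_derivative_diff
        has_derivative_const has_derivative_divide' has_derivative_mult c
        bounded_linear.has_derivative[OF bounded_linear_cnj c] has_derivative_one_plus_herm) simp
  then show ?thesis
  proof (rule has_derivative_eq_rhs, intro ext)
    fix v
    \<comment> \<open>The complex pairing with the gradient is \<open>- 2 * ?Q\<close>, and the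
      quotient rule yields the real number \<open>- (?Q + cnj ?Q)\<close>; the real parts
      agree.\<close>
    let ?Q = "cnj ?c * fubini_form (alift i w) (axis None 1) (insert_coord i v)"
    have "0 - ((cnj ?c * insert_coord i v $ None + cnj (insert_coord i v $ None) * ?c) * ?N
       - cnj ?c * ?c * (herm w v + herm v w)) / (?N * ?N) = - (?Q + cnj ?Q)"
      unfolding fubini_form_axis
      by (simp add: cnj_herm herm_alift herm_alift_insert herm_insert_alift power2_eq_square
          divide_simps) (simp add: algebra_simps)
    then show "Re (0 - ((cnj ?c * insert_coord i v $ None + cnj (insert_coord i v $ None) * ?c) * ?N
       - cnj ?c * ?c * (herm w v + herm v w)) / (?N * ?N)) = fubini_study w (grad_height i w) v"
      by (simp only: fubini_study_Re fubini_chart_grad_height) simp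
  qed
qed

text \<open>With \<open>s = sin^2 r\<close>, where \<open>r\<close> is the distance from the point
  of height 0, this is \<open>(ds/dr)^2\<close>.\<close>

lemma norm_grad_height:
  "fubini_study w (grad_height i w) (grad_height i w) =
     4 * height (alift i w) * (1 - height (alift i w))"
proof -
  let ?c = "alift i w $ None" and ?N = "herm (alift i w) (alift i w)"
  have "fubini_chart w (grad_height i w) (grad_height i w) = 4 * (?c * cnj ?c) * (?N - ?c * cnj ?c) / ?N\<^sup>2"
    unfolding fubini_chart_grad_height insert_grad_height_alift
    by (simp add: fubini_form_simps fubini_form_radial fubini_form_axis_axis)
  also have "\<dots> = 4 * (1 - cnj ?c * ?c / ?N) * (1 - (1 - cnj ?c * ?c / ?N))"
    by (simp add: field_simps power2_eq_square)
  also have "\<dots> = of_real (4 * height (alift i w) * (1 - height (alift i w)))"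
    by (simp only: height_complex[symmetric]) simp
  finally show ?thesis by (simp only: fubini_study_Re Re_complex_of_real)
qed

text \<open>Up to a multiple of the representative, the covariant derivative of the gradient is a
  multiple of the lift \<open>V\<close> minus a multiple of \<open>axis None 1\<close>. The
  subtracted square therefore sees only the component of \<open>V\<close> along the horizontal part
  of \<open>axis None 1\<close>.\<close>

lemma hess_height:
  "fubini_study w (grad_height i v + fubini_conn w v (grad_height i w)) v =
     2 * (1 - height (alift i w)) * fubini_study w v v
     - 2 * (norm (alift i w))\<^sup>2 * (cmod (fubini_form (alift i w) (axis None 1) (insert_coord i v)))\<^sup>2"
proof -
  define z V c where "z = alift i w" and "V = insert_coord i v" and "c = z $ None"
  define N where "N = herm z z"
  define \<tau> :: complex where "\<tau> = (if i = None then 2 else 0)"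
  define F where "F = fubini_form z (axis None 1) V"
  have N0: "N \<noteq> 0" by (simp add: N_def z_def)
  have cN: "cnj N = N" by (simp add: N_def cnj_herm)
  have N1: "1 + herm w w = N" by (simp add: N_def z_def herm_alift)
  have c\<tau>: "cnj \<tau> = \<tau>" by (simp add: \<tau>_def)
  have zg: "herm w (grad_height i w) = \<tau> * N - 2 * c * cnj c"
    unfolding herm_alift_insert[of i, symmetric] insert_grad_height_alift
    by (simp add: herm_simps herm_axis_right N_def z_def \<tau>_def c_def)
  have F: "cnj (V $ None) * N - cnj c * herm V z = N\<^sup>2 * cnj F"
    using N0 unfolding F_def fubini_form_axis
    by (simp add: N_def[symmetric] cN cnj_herm c_def field_simps power2_eq_square)
  \<comment> \<open>The chart-dependent coefficient \<tau> cancels in front of \<open>V\<close> and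
    survives only in the multiple of \<open>z\<close>, which \<open>fubini_form\<close>
    ignores.\<close>
  have ins: "insert_coord i (grad_height i v + fubini_conn w v (grad_height i w)) =
      (2 * c * cnj c / N) *s V - (2 * V $ None - 2 * c * herm z V / N) *s axis None 1
      - (herm z V * \<tau> / N) *s z"
    unfolding fubini_conn_def insert_coord_add insert_coord_smult insert_grad_height[of i v]
      insert_grad_height_alift[of i w] N1 zg herm_alift_insert[of i w v, symmetric]
    using N0
    by (simp add: vec_eq_iff z_def[symmetric] V_def[symmetric] c_def[symmetric] \<tau>_def[symmetric]
        field_simps)
  have "fubini_chart w (grad_height i v + fubini_conn w v (grad_height i w)) v =
      cnj (2 * c * cnj c / N) * fubini_form z V V - cnj (2 * V $ None - 2 * c * herm z V / N) * F"
    unfolding fubini_chart_alift[of _ _ _ i] ins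
    by (simp add: z_def[symmetric] V_def[symmetric] fubini_form_simps fubini_form_radial F_def
        algebra_simps)
  also have "cnj (2 * V $ None - 2 * c * herm z V / N) = 2 * (cnj (V $ None) * N - cnj c * herm V z) / N"
    using N0 by (simp add: cnj_herm cN field_simps)
  also have "\<dots> = 2 * N * cnj F"
    unfolding F using N0 by (simp add: power2_eq_square)
  also have "cnj (2 * c * cnj c / N) = of_real (2 * (1 - height z))"
    using N0 by (simp add: height_complex cN N_def[symmetric] c_def[symmetric])
  also have "2 * N * cnj F * F = of_real (2 * (norm z)\<^sup>2 * (cmod F)\<^sup>2)"
    by (simp only: N_def herm_self of_real_mult complex_norm_square of_real_numeral mult_ac)
  also have "fubini_form z V V = fubini_chart w v v"
    by (simp add: fubini_chart_alift[of _ _ _ i] z_def V_def)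
  finally show ?thesis
    unfolding z_def[symmetric] V_def[symmetric] F_def[symmetric] fubini_study_Re by simp
qed

text \<open>Splitting off the components along \<open>z\<close> leaves the Hermitian product of the
  horizontal parts; this makes the form positive semidefinite and yields its Cauchy-Schwarz
  inequality.\<close>

lemma fubini_form_project:
  assumes "z \<noteq> 0"
  shows "fubini_form z x y =
    herm (x - (herm z x / herm z z) *s z) (y - (herm z y / herm z z) *s z) / herm z z"
  using assms
  by (simp add: fubini_form_def herm_simps cnj_herm power2_eq_square divide_simps)

lemma fubini_form_cauchy_schwarz:
  assumes "z \<noteq> 0"
  shows "(cmod (fubini_form z x y))\<^sup>2 \<le> Re (fubini_form z x x) * Re (fubini_form z y y)"
proof -
  define P where "P x = x - (herm z x / herm z z) *s z" for x
  have n: "(norm z)\<^sup>2 > 0" using assms by simp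
  have e: "fubini_form z x y = herm (P x) (P y) / of_real ((norm z)\<^sup>2)" for x y
    unfolding fubini_form_project[OF assms] P_def herm_self[of z] by simp
  have r: "Re (fubini_form z x x) = (norm (P x))\<^sup>2 / (norm z)\<^sup>2" for x
    unfolding e herm_self of_real_divide[symmetric] by (rule Re_complex_of_real)
  have "cmod (fubini_form z x y) \<le> norm (P x) * norm (P y) / (norm z)\<^sup>2"
    unfolding e norm_divide norm_of_real using norm_herm_le[of "P x" "P y"] n
    by (simp add: divide_right_mono)
  then have "(cmod (fubini_form z x y))\<^sup>2 \<le> (norm (P x) * norm (P y) / (norm z)\<^sup>2)\<^sup>2"
    by (intro power_mono) simp_all
  also have "\<dots> = Re (fubini_form z x x) * Re (fubini_form z y y)"
    unfolding r by (simp add: power2_eq_square)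
  finally show ?thesis .
qed

lemma hess_height_le:
  "fubini_study w (grad_height i v + fubini_conn w v (grad_height i w)) v
     \<le> 2 * (1 - height (alift i w)) * fubini_study w v v"
  unfolding hess_height by simp

text \<open>Cauchy-Schwarz bounds the subtracted square in \<open>hess_height\<close>. The form on
  \<open>axis None 1\<close> equals the height divided by the squared norm of the lift, which turns
  \<open>1 - s\<close> into \<open>1 - 2 s\<close>.\<close>

lemma hess_height_ge:
  "fubini_study w (grad_height i v + fubini_conn w v (grad_height i w)) v
     \<ge> 2 * (1 - 2 * height (alift i w)) * fubini_study w v v"
proof -
  let ?z = "alift i w"
  let ?F = "fubini_form ?z (axis None 1) (insert_coord i v)"
  have n: "(norm ?z)\<^sup>2 > 0" by simp
  have "fubini_form ?z (axis None 1) (axis None 1) = (1 - cnj (?z $ None) * ?z $ None / herm ?z ?z) / herm ?z ?z"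
    unfolding fubini_form_axis_axis by (simp add: field_simps power2_eq_square)
  also have "\<dots> = of_real (height ?z / (norm ?z)\<^sup>2)"
    by (simp only: height_complex herm_self of_real_divide)
  finally have "(cmod ?F)\<^sup>2 \<le> (height ?z / (norm ?z)\<^sup>2) * fubini_study w v v"
    using fubini_form_cauchy_schwarz[of ?z "axis None 1" "insert_coord i v"]
    by (simp only: fubini_study_alift[of w v v i] Re_complex_of_real alift_nonzero simp_thms
        not_False_eq_True)
  then have "(norm ?z)\<^sup>2 * (cmod ?F)\<^sup>2 \<le> height ?z * fubini_study w v v"
    using n by (simp add: field_simps)
  then show ?thesis unfolding hess_height by (simp add: algebra_simps)
qed

lemma height_bounds: "0 \<le> height z" "height z \<le> 1"
proof -
  have "(cmod (z $ None))\<^sup>2 \<le> (norm z)\<^sup>2"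
    by (intro power_mono Finite_Cartesian_Product.norm_nth_le norm_ge_zero)
  then show "0 \<le> height z" "height z \<le> 1"
    unfolding height_def by (auto simp: divide_le_eq_1)
qed

text \<open>The tensor of constant holomorphic curvature 4: if
  \<open>fubini_chart w u v = r + i t\<close>, the coefficient of \<open>v\<close> is
  \<open>- r - 3 i t\<close>, the usual sum of metric and complex structure terms.\<close>

lemma fubini_conn_curvature:
  "fubini_conn_deriv w u v v - fubini_conn_deriv w v u v
     + fubini_conn w u (fubini_conn w v v) - fubini_conn w v (fubini_conn w u v) =
   fubini_chart w v v *s u + (fubini_chart w v u - 2 * fubini_chart w u v) *s v"
proof -
  define N where "N = 1 + herm w w"
  have N: "N \<noteq> 0" unfolding N_def by simp
  show ?thesis
    using N unfolding fubini_conn_deriv_def fubini_conn_def fubini_chart_def herm_simps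
      N_def[symmetric]
    by (simp add: vec_eq_iff divide_simps power2_eq_square) (simp add: algebra_simps)
qed

text \<open>For an orthonormal pair this is the classical \<open>1 + 3 cos^2\<close> of the angle
  between \<open>v\<close> and \<open>i u\<close>, the cosine being the imaginary part of
  \<open>fubini_chart w u v\<close>.\<close>

lemma fubini_study_curvature:
  "fubini_study w (fubini_conn_deriv w u v v - fubini_conn_deriv w v u v
     + fubini_conn w u (fubini_conn w v v) - fubini_conn w v (fubini_conn w u v)) u =
   fubini_study w u u * fubini_study w v v + 3 * (Im (fubini_chart w u v))\<^sup>2 - (fubini_study w u v)\<^sup>2"
proof -
  define r t where "r = Re (fubini_chart w u v)" and "t = Im (fubini_chart w u v)"
  have uv: "fubini_chart w u v = Complex r t" and vu: "fubini_chart w v u = Complex r (- t)"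
    by (simp_all add: r_def t_def complex_eq_iff cnj_fubini_chart[of w u v, symmetric])
  have self: "Im (fubini_chart w x x) = 0" for x
    using arg_cong[OF cnj_fubini_chart[of w x x], of Im] by simp
  show ?thesis
    unfolding fubini_conn_curvature fubini_study_Re fubini_chart_simps
    by (simp add: uv vu self algebra_simps power2_eq_square)
qed

definition min_curvature :: "'n itself \<Rightarrow> real" where
  "min_curvature _ = (if CARD('n) = 1 then 4 else 1)"

lemma fubini_study_curvature_ge:
  fixes w :: "complex ^ ('n::finite)"
  assumes "fubini_study w u v = 0"
  shows "min_curvature TYPE('n) * (fubini_study w u u * fubini_study w v v) \<le>
    fubini_study w (fubini_conn_deriv w u v v - fubini_conn_deriv w v u v
     + fubini_conn w u (fubini_conn w v v) - fubini_conn w v (fubini_conn w u v)) u"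
proof (cases "CARD('n) = 1")
  case True
  then obtain k where k: "(UNIV :: 'n set) = {k}" by (auto simp: card_1_singleton_iff)
  \<comment> \<open>With a single coordinate the form is a multiple of \<open>cnj u * v\<close>, so
    Cauchy-Schwarz is an equality and orthogonality forces the largest possible imaginary
    part.\<close>
  have "fubini_chart w u v * fubini_chart w v u = fubini_chart w u u * fubini_chart w v v"
    by (simp add: fubini_chart_def herm_def k algebra_simps)
  moreover have "Re (fubini_chart w u v * fubini_chart w v u) = (Im (fubini_chart w u v))\<^sup>2"
    using assms by (simp add: cnj_fubini_chart[of w u v, symmetric] fubini_study_Re power2_eq_square)
  moreover have "Im (fubini_chart w u u) = 0"
    using arg_cong[OF cnj_fubini_chart[of w u u], of Im] by simp
  ultimately have "(Im (fubini_chart w u v))\<^sup>2 = fubini_study w u u * fubini_study w v v"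
    by (simp add: fubini_study_Re)
  then show ?thesis
    unfolding fubini_study_curvature min_curvature_def using True assms by simp
next
  case False
  then show ?thesis
    unfolding fubini_study_curvature min_curvature_def using assms by simp
qed

text \<open>Metric and connection have one formula in all affine charts; only the height and its
  gradient depend on \<open>i\<close>. Both \<open>i\<close> and \<open>a\<close> stay free in the
  resulting facts.\<close>

interpretation fubini: conformal_change fubini_study fubini_conn fubini_conn_deriv
  "\<lambda>x. height (alift i x)" "grad_height i" a for i :: "('n::finite) option" and a
proof (rule conformal_change.intro)
  show "((\<lambda>y. fubini_study y v w) has_derivative
      (\<lambda>u. fubini_study x (fubini_conn x u v) w + fubini_study x v (fubini_conn x u w))) (at x)"
    for x v w :: "complex ^ 'n"
    unfolding fubini_study_Re
    by (rule has_derivative_eq_rhs,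
        rule bounded_linear.has_derivative[OF bounded_linear_Re has_derivative_fubini_chart]) simp
  show "bilinear (fubini_conn x)" for x :: "complex ^ 'n"
    unfolding bilinear_def fubini_conn_def
    by (auto intro!: linearI simp: herm_simps scaleR_eq_smult vec_eq_iff algebra_simps
        add_divide_distrib)
  show "fubini_conn x u v = fubini_conn x v u" for x u v :: "complex ^ 'n"
    by (simp add: fubini_conn_def add.commute)
qed (rule bilinear_fubini_study fubini_study_sym fubini_study_pos has_derivative_fubini_conn
    has_derivative_height linear_grad_height | assumption)+

section \<open>Curvature estimates for the conformal metric\<close>

lemma conformal_metric_gc:
  "conformal_metric a (cp_chart_dom i, cp_chart i) = fubini.gc i a"
  by (intro ext) (simp add: conformal_metric_chart fubini.gc_def)

text \<open>A unit vector of the conformal metric has squared Fubini-Study length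
  \<open>q = exp (- 2 a s)\<close>. Curvature and Hessian are each at least \<open>q\<close> times a
  polynomial in \<open>s\<close>, and \<open>pos\<close> makes the sum of the two polynomials
  positive.\<close>

lemma weighted_sec_pos_conformal:
  fixes a d :: real
  assumes a: "a \<ge> 0" "d \<ge> 0" and
    pos: "\<And>s. 0 \<le> s \<Longrightarrow> s \<le> 1 \<Longrightarrow> min_curvature TYPE('n::finite) - 4 * a * (1 - s) - 4 * a\<^sup>2 * s * (1 - s)
      + d * (2 - 4 * s - 4 * a * s * (1 - s)) > 0"
  shows "weighted_sec_pos CP (conformal_metric a :: (_, complex ^ 'n) metric)
    (\<lambda>L. d * line_height L)"
proof -
  have "weighted_sec (fubini.gc i a) (\<lambda>x. d * height (alift i x)) x v u > 0"
    if u: "fubini.gc i a x u u = 1" and v: "fubini.gc i a x v v = 1" and uv: "fubini.gc i a x u v = 0"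
    for i :: "'n option" and x u v
  proof -
    define s E q where "s = height (alift i x)" and "E = exp (2 * a * s)" and "q = 1 / E"
    define G where "G = grad_height i x"
    have E: "E > 0" by (simp add: E_def)
    have Eq: "E * q = 1" and q: "q > 0" using E by (simp_all add: q_def)
    have s: "0 \<le> s" "s \<le> 1" by (simp_all add: s_def height_bounds)
    have gc: "fubini.gc i a x y z = E * fubini_study x y z" for y z
      by (simp add: fubini.gc_def E_def s_def)
    have uu: "fubini_study x u u = q" and vv: "fubini_study x v v = q" and uv0: "fubini_study x u v = 0"
      using u v uv E unfolding gc q_def by (simp_all add: field_simps)
    have GG: "fubini_study x G G = 4 * s * (1 - s)"
      unfolding G_def s_def by (rule norm_grad_height)
    have Gu: "(fubini_study x G u)\<^sup>2 \<ge> 0" by simp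
    have Gv: "(fubini_study x G v)\<^sup>2 \<le> 4 * s * (1 - s) * q"
      using fubini.cauchy_schwarz[of x G v] by (simp add: GG vv)
    have Hu: "fubini.hess i x u u \<le> 2 * (1 - s) * q"
      unfolding fubini.hess_def s_def uu[symmetric] by (rule hess_height_le)
    have Hv: "fubini.hess i x v v \<le> 2 * (1 - s) * q" "fubini.hess i x v v \<ge> 2 * (1 - 2 * s) * q"
      unfolding fubini.hess_def s_def vv[symmetric] by (rule hess_height_le hess_height_ge)+
    have R: "fubini_study x (fubini.curv x u v v) u \<ge> min_curvature TYPE('n) * (q * q)"
      using fubini_study_curvature_ge[OF uv0] unfolding fubini.curv_def uu vv .
    define W where "W = fubini_study x (fubini.curv x u v v) u - a * (q * fubini.hess i x u u + q * fubini.hess i x v v)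
        + a\<^sup>2 * (q * (fubini_study x G u)\<^sup>2 + q * (fubini_study x G v)\<^sup>2 - 4 * s * (1 - s) * q * q)"
    have sc: "sectional_curvature (fubini.gc i a) x u v = E * W"
      unfolding sectional_curvature_def u v uv gc fubini.curvature_gc[OF uv0]
      by (simp add: uu vv uv0 Eq GG W_def G_def[symmetric])
    have hs: "hessian (fubini.gc i a) (\<lambda>x. d * height (alift i x)) x v v =
        d * (fubini.hess i x v v - a * (2 * (fubini_study x G v)\<^sup>2 - q * (4 * s * (1 - s))))"
      unfolding fubini.hessian_gc by (simp add: vv GG G_def[symmetric])
    \<comment> \<open>The Hessians enter with a minus sign, so their upper bounds count here; the
      squares of the pairings with the gradient are discarded.\<close>
    have "W \<ge> (min_curvature TYPE('n) - 4 * a * (1 - s) - 4 * a\<^sup>2 * s * (1 - s)) * (q * q)"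
    proof -
      have "a * (q * (fubini.hess i x u u + fubini.hess i x v v)) \<le> a * (q * (4 * (1 - s) * q))"
        using Hu Hv(1) a q by (intro mult_left_mono) (simp_all add: algebra_simps)
      moreover have "a\<^sup>2 * (q * (fubini_study x G u)\<^sup>2 + q * (fubini_study x G v)\<^sup>2) \<ge> 0"
        using q by simp
      ultimately show ?thesis using R unfolding W_def by (simp add: algebra_simps)
    qed
    then have "E * W \<ge> E * ((min_curvature TYPE('n) - 4 * a * (1 - s) - 4 * a\<^sup>2 * s * (1 - s)) * (q * q))"
      using E by simp
    moreover have "E * (k * (q * q)) = k * q" for k
    proof -
      have "E * (k * (q * q)) = k * q * (E * q)" by (simp only: mult_ac)
      then show ?thesis by (simp only: Eq mult_1_right)
    qed
    ultimately have 1: "E * W \<ge> (min_curvature TYPE('n) - 4 * a * (1 - s) - 4 * a\<^sup>2 * s * (1 - s)) * q"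
      by simp
    \<comment> \<open>Now the lower bound of the Hessian counts. The squared pairing costs at most
      \<open>8 a s (1 - s) q\<close>, half of which the last summand returns.\<close>
    have 2: "d * (fubini.hess i x v v - a * (2 * (fubini_study x G v)\<^sup>2 - q * (4 * s * (1 - s)))) \<ge>
        d * ((2 - 4 * s - 4 * a * s * (1 - s)) * q)"
    proof (rule mult_left_mono[OF _ a(2)])
      have "a * (fubini_study x G v)\<^sup>2 \<le> a * (4 * s * (1 - s) * q)"
        using Gv a by (intro mult_left_mono)
      then show "(2 - 4 * s - 4 * a * s * (1 - s)) * q
          \<le> fubini.hess i x v v - a * (2 * (fubini_study x G v)\<^sup>2 - q * (4 * s * (1 - s)))"
        using Hv(2) by (simp add: algebra_simps)
    qed
    have 3: "(min_curvature TYPE('n) - 4 * a * (1 - s) - 4 * a\<^sup>2 * s * (1 - s)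
      + d * (2 - 4 * s - 4 * a * s * (1 - s))) * q > 0"
      using pos[OF s] q by simp
    show ?thesis
      unfolding weighted_sec_def sc hs
      using add_mono[OF 1 2] 3 by (simp add: algebra_simps)
  qed
  then show ?thesis
    unfolding weighted_sec_pos_def CP_def
    by (auto simp: conformal_metric_gc o_def inv_into_cp_chart line_height_cline)
qed

text \<open>At affine coordinate 0 of the chart \<open>None\<close> the height and its gradient
  vanish and the Hessian is twice the metric, so \<open>- 4 a\<close> is the whole correction to the
  curvature of an orthonormal pair.\<close>

lemma not_sec_nonneg_conformal:
  fixes a :: real
  assumes a: "4 * a > min_curvature TYPE('n::finite)"
  shows "\<not> sec_nonneg CP (conformal_metric a :: (_, complex ^ 'n) metric)"
proof -
  have s0: "height (alift None (0 :: complex ^ 'n)) = 0"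
    by (simp add: height_def norm_alift)
  have fs: "fubini_study 0 u v = Re (herm u v)" "fubini_chart 0 u v = herm u v" for u v :: "complex ^ 'n"
    by (simp_all add: fubini_study_def fubini_chart_def)
  \<comment> \<open>The least curvature is attained on a complex line if there is one coordinate,
    and otherwise on the totally real plane of two coordinate vectors.\<close>
  have "\<exists>u v :: complex ^ 'n. Re (herm u v) = 0 \<and> herm u u = 1 \<and> herm v v = 1 \<and>
      1 + 3 * (Im (herm u v))\<^sup>2 = min_curvature TYPE('n)"
  proof (cases "CARD('n) = 1")
    case True
    have "herm (axis k 1) (\<i> *s axis k 1) = \<i>" "herm (\<i> *s axis k 1) (\<i> *s axis k 1) = 1"
      "herm (axis k 1) (axis k 1) = 1" for k :: 'n
      by (simp_all add: herm_simps herm_axis_left)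
    then show ?thesis using True
      by (intro exI[of _ "axis undefined 1"] exI[of _ "\<i> *s axis undefined 1"])
        (simp add: min_curvature_def)
  next
    case False
    have "(UNIV :: 'n set) \<noteq> {undefined}"
    proof
      assume "(UNIV :: 'n set) = {undefined}"
      then have "CARD('n) = card {undefined :: 'n}" by (rule arg_cong)
      then show False using False by simp
    qed
    then obtain j where "j \<noteq> (undefined :: 'n)" by auto
    then obtain j k :: 'n where "j \<noteq> k" by iprover
    then have "herm (axis j 1) (axis k 1) = 0" "herm (axis j 1) (axis j 1) = 1"
      "herm (axis k 1) (axis k 1) = 1"
      by (simp_all add: herm_axis_left) (simp add: axis_def)
    then show ?thesis using False
      by (intro exI[of _ "axis j 1"] exI[of _ "axis k 1"]) (simp add: min_curvature_def)
  qed
  then obtain u v :: "complex ^ 'n" where uv: "Re (herm u v) = 0" "herm u u = 1" "herm v v = 1"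
      "1 + 3 * (Im (herm u v))\<^sup>2 = min_curvature TYPE('n)"
    by blast
  have G: "grad_height None (0 :: complex ^ 'n) = 0"
    using linear_0[OF linear_grad_height] .
  have H: "fubini.hess None 0 y y = 2 * Re (herm y y)" for y :: "complex ^ 'n"
    unfolding fubini.hess_def hess_height s0 fubini_form_axis fs
    by (simp add: herm_alift_insert)
  have "fubini_study 0 (curvature_tensor (fubini.gc None a) 0 u v v) u = min_curvature TYPE('n) - 4 * a"
  proof -
    have uv0: "fubini_study 0 u v = 0" using uv by (simp add: fs)
    show ?thesis
      unfolding fubini.curvature_gc[OF uv0] H G fubini.curv_def fubini_study_curvature
      using uv by (simp add: fs)
  qed
  then have "sectional_curvature (fubini.gc None a) 0 u v < 0"
    using a uv by (simp add: sectional_curvature_def fubini.gc_def s0 fs)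
  moreover have "u \<noteq> v"
    using uv by auto
  moreover have "independent {u, v}"
  proof -
    have o: "u \<bullet> v = 0" and "u \<noteq> 0" "v \<noteq> 0" using uv by (auto simp: Re_herm)
    then show ?thesis
      using \<open>u \<noteq> v\<close> by (intro pairwise_orthogonal_independent)
        (auto simp: pairwise_def orthogonal_def inner_commute)
  qed
  ultimately show ?thesis
  proof (intro notI)
    assume "sectional_curvature (fubini.gc None a) 0 u v < 0" "u \<noteq> v" "independent {u, v}"
      and "sec_nonneg CP (conformal_metric a :: (_, complex ^ 'n) metric)"
    moreover have "(cp_chart_dom None, cp_chart None :: _ \<Rightarrow> complex ^ 'n) \<in> CP"
      "0 \<in> cp_chart None ` (cp_chart_dom None :: (complex ^ 'n option) set set)"
      by (simp_all add: CP_def cp_chart_image)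
    ultimately show False
      unfolding sec_nonneg_def conformal_metric_gc[symmetric] by fastforce
  qed
qed

section \<open>Unitary matrices and the Cayley transform\<close>

definition adj :: "complex ^ 'm ^ 'l \<Rightarrow> complex ^ 'l ^ 'm" where
  "adj A = (\<chi> i j. cnj (A $ j $ i))"

lemma adj_mult: "adj (A ** B) = adj B ** adj A"
  by (simp add: adj_def matrix_matrix_mult_def vec_eq_iff mult.commute)

lemma adj_adj [simp]: "adj (adj A) = A"
  by (simp add: adj_def vec_eq_iff)

lemma adj_add: "adj (A + B) = adj A + adj B"
  by (simp add: adj_def vec_eq_iff)

lemma adj_scaleR: "adj (r *\<^sub>R A) = r *\<^sub>R adj A"
  by (simp add: adj_def vec_eq_iff)

lemma adj_one [simp]: "adj (mat 1) = mat 1"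
  by (simp add: adj_def vec_eq_iff mat_def)

lemma herm_adj: "herm (A *v x) y = herm x (adj A *v y)"
proof -
  have "herm (A *v x) y = (\<Sum>m\<in>UNIV. \<Sum>k\<in>UNIV. cnj (A $ m $ k) * cnj (x $ k) * y $ m)"
    by (simp add: herm_def matrix_vector_mult_def sum_distrib_right)
  also have "\<dots> = (\<Sum>k\<in>UNIV. \<Sum>m\<in>UNIV. cnj (A $ m $ k) * cnj (x $ k) * y $ m)"
    by (rule sum.swap)
  also have "\<dots> = herm x (adj A *v y)"
    by (simp add: herm_def adj_def matrix_vector_mult_def sum_distrib_left mult_ac)
  finally show ?thesis .
qed

lemma smooth_on_adj: "smooth_on S f \<Longrightarrow> smooth_on S (\<lambda>x. adj (f x))"
  unfolding adj_def by (intro smooth_on_intros)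

lemma scaleR_matrix_mult: "(r *\<^sub>R A) ** B = r *\<^sub>R (A ** B :: complex ^ 'k ^ 'l)"
  by (simp add: matrix_matrix_mult_def vec_eq_iff scaleR_sum_right)

lemma matrix_mult_scaleR: "A ** (r *\<^sub>R B) = r *\<^sub>R (A ** B :: complex ^ 'k ^ 'l)"
  by (simp add: matrix_matrix_mult_def vec_eq_iff scaleR_sum_right)

lemma scaleR_matrix_vector: "(r *\<^sub>R A) *v x = r *\<^sub>R (A *v x :: complex ^ 'l)"
  by (simp add: matrix_vector_mult_def vec_eq_iff scaleR_sum_right)

lemma matrix_mult_add: "A ** (B + C) = A ** B + (A ** C :: complex ^ 'k ^ 'l)"
  by (simp add: matrix_matrix_mult_def vec_eq_iff distrib_left sum.distrib)

lemma add_matrix_mult: "(B + C) ** A = B ** A + (C ** A :: complex ^ 'k ^ 'l)"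
  by (simp add: matrix_matrix_mult_def vec_eq_iff distrib_right sum.distrib)

lemma add_matrix_vector: "(B + C) *v x = B *v x + (C *v x :: complex ^ 'l)"
  by (simp add: matrix_vector_mult_def vec_eq_iff distrib_right sum.distrib)

lemma det_nonzero_of_right_inverse:
  fixes A :: "'a::field ^ 'n ^ 'n"
  shows "A ** B = mat 1 \<Longrightarrow> det A \<noteq> 0"
  unfolding invertible_det_nz[symmetric] invertible_right_inverse by (rule exI)

lemma matrix_inv_unique:
  fixes A :: "'a::field ^ 'n ^ 'n"
  assumes "A ** B = mat 1" shows "matrix_inv A = B"
proof -
  have 1: "B ** A = mat 1" using assms matrix_left_right_inverse[of A B] by simp
  have 2: "A ** matrix_inv A = mat 1"
    by (rule matrix_inv_right[OF det_nonzero_of_right_inverse[OF assms]])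
  have "matrix_inv A = (B ** A) ** matrix_inv A" by (simp add: 1)
  also have "\<dots> = B ** (A ** matrix_inv A)" by (simp only: matrix_mul_assoc)
  finally show ?thesis by (simp add: 2)
qed

text \<open>Since \<open>1 - X = 2 - (1 + X)\<close>, this is the Cayley transform
  \<open>(1 - X) (1 + X)^(-1)\<close>, written with a single occurrence of the inverse.\<close>

definition cay :: "complex ^ ('m::finite) ^ 'm \<Rightarrow> complex ^ 'm ^ 'm" where
  "cay X = 2 *\<^sub>R matrix_inv (mat 1 + X) - mat 1"

text \<open>The equation \<open>(1 + X)(1 + Y) = 2\<close> characterizes \<open>Y = cay X\<close> and is symmetric.\<close>

lemma cay_relation:
  assumes "det (mat 1 + X) \<noteq> 0"
  shows "(mat 1 + X) ** (mat 1 + cay X) = 2 *\<^sub>R mat 1"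
  by (simp add: cay_def matrix_mult_scaleR matrix_inv_right[OF assms])

lemma cay_relation_commute:
  fixes X Y :: "complex ^ ('m::finite) ^ 'm"
  assumes "X ** Y = 2 *\<^sub>R mat 1" shows "Y ** X = 2 *\<^sub>R mat 1"
proof -
  have "X ** ((1/2) *\<^sub>R Y) = mat 1" by (simp add: matrix_mult_scaleR assms)
  then have "((1/2) *\<^sub>R Y) ** X = mat 1" using matrix_left_right_inverse by metis
  then have "2 *\<^sub>R (((1/2) *\<^sub>R Y) ** X) = 2 *\<^sub>R mat 1" by simp
  then show ?thesis by (simp add: scaleR_matrix_mult)
qed

lemma cay_eqI:
  assumes "(mat 1 + X) ** (mat 1 + Y) = 2 *\<^sub>R mat 1"
  shows "det (mat 1 + X) \<noteq> 0" "cay X = Y"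
proof -
  have "(mat 1 + X) ** ((1/2) *\<^sub>R (mat 1 + Y)) = mat 1"
    by (simp add: matrix_mult_scaleR assms)
  then show "det (mat 1 + X) \<noteq> 0" "cay X = Y"
    unfolding cay_def by (simp_all add: det_nonzero_of_right_inverse matrix_inv_unique)
qed

lemma cay_cay:
  assumes "det (mat 1 + X) \<noteq> 0"
  shows "det (mat 1 + cay X) \<noteq> 0" "cay (cay X) = X"
  using cay_eqI[OF cay_relation_commute[OF cay_relation[OF assms]]] by auto

text \<open>For \<open>e = base_vec\<close> this is a copy of \<open>U(n)\<close>, acting on the
  remaining homogeneous coordinates.\<close>

definition unitary_fixing :: "complex ^ ('m::finite) \<Rightarrow> (complex ^ 'm ^ 'm) set" where
  "unitary_fixing e = {A. adj A ** A = mat 1 \<and> A *v e = e}"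

text \<open>The Lie algebra of \<open>unitary_fixing e\<close>. As a real subspace it is the model
  space of the group atlas, so its dimension never has to be computed.\<close>

definition skew_killing :: "complex ^ ('m::finite) \<Rightarrow> (complex ^ 'm ^ 'm) set" where
  "skew_killing e = {X. adj X = - X \<and> X *v e = 0}"

lemma unitary_fixingD:
  assumes "A \<in> unitary_fixing e"
  shows "adj A ** A = mat 1" "A ** adj A = mat 1" "A *v e = e" "adj A *v e = e"
proof -
  show 1: "adj A ** A = mat 1" and 2: "A *v e = e" using assms by (auto simp: unitary_fixing_def)
  show "A ** adj A = mat 1" using 1 matrix_left_right_inverse by metis
  have "adj A *v e = adj A *v (A *v e)" by (simp add: 2)
  then show "adj A *v e = e" by (simp add: matrix_vector_mul_assoc 1)
qed

lemma unitary_fixing_one: "mat 1 \<in> unitary_fixing e"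
  by (simp add: unitary_fixing_def)

lemma unitary_fixing_mult:
  assumes "A \<in> unitary_fixing e" "B \<in> unitary_fixing e" shows "A ** B \<in> unitary_fixing e"
proof -
  have "adj (A ** B) ** (A ** B) = adj B ** (adj A ** A) ** B"
    by (simp add: adj_mult matrix_mul_assoc)
  then show ?thesis
    using unitary_fixingD[OF assms(1)] unitary_fixingD[OF assms(2)]
    by (simp add: unitary_fixing_def matrix_vector_mul_assoc[symmetric])
qed

lemma unitary_fixing_adj:
  assumes "A \<in> unitary_fixing e" shows "adj A \<in> unitary_fixing e"
  using unitary_fixingD(2,4)[OF assms] unfolding unitary_fixing_def by simp

lemma herm_unitary:
  assumes "A \<in> unitary_fixing e" shows "herm (A *v x) (A *v y) = herm x y"
  by (simp add: herm_adj matrix_vector_mul_assoc unitary_fixingD[OF assms])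

lemma subspace_skew_killing: "subspace (skew_killing e)"
  unfolding subspace_def skew_killing_def
  by (auto simp: adj_add adj_scaleR add_matrix_vector scaleR_matrix_vector)
    (simp add: adj_def vec_eq_iff)

text \<open>A kernel vector of \<open>mat 1 + X\<close> would be an eigenvector of \<open>X\<close>
  for -1, but eigenvalues of skew-Hermitian matrices are imaginary.\<close>

lemma det_skew:
  assumes "X \<in> skew_killing e" shows "det (mat 1 + X) \<noteq> 0"
proof -
  have "x = 0" if "(mat 1 + X) *v x = 0" for x
  proof -
    have X: "X *v x = - x"
      using that by (simp add: add_matrix_vector eq_neg_iff_add_eq_0 add.commute)
    have "herm (X *v x) x = herm x ((- X) *v x)"
      using assms by (simp add: herm_adj skew_killing_def)
    also have "(- X) *v x = x"
      using scaleR_matrix_vector[of "- 1" X x] by (simp add: X)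
    finally have "herm x x = 0" by (simp add: X herm_minus_left eq_neg_iff_add_eq_0)
    then show ?thesis by simp
  qed
  then show ?thesis
    unfolding invertible_det_nz[symmetric] invertible_left_inverse
    by (auto simp: matrix_left_invertible_ker)
qed

text \<open>In terms of \<open>S = 1 + X\<close> and \<open>T = 1 + Y\<close>, skewness reads
  \<open>S + adj S = 2\<close> and unitarity reads \<open>adj T ** T = adj T + T\<close>.
  Multiplying the first by \<open>adj T\<close> on the left and \<open>T\<close> on the right gives
  the second; the converse multiplies by \<open>adj S\<close> and \<open>S\<close>.\<close>

lemma cay_unitary_iff:
  assumes rel: "(mat 1 + X) ** (mat 1 + Y) = 2 *\<^sub>R mat 1"
  shows "X \<in> skew_killing e \<longleftrightarrow> Y \<in> unitary_fixing e"
proof -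
  define S T where "S = mat 1 + X" and "T = mat 1 + Y"
  have ST: "S ** T = 2 *\<^sub>R mat 1" using rel by (simp add: S_def T_def)
  have TS: "T ** S = 2 *\<^sub>R mat 1" by (rule cay_relation_commute[OF ST])
  have aTS: "adj T ** adj S = 2 *\<^sub>R mat 1" "adj S ** adj T = 2 *\<^sub>R mat 1"
    using arg_cong[OF ST, of adj] arg_cong[OF TS, of adj] by (simp_all add: adj_mult adj_scaleR)
  have skew: "adj X = - X \<longleftrightarrow> S + adj S = 2 *\<^sub>R mat 1"
    unfolding S_def adj_add adj_one by (auto simp: eq_neg_iff_add_eq_0 scaleR_2 algebra_simps)
  have uni: "adj Y ** Y = mat 1 \<longleftrightarrow> adj T ** T = adj T + T"
    unfolding T_def adj_add adj_one
    by (auto simp: matrix_mult_add add_matrix_mult algebra_simps)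
  have iff: "S + adj S = 2 *\<^sub>R mat 1 \<longleftrightarrow> adj T ** T = adj T + T"
  proof
    assume a: "S + adj S = 2 *\<^sub>R mat 1"
    have "adj T ** (S + adj S) ** T = adj T ** (S ** T) + (adj T ** adj S) ** T"
      by (simp add: matrix_mult_add add_matrix_mult matrix_mul_assoc)
    then have "2 *\<^sub>R (adj T ** T) = 2 *\<^sub>R (adj T + T)"
      unfolding a by (simp add: ST aTS matrix_mult_scaleR scaleR_matrix_mult scaleR_add_right)
    then show "adj T ** T = adj T + T" by simp
  next
    assume a: "adj T ** T = adj T + T"
    have "adj S ** (adj T ** T) ** S = (adj S ** adj T) ** (T ** S)"
      by (simp only: matrix_mul_assoc)
    moreover have "adj S ** (adj T + T) ** S = (adj S ** adj T) ** S + adj S ** (T ** S)"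
      by (simp add: matrix_mult_add add_matrix_mult matrix_mul_assoc)
    ultimately have "2 *\<^sub>R (S + adj S) = 2 *\<^sub>R (2 *\<^sub>R mat 1)"
      unfolding a by (simp add: TS aTS matrix_mult_scaleR scaleR_matrix_mult scaleR_add_right)
    then show "S + adj S = 2 *\<^sub>R mat 1" by (rule scaleR_left_imp_eq[rotated]) simp
  qed
  have e: "X *v e = 0 \<longleftrightarrow> Y *v e = e"
  proof -
    have "S *v e = e \<longleftrightarrow> T *v e = 2 *\<^sub>R e"
    proof
      assume "S *v e = e"
      then have "T *v e = (T ** S) *v e" by (simp add: matrix_vector_mul_assoc[symmetric])
      then show "T *v e = 2 *\<^sub>R e" by (simp add: TS scaleR_matrix_vector)
    next
      assume "T *v e = 2 *\<^sub>R e"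
      then have "S *v (2 *\<^sub>R e) = (S ** T) *v e" by (simp add: matrix_vector_mul_assoc[symmetric])
      then have "2 *\<^sub>R (S *v e) = 2 *\<^sub>R e"
        by (simp add: ST scaleR_matrix_vector linear_scale[OF bounded_linear.linear[OF bounded_linear_matrix_vector]])
      then show "S *v e = e" by simp
    qed
    then show ?thesis
      by (simp add: S_def T_def add_matrix_vector scaleR_2)
  qed
  show ?thesis
    unfolding skew_killing_def unitary_fixing_def using skew uni iff e by simp
qed

lemma cay_skew: "X \<in> skew_killing e \<Longrightarrow> cay X \<in> unitary_fixing e"
  using cay_unitary_iff[OF cay_relation[OF det_skew]] by blast

lemma cay_unitary:
  assumes "A \<in> unitary_fixing e" "det (mat 1 + A) \<noteq> 0" shows "cay A \<in> skew_killing e"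
  using cay_unitary_iff[OF cay_relation_commute[OF cay_relation[OF assms(2)]]] assms(1) by blast

lemma smooth_on_cay:
  "smooth_on S f \<Longrightarrow> (\<And>x. x \<in> S \<Longrightarrow> det (mat 1 + f x) \<noteq> 0) \<Longrightarrow> smooth_on S (\<lambda>x. cay (f x))"
  unfolding cay_def
  by (intro smooth_on_diff smooth_on_scaleR smooth_on_matrix_inv smooth_on_add smooth_on_const)

lemma compact_unitary_fixing: "compact (unitary_fixing e)"
  unfolding compact_eq_bounded_closed
proof
  have "continuous_on UNIV (\<lambda>A :: complex ^ 'a ^ 'a. adj A ** A)"
    "continuous_on UNIV (\<lambda>A :: complex ^ 'a ^ 'a. A *v e)"
    by (intro smooth_on_imp_continuous_on smooth_on_matrix_mult smooth_on_adj smooth_on_ident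
        smooth_on_matrix_vector_mult smooth_on_const)+
  then show "closed (unitary_fixing e)"
    unfolding unitary_fixing_def by (intro closed_Collect_conj closed_Collect_eq continuous_on_const)
  have "norm A \<le> (\<Sum>i\<in>(UNIV :: 'a set). \<Sum>j\<in>(UNIV :: 'a set). 1)"
    if A: "A \<in> unitary_fixing e" for A :: "complex ^ 'a ^ 'a"
  proof -
    have c: "cmod (A $ i $ j) \<le> 1" for i j
    proof -
      have "A $ i $ j = (A *v axis j 1) $ i"
        by (simp add: matrix_vector_mult_def axis_def if_distrib cong: if_cong)
      moreover have "norm ((A *v axis j 1) $ i) \<le> norm (A *v axis j 1)"
        by (rule Finite_Cartesian_Product.norm_nth_le)
      ultimately show ?thesis
        using norm_unitary[OF herm_unitary[OF A], of "axis j 1"] by (simp add: norm_axis_1)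
    qed
    have "norm A \<le> (\<Sum>i\<in>UNIV. norm (A $ i))"
      unfolding norm_vec_def[of A] by (rule L2_set_le_sum) simp
    also have "\<dots> \<le> (\<Sum>i\<in>UNIV. \<Sum>j\<in>UNIV. cmod (A $ i $ j))"
      by (intro sum_mono) (auto simp: norm_vec_def intro: L2_set_le_sum)
    also have "\<dots> \<le> (\<Sum>i\<in>(UNIV :: 'a set). \<Sum>j\<in>(UNIV :: 'a set). 1)"
      by (intro sum_mono c)
    finally show ?thesis .
  qed
  then show "bounded (unitary_fixing e)"
    unfolding bounded_iff by blast
qed

section \<open>The unitary group as a Lie group\<close>

definition unitary_group :: "complex ^ ('m::finite) \<Rightarrow> (complex ^ 'm ^ 'm) monoid" where
  "unitary_group e = \<lparr>carrier = unitary_fixing e, mult = (**), one = mat 1\<rparr>"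

lemma unitary_group_simps [simp]:
  "carrier (unitary_group e) = unitary_fixing e"
  "mult (unitary_group e) = (**)" "one (unitary_group e) = mat 1"
  by (simp_all add: unitary_group_def)

lemma group_unitary_group: "group (unitary_group e)"
proof (rule groupI)
  fix A assume "A \<in> carrier (unitary_group e)"
  then show "\<exists>B\<in>carrier (unitary_group e). B \<otimes>\<^bsub>unitary_group e\<^esub> A = \<one>\<^bsub>unitary_group e\<^esub>"
    by (intro bexI[of _ "adj A"]) (simp_all add: unitary_fixing_adj unitary_fixingD)
qed (simp_all add: unitary_fixing_mult unitary_fixing_one matrix_mul_assoc)

lemma inv_unitary_group:
  assumes "A \<in> unitary_fixing e" shows "inv\<^bsub>unitary_group e\<^esub> A = adj A"
  by (rule group.inv_equality[OF group_unitary_group])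
    (simp_all add: assms unitary_fixing_adj unitary_fixingD[OF assms])

text \<open>The chart around \<open>B\<close> is the Cayley transform after left translation of
  \<open>B\<close> to the identity; excluded are the \<open>A\<close> for which
  \<open>adj B ** A\<close> has the eigenvalue -1.\<close>

definition cay_dom :: "complex ^ ('m::finite) \<Rightarrow> complex ^ 'm ^ 'm \<Rightarrow> (complex ^ 'm ^ 'm) set" where
  "cay_dom e B = {A \<in> unitary_fixing e. det (mat 1 + adj B ** A) \<noteq> 0}"

definition cay_chart :: "complex ^ ('m::finite) ^ 'm \<Rightarrow> complex ^ 'm ^ 'm \<Rightarrow> complex ^ 'm ^ 'm" where
  "cay_chart B A = cay (adj B ** A)"

definition unitary_atlas :: "complex ^ ('m::finite) \<Rightarrow> (complex ^ 'm ^ 'm, complex ^ 'm ^ 'm) atlas" where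
  "unitary_atlas e = (\<lambda>B. (cay_dom e B, cay_chart B)) ` unitary_fixing e"

text \<open>An explicit inverse together with the image of the chart: it turns
  \<open>inv_into\<close> and the images of overlaps into formulas.\<close>

definition chart_inverse :: "'a set \<Rightarrow> ('a \<Rightarrow> 'e) \<Rightarrow> 'e set \<Rightarrow> ('e \<Rightarrow> 'a) \<Rightarrow> bool" where
  "chart_inverse U \<phi> I \<psi> \<longleftrightarrow> (\<forall>p\<in>U. \<phi> p \<in> I \<and> \<psi> (\<phi> p) = p) \<and> (\<forall>x\<in>I. \<psi> x \<in> U \<and> \<phi> (\<psi> x) = x)"

lemma chart_inverseD:
  assumes "chart_inverse U \<phi> I \<psi>"
  shows "inj_on \<phi> U" "x \<in> I \<Longrightarrow> inv_into U \<phi> x = \<psi> x" "\<phi> ` (U \<inter> P) = {x \<in> I. \<psi> x \<in> P}"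
    "\<phi> ` U = I"
proof -
  show i: "inj_on \<phi> U" using assms unfolding chart_inverse_def by (metis inj_onI)
  show "inv_into U \<phi> x = \<psi> x" if "x \<in> I"
    using assms that unfolding chart_inverse_def by (intro inv_into_f_eq[OF i]) auto
  show "\<phi> ` (U \<inter> P) = {x \<in> I. \<psi> x \<in> P}" "\<phi> ` U = I"
    using assms unfolding chart_inverse_def by (force simp: image_iff)+
qed

text \<open>Each chart is onto the whole model space, because \<open>1 + X\<close> is invertible for
  every skew \<open>X\<close>.\<close>

lemma chart_inverse_cay:
  assumes "B \<in> unitary_fixing e"
  shows "chart_inverse (cay_dom e B) (cay_chart B) (skew_killing e) (\<lambda>X. B ** cay X)"
proof -
  have 1: "adj B ** (B ** Y) = Y" "B ** (adj B ** Y) = Y" for Y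
    by (simp_all add: matrix_mul_assoc unitary_fixingD[OF assms])
  show ?thesis
    unfolding chart_inverse_def cay_dom_def cay_chart_def
    using assms
    by (auto simp: 1 cay_cay det_skew
        intro!: cay_unitary cay_skew unitary_fixing_mult unitary_fixing_adj)
qed

lemma chart_inverse_prod:
  assumes "chart_inverse U \<phi> I \<psi>" "chart_inverse V \<phi>' J \<psi>'"
  shows "chart_inverse (U \<times> V) (map_prod \<phi> \<phi>') (I \<times> J) (map_prod \<psi> \<psi>')"
  using assms unfolding chart_inverse_def by auto

text \<open>The matrix in question is \<open>1 + 1\<close>, invertible by the Cayley relation
  \<open>(1 + 1) (1 + 0) = 2\<close>. Hence the domains cover the group.\<close>

lemma cay_dom_self: "A \<in> unitary_fixing e \<Longrightarrow> A \<in> cay_dom e A"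
  using cay_eqI(1)[of "mat 1" 0]
  by (simp add: cay_dom_def unitary_fixingD scaleR_2)

lemma points_unitary_atlas: "points (unitary_atlas e) = unitary_fixing e"
  unfolding points_def unitary_atlas_def using cay_dom_self by (force simp: cay_dom_def)

lemma openin_Collect_nonzero:
  fixes f :: "'e::euclidean_space \<Rightarrow> 'f::euclidean_space"
  assumes "smooth_on S f" shows "openin (top_of_set S) {x \<in> S. f x \<noteq> 0}"
proof -
  have "openin (top_of_set S) (S \<inter> f -` (- {0}))"
    using smooth_on_imp_continuous_on[OF assms] continuous_openin_preimage_gen by blast
  moreover have "S \<inter> f -` (- {0}) = {x \<in> S. f x \<noteq> 0}" by auto
  ultimately show ?thesis by simp
qed

text \<open>The chart is rational in the real and imaginary parts of the matrix entries, with
  nonzero denominator on its domain. Transition maps, product and inverse thus only need ordinary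
  smoothness as matrix-valued maps.\<close>

lemma smooth_into_unitary_chart:
  assumes h: "smooth_on S h" and "h ` S \<subseteq> unitary_fixing e"
  shows "openin (top_of_set S) {x \<in> S. h x \<in> cay_dom e B}"
    "smooth_on {x \<in> S. h x \<in> cay_dom e B} (\<lambda>x. cay_chart B (h x))"
proof -
  have "smooth_on S (\<lambda>x. det (mat 1 + adj B ** h x))"
    by (intro smooth_on_det smooth_on_add smooth_on_const smooth_on_matrix_mult h)
  moreover have "{x \<in> S. h x \<in> cay_dom e B} = {x \<in> S. det (mat 1 + adj B ** h x) \<noteq> 0}"
    using assms(2) by (auto simp: cay_dom_def)
  ultimately show "openin (top_of_set S) {x \<in> S. h x \<in> cay_dom e B}"
    using openin_Collect_nonzero by simp
  show "smooth_on {x \<in> S. h x \<in> cay_dom e B} (\<lambda>x. cay_chart B (h x))"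
    unfolding cay_chart_def
    by (intro smooth_on_cay smooth_on_matrix_mult smooth_on_const smooth_on_subset[OF h])
      (auto simp: cay_dom_def)
qed

lemma smooth_map_into_unitary:
  assumes F: "F ` points A \<subseteq> unitary_fixing e"
    and charts: "\<And>U \<phi>. (U, \<phi>) \<in> A \<Longrightarrow> \<exists>\<psi>. chart_inverse U \<phi> E \<psi> \<and> smooth_on E (\<lambda>x. F (\<psi> x))"
  shows "smooth_map E A (unitary_atlas e) F"
  unfolding smooth_map_def
proof (intro conjI, goal_cases)
  case 1
  then show ?case using F by (simp add: points_unitary_atlas)
next
  case 2
  show ?case
  proof clarify
    fix U \<phi> V \<phi>' assume c: "(U, \<phi>) \<in> A" and "(V, \<phi>') \<in> unitary_atlas e"
    then obtain B where d: "V = cay_dom e B" "\<phi>' = cay_chart B" by (auto simp: unitary_atlas_def)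
    obtain \<psi> where \<psi>: "chart_inverse U \<phi> E \<psi>" and s: "smooth_on E (\<lambda>x. F (\<psi> x))"
      using charts[OF c] by blast
    have sub: "(\<lambda>x. F (\<psi> x)) ` E \<subseteq> unitary_fixing e"
      using \<psi> F c unfolding chart_inverse_def points_def by force
    have im: "\<phi> ` (U \<inter> F -` cay_dom e B) = {x \<in> E. F (\<psi> x) \<in> cay_dom e B}"
      unfolding chart_inverseD(3)[OF \<psi>] by auto
    have "smooth_on {x \<in> E. F (\<psi> x) \<in> cay_dom e B} (cay_chart B \<circ> F \<circ> inv_into U \<phi>)"
      by (rule smooth_on_cong[OF smooth_into_unitary_chart(2)[OF s sub]])
        (simp add: chart_inverseD(2)[OF \<psi>])
    then show "openin (top_of_set E) (\<phi> ` (U \<inter> F -` V)) \<and>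
        smooth_on (\<phi> ` (U \<inter> F -` V)) (\<phi>' \<circ> F \<circ> inv_into U \<phi>)"
      using smooth_into_unitary_chart(1)[OF s sub] by (simp add: d im)
  qed
qed

lemma smooth_on_cay_param: "smooth_on (skew_killing e) (\<lambda>X. B ** cay X)"
  by (intro smooth_on_matrix_mult smooth_on_const smooth_on_cay smooth_on_ident det_skew)

lemma smooth_atlas_unitary: "smooth_atlas (skew_killing e) (unitary_atlas e)"
  unfolding smooth_atlas_def
proof (intro conjI)
  show "\<forall>(U, \<phi>)\<in>unitary_atlas e. inj_on \<phi> U"
    using chart_inverseD(1)[OF chart_inverse_cay] by (auto simp: unitary_atlas_def)
  show "\<forall>(U, \<phi>)\<in>unitary_atlas e. \<forall>(V, \<psi>)\<in>unitary_atlas e.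
      openin (top_of_set (skew_killing e)) (\<phi> ` (U \<inter> V)) \<and>
      smooth_on (\<phi> ` (U \<inter> V)) (\<psi> \<circ> inv_into U \<phi>)"
  proof (clarsimp simp: unitary_atlas_def)
    fix B C assume B: "B \<in> unitary_fixing e" and C: "C \<in> unitary_fixing e"
    note p = chart_inverse_cay[OF B]
    have sub: "(\<lambda>X. B ** cay X) ` skew_killing e \<subseteq> unitary_fixing e"
      using B by (auto intro!: unitary_fixing_mult cay_skew)
    have "smooth_on {x \<in> skew_killing e. B ** cay x \<in> cay_dom e C}
        (cay_chart C \<circ> inv_into (cay_dom e B) (cay_chart B))"
      by (rule smooth_on_cong[OF smooth_into_unitary_chart(2)[OF smooth_on_cay_param sub]])
        (simp add: chart_inverseD(2)[OF p])
    then show "openin (top_of_set (skew_killing e)) (cay_chart B ` (cay_dom e B \<inter> cay_dom e C)) \<and>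
        smooth_on (cay_chart B ` (cay_dom e B \<inter> cay_dom e C))
          (cay_chart C \<circ> inv_into (cay_dom e B) (cay_chart B))"
      unfolding chart_inverseD(3)[OF p]
      using smooth_into_unitary_chart(1)[OF smooth_on_cay_param sub] by blast
  qed
qed (rule subspace_skew_killing)

text \<open>Cayley charts and their inverses are continuous for the usual topology of matrices. The
  group thereby inherits the Hausdorff property, a countable base and compactness from the matrix
  space.\<close>

lemma atlas_topology_unitary:
  "atlas_topology (skew_killing e) (unitary_atlas e) = top_of_set (unitary_fixing e)"
  unfolding topology_eq openin_atlas_topology[OF smooth_atlas_unitary]
proof (intro allI iffI)
  fix W assume W: "openin (top_of_set (unitary_fixing e)) W"
  then obtain O' where O': "open O'" "W = unitary_fixing e \<inter> O'" by (auto simp: openin_open)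
  show "atlas_open (skew_killing e) (unitary_atlas e) W"
    unfolding atlas_open_def points_unitary_atlas
  proof (intro conjI)
    show "W \<subseteq> unitary_fixing e" using O' by blast
    show "\<forall>(U, \<phi>)\<in>unitary_atlas e. openin (top_of_set (skew_killing e)) (\<phi> ` (W \<inter> U))"
    proof (clarsimp simp: unitary_atlas_def)
      fix B assume B: "B \<in> unitary_fixing e"
      have "cay_chart B ` (W \<inter> cay_dom e B) = skew_killing e \<inter> (\<lambda>X. B ** cay X) -` O'"
        unfolding Int_commute[of W "cay_dom e B"] chart_inverseD(3)[OF chart_inverse_cay[OF B]]
        unfolding O'(2)
        using B by (auto intro!: unitary_fixing_mult cay_skew)
      then show "openin (top_of_set (skew_killing e)) (cay_chart B ` (W \<inter> cay_dom e B))"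
        using continuous_openin_preimage_gen[OF smooth_on_imp_continuous_on[OF smooth_on_cay_param] O'(1)]
        by simp
    qed
  qed
next
  fix W assume W: "atlas_open (skew_killing e) (unitary_atlas e) W"
  show "openin (top_of_set (unitary_fixing e)) W"
  \<comment> \<open>Near each \<open>A\<close> openness is tested in the chart centred at
    \<open>A\<close> itself.\<close>
  proof (subst openin_subopen, intro ballI)
    fix A assume A: "A \<in> W"
    then have Ae: "A \<in> unitary_fixing e"
      using W by (auto simp: atlas_open_def points_unitary_atlas)
    note p = chart_inverse_cay[OF Ae]
    have id: "smooth_on (unitary_fixing e) (\<lambda>x. x)" "(\<lambda>x. x) ` unitary_fixing e \<subseteq> unitary_fixing e"
      by (auto intro: smooth_on_ident)
    have dom: "{x \<in> unitary_fixing e. x \<in> cay_dom e A} = cay_dom e A"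
      by (auto simp: cay_dom_def)
    have "openin (top_of_set (skew_killing e)) (cay_chart A ` (W \<inter> cay_dom e A))"
      using W Ae unfolding atlas_open_def unitary_atlas_def by auto
    then obtain O' where O': "open O'" "cay_chart A ` (W \<inter> cay_dom e A) = skew_killing e \<inter> O'"
      by (auto simp: openin_open)
    have "continuous_on (cay_dom e A) (cay_chart A)"
      using smooth_on_imp_continuous_on[OF smooth_into_unitary_chart(2)[OF id, of A]]
      unfolding dom .
    then have "openin (top_of_set (cay_dom e A)) (cay_dom e A \<inter> cay_chart A -` O')"
      using O'(1) by (rule continuous_openin_preimage_gen)
    moreover have "openin (top_of_set (unitary_fixing e)) (cay_dom e A)"
      using smooth_into_unitary_chart(1)[OF id, of A] unfolding dom .
    ultimately have "openin (top_of_set (unitary_fixing e)) (cay_dom e A \<inter> cay_chart A -` O')"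
      by (rule openin_trans)
    moreover have "cay_dom e A \<inter> cay_chart A -` O' = W \<inter> cay_dom e A"
    proof -
      have "cay_chart A x \<in> O' \<longleftrightarrow> x \<in> W" if x: "x \<in> cay_dom e A" for x
      proof -
        have "cay_chart A x \<in> skew_killing e" using p x by (auto simp: chart_inverse_def)
        then have "cay_chart A x \<in> O' \<longleftrightarrow> cay_chart A x \<in> cay_chart A ` (W \<inter> cay_dom e A)"
          using O'(2) by blast
        also have "\<dots> \<longleftrightarrow> x \<in> W"
          using inj_on_image_mem_iff[OF chart_inverseD(1)[OF p] x, of "W \<inter> cay_dom e A"] x by simp
        finally show ?thesis .
      qed
      then show ?thesis by auto
    qed
    ultimately show "\<exists>T. openin (top_of_set (unitary_fixing e)) T \<and> A \<in> T \<and> T \<subseteq> W"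
      using A cay_dom_self[OF Ae] by (intro exI[of _ "W \<inter> cay_dom e A"]) simp
  qed
qed

lemma smooth_manifold_unitary: "smooth_manifold (skew_killing e) (unitary_atlas e)"
  unfolding smooth_manifold_def atlas_topology_unitary
proof (intro conjI)
  show "Hausdorff_space (top_of_set (unitary_fixing e))"
    by (intro Hausdorff_space_subtopology Hausdorff_space_euclidean)
  obtain \<B> :: "(complex ^ 'a ^ 'a) set set" where B: "countable \<B>" "\<And>C. C \<in> \<B> \<Longrightarrow> open C"
    "\<And>S. open S \<Longrightarrow> \<exists>U. U \<subseteq> \<B> \<and> S = \<Union>U"
    using univ_second_countable by blast
  let ?C = "(\<lambda>b. unitary_fixing e \<inter> b) ` \<B>"
  have 1: "\<exists>C\<in>?C. x \<in> C \<and> C \<subseteq> W" if "openin (top_of_set (unitary_fixing e)) W" "x \<in> W" for W x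
  proof -
    obtain T where T: "open T" "W = unitary_fixing e \<inter> T" using \<open>openin _ W\<close> by (auto simp: openin_open)
    then obtain U where "U \<subseteq> \<B>" "T = \<Union>U" using B(3) by blast
    then obtain b where "b \<in> U" "x \<in> b" "b \<in> \<B>" "b \<subseteq> T" using T \<open>x \<in> W\<close> by blast
    then show ?thesis using T \<open>x \<in> W\<close> by (intro bexI[of _ "unitary_fixing e \<inter> b"]) auto
  qed
  have 2: "countable ?C" using B(1) by simp
  have 3: "\<forall>C\<in>?C. openin (top_of_set (unitary_fixing e)) C"
    using B(2) by (auto simp: openin_open)
  show "\<exists>\<B>. countable \<B> \<and> (\<forall>B\<in>\<B>. openin (top_of_set (unitary_fixing e)) B) \<and>
      (\<forall>W x. openin (top_of_set (unitary_fixing e)) W \<and> x \<in> W \<longrightarrow> (\<exists>B\<in>\<B>. x \<in> B \<and> B \<subseteq> W))"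
    by (intro exI[of _ ?C] conjI 2 3 allI impI, elim conjE) (rule 1)
qed (rule smooth_atlas_unitary)

lemma points_prod_atlas: "points (prod_atlas A B) \<subseteq> points A \<times> points B"
  unfolding points_def prod_atlas_def by force

lemma lie_group_unitary: "lie_group (unitary_group e) (skew_killing e) (unitary_atlas e)"
  unfolding lie_group_def
proof (intro conjI)
  show "smooth_map (skew_killing e \<times> skew_killing e) (prod_atlas (unitary_atlas e) (unitary_atlas e))
      (unitary_atlas e) (\<lambda>(a, b). a \<otimes>\<^bsub>unitary_group e\<^esub> b)"
  proof (rule smooth_map_into_unitary)
    show "(\<lambda>(a, b). a \<otimes>\<^bsub>unitary_group e\<^esub> b) ` points (prod_atlas (unitary_atlas e) (unitary_atlas e))
        \<subseteq> unitary_fixing e"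
      using points_prod_atlas[of "unitary_atlas e" "unitary_atlas e"]
      by (auto simp: points_unitary_atlas intro!: unitary_fixing_mult)
    fix U \<phi> assume "(U, \<phi>) \<in> prod_atlas (unitary_atlas e) (unitary_atlas e)"
    then obtain B C where BC: "B \<in> unitary_fixing e" "C \<in> unitary_fixing e"
      "U = cay_dom e B \<times> cay_dom e C" "\<phi> = map_prod (cay_chart B) (cay_chart C)"
      by (auto simp: prod_atlas_def unitary_atlas_def)
    have "smooth_on (skew_killing e \<times> skew_killing e) (\<lambda>x. (B ** cay (fst x)) ** (C ** cay (snd x)))"
      by (intro smooth_on_matrix_mult smooth_on_const smooth_on_cay smooth_on_fst smooth_on_snd
          smooth_on_ident) (auto dest: det_skew)
    then show "\<exists>\<psi>. chart_inverse U \<phi> (skew_killing e \<times> skew_killing e) \<psi> \<and>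
        smooth_on (skew_killing e \<times> skew_killing e) (\<lambda>x. (\<lambda>(a, b). a \<otimes>\<^bsub>unitary_group e\<^esub> b) (\<psi> x))"
      using chart_inverse_prod[OF chart_inverse_cay[OF BC(1)] chart_inverse_cay[OF BC(2)]]
      unfolding BC(3,4)
      by (intro exI[of _ "map_prod (\<lambda>X. B ** cay X) (\<lambda>X. C ** cay X)"])
        (simp add: case_prod_beta)
  qed
  show "smooth_map (skew_killing e) (unitary_atlas e) (unitary_atlas e) (\<lambda>a. inv\<^bsub>unitary_group e\<^esub> a)"
  proof (rule smooth_map_into_unitary)
    show "(\<lambda>a. inv\<^bsub>unitary_group e\<^esub> a) ` points (unitary_atlas e) \<subseteq> unitary_fixing e"
      by (auto simp: points_unitary_atlas inv_unitary_group unitary_fixing_adj)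
    fix U \<phi> assume "(U, \<phi>) \<in> unitary_atlas e"
    then obtain B where B: "B \<in> unitary_fixing e" "U = cay_dom e B" "\<phi> = cay_chart B"
      by (auto simp: unitary_atlas_def)
    have "smooth_on (skew_killing e) (\<lambda>X. inv\<^bsub>unitary_group e\<^esub> (B ** cay X))"
      by (rule smooth_on_cong[OF smooth_on_adj[OF smooth_on_cay_param[of e B]]])
        (simp add: inv_unitary_group unitary_fixing_mult B cay_skew)
    then show "\<exists>\<psi>. chart_inverse U \<phi> (skew_killing e) \<psi> \<and>
        smooth_on (skew_killing e) (\<lambda>x. inv\<^bsub>unitary_group e\<^esub> (\<psi> x))"
      using chart_inverse_cay[OF B(1)] unfolding B(2,3) by blast
  qed
qed (simp_all add: group_unitary_group smooth_manifold_unitary points_unitary_atlas)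

lemma compact_space_unitary: "compact_space (atlas_topology (skew_killing e) (unitary_atlas e))"
  by (simp add: atlas_topology_unitary compact_space_subtopology compact_unitary_fixing)

section \<open>The action on projective space\<close>

text \<open>Maps into projective space are handled through a nowhere vanishing lift
  \<open>h\<close>; their affine coordinates are quotients of the coordinates of
  \<open>h\<close>.\<close>

lemma smooth_into_cp_chart:
  fixes h :: "'e::euclidean_space \<Rightarrow> complex ^ ('n::finite) option"
  assumes h: "smooth_on S h" and nz: "\<And>x. x \<in> S \<Longrightarrow> h x \<noteq> 0"
  shows "openin (top_of_set S) {x \<in> S. cline (h x) \<in> cp_chart_dom j}"
    "smooth_on {x \<in> S. cline (h x) \<in> cp_chart_dom j} (\<lambda>x. cp_chart j (cline (h x)))"
proof -
  have e: "{x \<in> S. cline (h x) \<in> cp_chart_dom j} = {x \<in> S. h x $ j \<noteq> 0}"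
    using nz by (auto simp: cline_mem_chart_dom)
  show "openin (top_of_set S) {x \<in> S. cline (h x) \<in> cp_chart_dom j}"
    unfolding e by (rule openin_Collect_nonzero[OF smooth_on_nth[OF h]])
  have "smooth_on {x \<in> S. h x $ j \<noteq> 0} (\<lambda>x. drop_coord j ((1 / h x $ j) *s h x))"
    by (intro smooth_on_drop_coord smooth_on_vector_smult smooth_on_divide smooth_on_const
        smooth_on_nth smooth_on_subset[OF h]) auto
  then show "smooth_on {x \<in> S. cline (h x) \<in> cp_chart_dom j} (\<lambda>x. cp_chart j (cline (h x)))"
    unfolding e by (rule smooth_on_cong) (simp add: cp_chart_cline')
qed

lemma chart_inverse_cp:
  "chart_inverse (cp_chart_dom i) (cp_chart i) UNIV (\<lambda>w. cline (alift i w))"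
  unfolding chart_inverse_def by (auto simp: cline_alift_mem elim!: cp_chart_domE)

lemma smooth_map_into_CP:
  fixes F :: "'b \<Rightarrow> (complex ^ ('n::finite) option) set"
  assumes F: "F ` points A \<subseteq> points CP"
    and charts: "\<And>U \<phi>. (U, \<phi>) \<in> A \<Longrightarrow> \<exists>\<psi> h. chart_inverse U \<phi> E \<psi> \<and> smooth_on E h \<and>
      (\<forall>x\<in>E. h x \<noteq> 0 \<and> F (\<psi> x) = cline (h x))"
  shows "smooth_map E A CP F"
  unfolding smooth_map_def
proof (intro conjI F)
  show "\<forall>(U, \<phi>)\<in>A. \<forall>(V, \<phi>')\<in>CP. openin (top_of_set E) (\<phi> ` (U \<inter> F -` V)) \<and>
      smooth_on (\<phi> ` (U \<inter> F -` V)) (\<phi>' \<circ> F \<circ> inv_into U \<phi>)"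
  proof clarify
    fix U \<phi> and V and \<phi>' :: "_ \<Rightarrow> complex ^ 'n"
    assume c: "(U, \<phi>) \<in> A" and "(V, \<phi>') \<in> CP"
    then obtain j where d: "V = cp_chart_dom j" "\<phi>' = cp_chart j" by (auto simp: CP_def)
    obtain \<psi> h where \<psi>: "chart_inverse U \<phi> E \<psi>" and h: "smooth_on E h" "\<And>x. x \<in> E \<Longrightarrow> h x \<noteq> 0"
      and F\<psi>: "\<And>x. x \<in> E \<Longrightarrow> F (\<psi> x) = cline (h x)"
      using charts[OF c] by blast
    have im: "\<phi> ` (U \<inter> F -` cp_chart_dom j) = {x \<in> E. cline (h x) \<in> cp_chart_dom j}"
      unfolding chart_inverseD(3)[OF \<psi>] using F\<psi> by auto
    have "smooth_on {x \<in> E. cline (h x) \<in> cp_chart_dom j} (cp_chart j \<circ> F \<circ> inv_into U \<phi>)"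
      by (rule smooth_on_cong[OF smooth_into_cp_chart(2)[OF h]])
        (simp_all add: chart_inverseD(2)[OF \<psi>] F\<psi>)
    then show "openin (top_of_set E) (\<phi> ` (U \<inter> F -` V)) \<and>
        smooth_on (\<phi> ` (U \<inter> F -` V)) (\<phi>' \<circ> F \<circ> inv_into U \<phi>)"
      using smooth_into_cp_chart(1)[OF h] by (simp add: d im)
  qed
qed

text \<open>The restriction to \<open>points CP\<close> makes the maps extensional, as membership in
  \<open>Bij\<close> demands.\<close>

definition proj_action ::
  "complex ^ ('n::finite) option ^ 'n option \<Rightarrow> (complex ^ 'n option) set \<Rightarrow> (complex ^ 'n option) set"
  where "proj_action A = (\<lambda>p\<in>points CP. (*v) A ` p)"

lemma image_cline: "(*v) A ` cline z = cline (A *v z)"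
  unfolding cline_def image_image vector_scalar_commute ..

lemma unitary_nonzero:
  assumes "A \<in> unitary_fixing e" "z \<noteq> 0" shows "A *v z \<noteq> 0"
  using norm_unitary[OF herm_unitary[OF assms(1)], of z] assms(2) by (metis norm_eq_zero)

lemma proj_action_cline: "z \<noteq> 0 \<Longrightarrow> proj_action A (cline z) = cline (A *v z)"
  unfolding proj_action_def by (subst restrict_apply') (auto simp: points_CP image_cline)

lemma proj_action_mem:
  assumes "A \<in> unitary_fixing e" "p \<in> points CP" shows "proj_action A p \<in> points CP"
proof -
  obtain z where z: "z \<noteq> 0" "p = cline z" using assms(2) by (auto simp: points_CP)
  then show ?thesis
    unfolding z(2) proj_action_cline[OF z(1)] points_CP using unitary_nonzero[OF assms(1) z(1)] by blast
qed

lemma group_action_proj: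
  "group_action (unitary_group e) (points CP) (proj_action :: complex ^ ('n::finite) option ^ 'n option \<Rightarrow> _)"
proof -
  have comp: "proj_action A (proj_action B p) = proj_action (A ** B) p"
    if "B \<in> unitary_fixing e" "p \<in> points CP" for p and A B :: "complex ^ 'n option ^ 'n option"
    using that by (auto simp: points_CP proj_action_cline unitary_nonzero matrix_vector_mul_assoc)
  have one: "proj_action (mat 1) p = p" if "p \<in> points CP" for p :: "(complex ^ 'n option) set"
    using that by (auto simp: points_CP proj_action_cline)
  have Bij: "proj_action A \<in> Bij (points CP)" if A: "A \<in> unitary_fixing e"
    for A :: "complex ^ 'n option ^ 'n option"
  proof -
    have "bij_betw (proj_action A) (points CP) (points CP)"
      by (rule bij_betw_byWitness[of _ "proj_action (adj A)"])
        (auto simp: comp one proj_action_mem[OF A] proj_action_mem[OF unitary_fixing_adj[OF A]] A unitary_fixing_adj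
          unitary_fixingD[OF A])
    then show ?thesis by (simp add: Bij_def proj_action_def)
  qed
  have "proj_action \<in> hom (unitary_group e) (BijGroup (points (CP :: (_, complex ^ 'n) atlas)))"
  proof (rule homI)
    fix A B :: "complex ^ 'n option ^ 'n option"
    assume "A \<in> carrier (unitary_group e)" "B \<in> carrier (unitary_group e)"
    then have A: "A \<in> unitary_fixing e" and B: "B \<in> unitary_fixing e" by simp_all
    have "proj_action (A ** B) p = compose (points CP) (proj_action A) (proj_action B) p" for p
      by (cases "p \<in> points CP") (simp_all add: compose_def comp[OF B], simp add: proj_action_def)
    then show "proj_action (A \<otimes>\<^bsub>unitary_group e\<^esub> B) =
        proj_action A \<otimes>\<^bsub>BijGroup (points CP)\<^esub> proj_action B"
      using Bij[OF A] Bij[OF B] by (simp add: BijGroup_def fun_eq_iff)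
  qed (simp add: BijGroup_def Bij)
  then show ?thesis
    unfolding group_action_def group_hom_def group_hom_axioms_def
    by (simp add: group_unitary_group group_BijGroup)
qed

lemma smooth_action_proj:
  "smooth_action (unitary_group e) (skew_killing e) (unitary_atlas e)
    (CP :: (_, complex ^ ('n::finite)) atlas) proj_action"
  unfolding smooth_action_def
proof (intro conjI group_action_proj smooth_map_into_CP)
  let ?F = "\<lambda>(a, p). proj_action a p"
  show "?F ` points (prod_atlas (unitary_atlas e) (CP :: (_, complex ^ 'n) atlas)) \<subseteq> points CP"
    using points_prod_atlas[of "unitary_atlas e" "CP :: (_, complex ^ 'n) atlas"]
    by (auto simp: points_unitary_atlas intro!: proj_action_mem)
  fix U and \<phi> :: "_ \<Rightarrow> _ \<times> (complex ^ 'n)"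
  assume "(U, \<phi>) \<in> prod_atlas (unitary_atlas e) CP"
  then obtain B i where B: "B \<in> unitary_fixing e" and
    U: "U = cay_dom e B \<times> cp_chart_dom i" "\<phi> = map_prod (cay_chart B) (cp_chart i)"
    by (auto simp: prod_atlas_def unitary_atlas_def CP_def)
  let ?h = "\<lambda>x. (B ** cay (fst x)) *v alift i (snd x)"
  have "smooth_on (skew_killing e \<times> UNIV) ?h"
    by (intro smooth_on_matrix_vector_mult smooth_on_matrix_mult smooth_on_const smooth_on_cay
        smooth_on_fst smooth_on_alift smooth_on_snd smooth_on_ident) (auto dest: det_skew)
  moreover have "?h x \<noteq> 0" if "x \<in> skew_killing e \<times> UNIV" for x
    using that by (intro unitary_nonzero[OF unitary_fixing_mult[OF B cay_skew]]) auto
  ultimately show "\<exists>\<psi> h. chart_inverse U \<phi> (skew_killing e \<times> UNIV) \<psi> \<and>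
      smooth_on (skew_killing e \<times> UNIV) h \<and>
      (\<forall>x\<in>skew_killing e \<times> UNIV. h x \<noteq> 0 \<and> ?F (\<psi> x) = cline (h x))"
    using chart_inverse_prod[OF chart_inverse_cay[OF B] chart_inverse_cp[of i]] unfolding U
    by (intro exI[of _ "map_prod (\<lambda>X. B ** cay X) (\<lambda>w. cline (alift i w))"] exI[of _ ?h])
      (auto simp: proj_action_cline)
qed

text \<open>Matrix entries are Hermitian products with coordinate vectors, so preserving
  \<open>herm\<close> determines \<open>adj A ** A\<close>.\<close>

lemma unitary_fixingI:
  assumes "\<And>x y. herm (A *v x) (A *v y) = herm x y" "A *v e = e"
  shows "A \<in> unitary_fixing e"
proof -
  have "(adj A ** A) $ i $ j = (mat 1 :: complex ^ 'a ^ 'a) $ i $ j" for i j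
  proof -
    have e: "M $ i $ j = herm (axis i 1) (M *v axis j 1)" for M :: "complex ^ 'a ^ 'a"
      by (simp add: herm_axis_left) (simp add: matrix_vector_mult_def axis_def if_distrib cong: if_cong)
    show ?thesis
      unfolding e matrix_vector_mul_assoc[symmetric] herm_adj[symmetric] assms(1) by simp
  qed
  then show ?thesis using assms(2) by (simp add: unitary_fixing_def vec_eq_iff)
qed

text \<open>A complex reflection along \<open>z - y\<close> moves \<open>z\<close> to \<open>y\<close>.\<close>

lemma unitary_transitive:
  assumes n: "norm z = norm y" and e: "herm e z = herm e y"
  shows "\<exists>A\<in>unitary_fixing e. A *v z = y"
proof (cases "z = y")
  case True
  then show ?thesis by (intro bexI[of _ "mat 1"] unitary_fixing_one) simp
next
  case False
  \<comment> \<open>Dividing by \<open>b\<close> rather than by half of \<open>herm d d\<close>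
    gives \<open>A *v z = z - d = y\<close> even if \<open>herm z y\<close> is not real. Unitarity
    rests on \<open>herm d d = b + cnj b\<close>, a consequence of the equal norms.\<close>
  define d b where "d = z - y" and "b = herm d z"
  define A where "A = mat 1 + (\<chi> i j. - (1 / b) * d $ i * cnj (d $ j))"
  have Ax: "A *v x = x - (herm d x / b) *s d" for x
  proof -
    have "(\<chi> i j. - (1 / b) * d $ i * cnj (d $ j)) *v x = - ((herm d x / b) *s d)"
      by (simp add: vec_eq_iff herm_def matrix_vector_mult_def sum_divide_distrib sum_distrib_left
          sum_negf mult_ac)
    then show ?thesis unfolding A_def add_matrix_vector by simp
  qed
  have dd: "herm d d = b + cnj b"
  proof -
    have "herm z z = herm y y" by (simp add: herm_self n)
    then show ?thesis by (simp add: b_def d_def herm_simps cnj_herm)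
  qed
  have b: "b \<noteq> 0"
    using dd False herm_self_nonzero[of d] by (auto simp: d_def)
  have "A \<in> unitary_fixing e"
  proof (rule unitary_fixingI)
    fix x x'
    have "herm (A *v x) (A *v x') = herm x x'
        - herm x d * herm d x' * (1 / b + 1 / cnj b - herm d d / (b * cnj b))"
      unfolding Ax by (simp add: herm_simps cnj_herm algebra_simps diff_divide_distrib add_divide_distrib)
    also have "1 / b + 1 / cnj b - herm d d / (b * cnj b) = 0"
      using b by (simp add: dd field_simps)
    finally show "herm (A *v x) (A *v x') = herm x x'" by simp
    have "herm d e = cnj (herm e d)" by (simp add: cnj_herm)
    then have "herm d e = 0" using e by (simp add: d_def herm_simps)
    then show "A *v e = e" by (simp add: Ax)
  qed
  moreover have "A *v z = y"
    using b by (simp add: Ax b_def[symmetric]) (simp add: d_def)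
  ultimately show ?thesis by blast
qed

section \<open>Orbits, stabilizers and principal points\<close>

abbreviation base_vec :: "complex ^ ('n::finite) option" where
  "base_vec \<equiv> axis None 1"

lemma unitary_base_comp:
  assumes "A \<in> unitary_fixing base_vec" shows "(A *v x) $ None = x $ None"
proof -
  have "(A *v x) $ None = herm (A *v base_vec) (A *v x)"
    by (simp add: unitary_fixingD[OF assms] herm_axis_left)
  then show ?thesis by (simp add: herm_unitary[OF assms] herm_axis_left)
qed

lemma alift_drop: "z $ None = 1 \<Longrightarrow> alift None (drop_coord None z) = z"
  using alift_drop_coord[of z None] by simp

text \<open>The group preserves the coordinate \<open>None\<close> and the norm, hence the
  normalization of the lift and the norm of the affine coordinates. Conversely, lifts of equal norm
  have the same product with \<open>base_vec\<close>, so \<open>unitary_transitive\<close> connects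
  them.\<close>

lemma orbit_alift:
  fixes w :: "complex ^ ('n::finite)"
  shows "orbit (unitary_group base_vec) proj_action (cline (alift None w)) =
     {cline (alift None v) | v :: complex ^ 'n. norm v = norm w}"
proof (intro equalityI subsetI)
  fix p assume "p \<in> orbit (unitary_group base_vec) proj_action (cline (alift None w))"
  then obtain A where A: "A \<in> unitary_fixing base_vec" "p = cline (A *v alift None w)"
    by (auto simp: orbit_def proj_action_cline)
  define v where "v = drop_coord None (A *v alift None w)"
  have v: "alift None v = A *v alift None w"
    unfolding v_def by (rule alift_drop) (simp add: unitary_base_comp[OF A(1)])
  have "(norm (alift None v))\<^sup>2 = (norm (alift None w))\<^sup>2"
    by (simp add: v norm_unitary[OF herm_unitary[OF A(1)]])
  then have "norm v = norm w" by (simp add: norm_alift)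
  then show "p \<in> {cline (alift None v) | v :: complex ^ 'n. norm v = norm w}" 
    by (intro CollectI exI[of _ v]) (simp add: A(2) v)
next
  fix p assume "p \<in> {cline (alift None v) | v :: complex ^ 'n. norm v = norm w}"
  then obtain v where v: "p = cline (alift None v)" "norm v = norm w" by blast
  have "(norm (alift None w))\<^sup>2 = (norm (alift None v))\<^sup>2"
    unfolding norm_alift v(2) ..
  then have "norm (alift None w) = norm (alift None v)" by simp
  then obtain A where "A \<in> unitary_fixing base_vec" "A *v alift None w = alift None v"
    using unitary_transitive[of "alift None w" "alift None v" base_vec] by (auto simp: herm_axis_left)
  then show "p \<in> orbit (unitary_group base_vec) proj_action (cline (alift None w))"
    unfolding orbit_def using v(1) by (auto simp: proj_action_cline intro!: exI[of _ A])
qed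

lemma stabilizer_cline:
  "z \<noteq> 0 \<Longrightarrow> stabilizer (unitary_group e) proj_action (cline z) =
     {A \<in> unitary_fixing e. \<exists>c. A *v z = c *s z}"
proof -
  assume z: "z \<noteq> 0"
  have "cline (A *v z) = cline z \<longleftrightarrow> (\<exists>c. A *v z = c *s z)" if A: "A \<in> unitary_fixing e" for A
  proof -
    have "A *v z = c *s z \<Longrightarrow> c \<noteq> 0" for c using unitary_nonzero[OF A z] by auto
    then show ?thesis using cline_eq_iff[OF z, of "A *v z"] by (metis (no_types))
  qed
  then show ?thesis by (auto simp: stabilizer_def proj_action_cline z)
qed

text \<open>The central symmetry \<open>diag(1, -1, \<dots>, -1)\<close> fixes the base point and its cut locus, but no
  other point.\<close>

lemma principal_alift:
  assumes "principal_point (unitary_group base_vec) (points CP) proj_action p"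
  obtains w where "p = cline (alift None w)" "w \<noteq> (0 :: complex ^ ('n::finite))"
proof -
  obtain z where z: "p = cline z" "z \<noteq> (0 :: complex ^ 'n option)"
    using assms by (auto simp: principal_point_def points_CP)
  define Z :: "complex ^ 'n option ^ 'n option" where
    "Z = (\<chi> i j. if i = j then (if i = None then 1 else - 1) else 0)"
  have Z: "Z *v x = (2 * x $ None) *s base_vec - x" for x
  proof -
    have "(if i = j then if i = None then 1 else - 1 else 0) * x $ j =
        (if j = i then (if i = None then 1 else - 1) * x $ i else 0)" for i j by auto
    then show ?thesis
      by (simp add: Z_def vec_eq_iff matrix_vector_mult_def axis_def)
  qed
  have Zu: "Z \<in> unitary_fixing base_vec"
  proof (rule unitary_fixingI)
    show "herm (Z *v x) (Z *v y) = herm x y" for x y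
      unfolding Z by (simp add: herm_simps herm_axis_left herm_axis_right algebra_simps)
    show "Z *v base_vec = base_vec"
      unfolding Z by (simp add: vec_eq_iff axis_def)
  qed
  \<comment> \<open>This only names an index, in order to have a point \<open>?q\<close> that
    \<open>Z\<close> moves.\<close>
  obtain k :: 'n where True by simp
  let ?q = "alift None (axis k 1) :: complex ^ 'n option"
  have "cline ?q \<in> points CP" by (auto simp: points_CP)
  then obtain A where A: "A \<in> unitary_fixing base_vec"
    and sub: "(\<lambda>B. A ** B ** adj A) ` stabilizer (unitary_group base_vec) proj_action (cline z)
      \<subseteq> stabilizer (unitary_group base_vec) proj_action (cline ?q)"
    using assms unfolding principal_point_def z(1)
    by (force simp: inv_unitary_group)
  \<comment> \<open>\<open>Z\<close> is central, so conjugation leaves it in place: if it fixed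
    \<open>cline z\<close>, the inclusion \<open>sub\<close> would make it fix
    \<open>?q\<close>.\<close>
  have comm: "A ** Z ** adj A *v x = Z *v x" for x
    unfolding matrix_vector_mul_assoc[symmetric] Z
    by (simp add: matrix_vector_mult_diff_distrib vector_scalar_commute unitary_fixingD[OF A]
        unitary_base_comp[OF unitary_fixing_adj[OF A]] matrix_vector_mul_assoc)
  have not_fix: "Z \<notin> stabilizer (unitary_group base_vec) proj_action (cline z)"
  proof
    assume "Z \<in> stabilizer (unitary_group base_vec) proj_action (cline z)"
    then have "A ** Z ** adj A \<in> stabilizer (unitary_group base_vec) proj_action (cline ?q)"
      using sub by blast
    then obtain c where c: "Z *v ?q = c *s ?q"
      by (auto simp: stabilizer_cline comm)
    have "(Z *v ?q) $ None = (c *s ?q) $ None" "(Z *v ?q) $ Some k = (c *s ?q) $ Some k"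
      using c by simp_all
    moreover have "?q $ Some k = 1"
      by (simp add: alift_def insert_coord_def) (simp add: axis_def)
    ultimately show False unfolding Z by (simp add: axis_def)
  qed
  have nz: "z $ None \<noteq> 0"
  proof
    assume "z $ None = 0"
    then have "Z *v z = (- 1) *s z" by (simp add: Z)
    then show False using not_fix Zu unfolding stabilizer_cline[OF z(2)] by blast
  qed
  define w where "w = drop_coord None ((1 / z $ None) *s z)"
  have pw: "p = cline (alift None w)"
    unfolding w_def alift_drop_coord[OF nz] z(1) using nz by (simp add: cline_smult)
  have "w \<noteq> 0"
  proof
    assume "w = 0"
    then have "alift None w = base_vec" by (simp add: alift_def insert_coord_def vec_eq_iff)
    then have "(1 / z $ None) *s z = base_vec"
      using alift_drop_coord[OF nz] unfolding w_def[symmetric] by simp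
    moreover have "z $ None *s ((1 / z $ None) *s z) = z" using nz by simp
    ultimately have c: "z $ None *s base_vec = z" by metis
    have "Z *v (c *s base_vec) = 1 *s (c *s base_vec)" for c
      unfolding Z by (simp add: vec_eq_iff axis_def)
    from this[of "z $ None"] have "Z *v z = 1 *s z" unfolding c .
    then show False using not_fix Zu unfolding stabilizer_cline[OF z(2)] by blast
  qed
  with pw show thesis by (rule that)
qed

text \<open>An element of the stabilizer fixes \<open>base_vec\<close> and the lift of
  \<open>?u\<close>. If \<open>A\<close> rotates the direction of \<open>?u\<close> into that of the
  affine part \<open>v\<close> of \<open>z\<close>, the conjugate by \<open>A\<close> fixes
  \<open>base_vec\<close> and \<open>v\<close>, hence \<open>z\<close>. The base point and its cut
  locus need no separate treatment beyond \<open>v = 0\<close>.\<close>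

lemma principal_point_exists:
  "principal_point (unitary_group base_vec) (points CP) proj_action
     (cline (alift None (axis k 1 :: complex ^ ('n::finite))))"
  unfolding principal_point_def
proof (intro conjI ballI)
  let ?u = "axis k 1 :: complex ^ 'n"
  let ?p = "alift None ?u"
  show "cline ?p \<in> points CP" by (auto simp: points_CP)
  fix q :: "(complex ^ 'n option) set" assume "q \<in> points CP"
  then obtain z where z: "q = cline z" "z \<noteq> 0" by (auto simp: points_CP)
  define v where "v = drop_coord None z"
  have zv: "z = z $ None *s base_vec + insert_coord None v"
    unfolding v_def insert_drop_coord by simp
  obtain A where A: "A \<in> unitary_fixing base_vec"
    and Av: "insert_coord None v = norm v *\<^sub>R (A *v insert_coord None ?u)"
  proof (cases "v = 0")
    case True
    then show thesis using that[OF unitary_fixing_one] by (simp add: insert_coord_def vec_eq_iff)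
  next
    case False
    let ?v = "(1 / norm v) *\<^sub>R insert_coord None v"
    have "norm (insert_coord None x) = norm x" for x :: "complex ^ 'n"
    proof -
      have "Re (herm (insert_coord None x) (insert_coord None x)) = Re (herm x x)"
        by (simp only: herm_insert_coord)
      then show ?thesis by (simp add: Re_herm norm_eq_sqrt_inner)
    qed
    then have "norm (insert_coord None ?u) = norm ?v"
      using False by (simp add: norm_axis_1)
    then obtain A where "A \<in> unitary_fixing base_vec" "A *v insert_coord None ?u = ?v"
      using unitary_transitive[of "insert_coord None ?u" ?v base_vec] by (auto simp: herm_axis_left)
    then show thesis using that[of A] False by simp
  qed
  have "A ** B ** adj A \<in> stabilizer (unitary_group base_vec) proj_action (cline z)"
    if Bp: "B \<in> stabilizer (unitary_group base_vec) proj_action (cline ?p)" for B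
  proof -
    obtain c where B: "B \<in> unitary_fixing base_vec" "B *v ?p = c *s ?p"
      using Bp unfolding stabilizer_cline[OF alift_nonzero] by blast
    \<comment> \<open>The lift has coordinate 1 at \<open>None\<close>, which the group preserves;
      \<open>B\<close> fixes the vector and not just its line.\<close>
    have "c = 1"
      using arg_cong[OF B(2), of "\<lambda>x. x $ None"] unitary_base_comp[OF B(1), of ?p] by simp
    then have "B *v (base_vec + insert_coord None ?u) = base_vec + insert_coord None ?u"
      using B(2) by (simp add: alift_def)
    then have Bu: "B *v insert_coord None ?u = insert_coord None ?u"
      by (simp add: matrix_vector_right_distrib unitary_fixingD(3)[OF B(1)])
    let ?C = "A ** B ** adj A"
    have C: "?C \<in> unitary_fixing base_vec"
      by (intro unitary_fixing_mult unitary_fixing_adj A B)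
    have "?C *v (A *v x) = A *v (B *v x)" for x
    proof -
      have "?C *v (A *v x) = (A ** B ** (adj A ** A)) *v x"
        by (simp only: matrix_vector_mul_assoc matrix_mul_assoc)
      then show ?thesis by (simp add: unitary_fixingD[OF A] matrix_vector_mul_assoc)
    qed
    then have "?C *v insert_coord None v = insert_coord None v"
      unfolding Av linear_scale[OF bounded_linear.linear[OF bounded_linear_matrix_vector]]
      by (simp add: Bu)
    moreover have "?C *v (d *s base_vec) = d *s base_vec" for d
      by (simp only: vector_scalar_commute unitary_fixingD(3)[OF C])
    ultimately have "?C *v (d *s base_vec + insert_coord None v) = 1 *s (d *s base_vec + insert_coord None v)"
      for d by (simp add: matrix_vector_right_distrib)
    from this[of "z $ None"] have "?C *v z = 1 *s z" unfolding zv[symmetric] .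
    then show ?thesis unfolding stabilizer_cline[OF z(2)] using C by blast
  qed
  then show "\<exists>a\<in>carrier (unitary_group base_vec).
      (\<lambda>b. a \<otimes>\<^bsub>unitary_group base_vec\<^esub> b \<otimes>\<^bsub>unitary_group base_vec\<^esub> inv\<^bsub>unitary_group base_vec\<^esub> a) `
        stabilizer (unitary_group base_vec) proj_action (cline ?p)
      \<subseteq> stabilizer (unitary_group base_vec) proj_action q"
    using A by (intro bexI[of _ A]) (auto simp: z(1) inv_unitary_group)
qed

section \<open>Slice charts for the principal orbits\<close>

text \<open>Inversion in a point of the sphere \<open>|x| = |c|\<close>, translated so that this sphere becomes
  the hyperplane orthogonal to \<open>c\<close>.\<close>

definition inversion :: "'a::euclidean_space \<Rightarrow> 'a \<Rightarrow> 'a" where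
  "inversion c x = (1 / ((x - c) \<bullet> (x - c))) *\<^sub>R (x - c) + (1 / (2 * (c \<bullet> c))) *\<^sub>R c"

definition inversion_inv :: "'a::euclidean_space \<Rightarrow> 'a \<Rightarrow> 'a" where
  "inversion_inv c x = (let y = x - (1 / (2 * (c \<bullet> c))) *\<^sub>R c in c + (1 / (y \<bullet> y)) *\<^sub>R y)"

lemma inversion_inv_inversion: "x \<noteq> c \<Longrightarrow> inversion_inv c (inversion c x) = x"
  by (simp add: inversion_inv_def inversion_def)

lemma inversion_inversion_inv:
  "x \<noteq> (1 / (2 * (c \<bullet> c))) *\<^sub>R c \<Longrightarrow> inversion c (inversion_inv c x) = x"
  by (simp add: inversion_inv_def inversion_def Let_def)

lemma inversion_inv_neq: "x \<noteq> (1 / (2 * (c \<bullet> c))) *\<^sub>R c \<Longrightarrow> inversion_inv c x \<noteq> c"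
  by (simp add: inversion_inv_def Let_def)

lemma inversion_neq: "x \<noteq> c \<Longrightarrow> inversion c x \<noteq> (1 / (2 * (c \<bullet> c))) *\<^sub>R c"
  by (simp add: inversion_def)

text \<open>Adding \<open>y / (y \<bullet> y)\<close> to \<open>c\<close> changes the squared norm
  by \<open>(2 * (c \<bullet> y) + 1) / (y \<bullet> y)\<close>. The translation by
  \<open>c / (2 * (c \<bullet> c))\<close> is chosen to make this numerator
  \<open>2 * (c \<bullet> x)\<close>.\<close>

lemma norm_inversion_inv:
  assumes "x \<noteq> (1 / (2 * (c \<bullet> c))) *\<^sub>R c" "c \<noteq> 0"
  shows "norm (inversion_inv c x) = norm c \<longleftrightarrow> c \<bullet> x = 0"
proof -
  define y where "y = x - (1 / (2 * (c \<bullet> c))) *\<^sub>R c"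
  have y: "y \<bullet> y > 0" using assms by (simp add: y_def)
  have inv: "inversion_inv c x = c + (1 / (y \<bullet> y)) *\<^sub>R y"
    by (simp only: inversion_inv_def Let_def y_def)
  have "norm (inversion_inv c x) = norm c \<longleftrightarrow> inversion_inv c x \<bullet> inversion_inv c x = c \<bullet> c"
    by (simp add: norm_eq_sqrt_inner)
  also have "inversion_inv c x \<bullet> inversion_inv c x = c \<bullet> c + (2 * (c \<bullet> y) + 1) / (y \<bullet> y)"
    using y unfolding inv
    by (simp add: inner_add_left inner_add_right inner_commute[of y c] field_simps)
  also have "\<dots> = c \<bullet> c \<longleftrightarrow> 2 * (c \<bullet> y) + 1 = 0"
    using y by auto
  also have "2 * (c \<bullet> y) + 1 = 2 * (c \<bullet> x)"
    using assms(2) by (simp add: y_def inner_diff_right)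
  finally show ?thesis by simp
qed

lemma smooth_on_inversion: "smooth_on S f \<Longrightarrow> (\<And>x. x \<in> S \<Longrightarrow> f x \<noteq> c) \<Longrightarrow> smooth_on S (\<lambda>x. inversion c (f x))"
  unfolding inversion_def
  by (intro smooth_on_add smooth_on_scaleR smooth_on_divide smooth_on_const smooth_on_inner smooth_on_diff)
    auto

lemma smooth_on_inversion_inv:
  "smooth_on S f \<Longrightarrow> (\<And>x. x \<in> S \<Longrightarrow> f x \<noteq> (1 / (2 * (c \<bullet> c))) *\<^sub>R c) \<Longrightarrow>
    smooth_on S (\<lambda>x. inversion_inv c (f x))"
  unfolding inversion_inv_def Let_def
  by (intro smooth_on_add smooth_on_scaleR smooth_on_divide smooth_on_const smooth_on_inner smooth_on_diff)
    auto

text \<open>The affine chart \<open>None\<close> without the centre \<open>c\<close>, where the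
  inversion is singular.\<close>

definition slice_dom :: "complex ^ ('n::finite) \<Rightarrow> (complex ^ 'n option) set set" where
  "slice_dom c = {cline (alift None w) | w. w \<noteq> c}"

definition slice_chart :: "complex ^ ('n::finite) \<Rightarrow> (complex ^ 'n option) set \<Rightarrow> complex ^ 'n" where
  "slice_chart c L = inversion c (cp_chart None L)"

lemma chart_inverse_slice:
  "chart_inverse (slice_dom c) (slice_chart c) (- {(1 / (2 * (c \<bullet> c))) *\<^sub>R c})
     (\<lambda>x. cline (alift None (inversion_inv c x)))"
  unfolding chart_inverse_def slice_dom_def slice_chart_def
  by (auto simp: inversion_inv_inversion inversion_inversion_inv inversion_inv_neq inversion_neq)

lemma smooth_into_slice_chart:
  fixes h :: "'e::euclidean_space \<Rightarrow> complex ^ ('n::finite) option"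
  assumes h: "smooth_on S h" and nz: "\<And>x. x \<in> S \<Longrightarrow> h x \<noteq> 0"
  shows "openin (top_of_set S) {x \<in> S. cline (h x) \<in> slice_dom c}"
    "smooth_on {x \<in> S. cline (h x) \<in> slice_dom c} (\<lambda>x. slice_chart c (cline (h x)))"
proof -
  let ?S = "{x \<in> S. cline (h x) \<in> cp_chart_dom None}"
  note p = smooth_into_cp_chart[OF h nz, of None]
  have "L \<in> slice_dom c \<longleftrightarrow> L \<in> cp_chart_dom None \<and> cp_chart None L \<noteq> c" for L
  proof
    assume "L \<in> slice_dom c"
    then obtain w where "L = cline (alift None w)" "w \<noteq> c" by (auto simp: slice_dom_def)
    then show "L \<in> cp_chart_dom None \<and> cp_chart None L \<noteq> c" by (simp add: cline_alift_mem)
  next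
    assume L: "L \<in> cp_chart_dom None \<and> cp_chart None L \<noteq> c"
    then obtain w where w: "L = cline (alift None w)" using cp_chart_domE by metis
    then have "w \<noteq> c" using L by simp
    then show "L \<in> slice_dom c" unfolding slice_dom_def w by blast
  qed
  then have e: "{x \<in> S. cline (h x) \<in> slice_dom c} = {x \<in> ?S. cp_chart None (cline (h x)) - c \<noteq> 0}"
    by auto
  have "openin (top_of_set ?S) {x \<in> ?S. cp_chart None (cline (h x)) - c \<noteq> 0}"
    by (intro openin_Collect_nonzero smooth_on_diff smooth_on_const p(2))
  then show "openin (top_of_set S) {x \<in> S. cline (h x) \<in> slice_dom c}"
    unfolding e by (rule openin_trans[OF _ p(1)])
  show "smooth_on {x \<in> S. cline (h x) \<in> slice_dom c} (\<lambda>x. slice_chart c (cline (h x)))"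
    unfolding e slice_chart_def
    by (intro smooth_on_inversion smooth_on_subset[OF p(2)]) auto
qed

text \<open>\<open>param\<close> gives every chart, the slice chart included, an inverse with a
  smooth nonvanishing lift, and \<open>target\<close> treats every chart as a codomain; together
  they settle all overlaps uniformly.\<close>

lemma smooth_atlas_insert_slice: "smooth_atlas UNIV (insert (slice_dom c, slice_chart c) CP)"
  unfolding smooth_atlas_def
proof (intro conjI)
  let ?A = "insert (slice_dom c, slice_chart c) CP"
  have param: "\<exists>I h. open I \<and> chart_inverse U \<phi> I (\<lambda>x. cline (h x)) \<and> smooth_on I h \<and> (\<forall>x\<in>I. h x \<noteq> 0)"
    if U: "(U, \<phi>) \<in> ?A" for U \<phi>
  proof (cases "(U, \<phi>) = (slice_dom c, slice_chart c)")
    case True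
    have "open (- {(1 / (2 * (c \<bullet> c))) *\<^sub>R c})" by auto
    moreover have "smooth_on (- {(1 / (2 * (c \<bullet> c))) *\<^sub>R c}) (\<lambda>x. alift None (inversion_inv c x))"
      by (intro smooth_on_alift smooth_on_inversion_inv smooth_on_ident) auto
    ultimately show ?thesis
      using True chart_inverse_slice[of c]
      by (intro exI[of _ "- {(1 / (2 * (c \<bullet> c))) *\<^sub>R c}"]
          exI[of _ "\<lambda>x. alift None (inversion_inv c x)"]) simp
  next
    case False
    then obtain i where "U = cp_chart_dom i" "\<phi> = cp_chart i" using U by (auto simp: CP_def)
    then show ?thesis
      using chart_inverse_cp[of i] smooth_on_alift[OF smooth_on_ident]
      by (intro exI[of _ UNIV] exI[of _ "alift i"]) simp
  qed
  have target: "openin (top_of_set I) {x \<in> I. cline (h x) \<in> V} \<and>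
      smooth_on {x \<in> I. cline (h x) \<in> V} (\<lambda>x. \<phi> (cline (h x)))"
    if "(V, \<phi>) \<in> ?A" "smooth_on I h" "\<forall>x\<in>I. h x \<noteq> 0"
    for V \<phi> and I :: "(complex ^ 'a) set" and h
    using that smooth_into_cp_chart[of I h] smooth_into_slice_chart[of I h]
    by (auto simp: CP_def)
  show "\<forall>(U, \<phi>)\<in>?A. inj_on \<phi> U"
  proof clarify
    fix U \<phi> assume U: "(U, \<phi>) \<in> ?A"
    from param[OF U] obtain I h where "chart_inverse U \<phi> I (\<lambda>x. cline (h x))" by (elim exE conjE)
    then show "inj_on \<phi> U" by (rule chart_inverseD(1))
  qed
  show "\<forall>(U, \<phi>)\<in>?A. \<forall>(V, \<psi>)\<in>?A. openin (top_of_set UNIV) (\<phi> ` (U \<inter> V)) \<and>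
      smooth_on (\<phi> ` (U \<inter> V)) (\<psi> \<circ> inv_into U \<phi>)"
  proof clarify
    fix U \<phi> V \<psi> assume U: "(U, \<phi>) \<in> ?A" and V: "(V, \<psi>) \<in> ?A"
    obtain I h where I: "open I" "chart_inverse U \<phi> I (\<lambda>x. cline (h x))" "smooth_on I h"
      "\<forall>x\<in>I. h x \<noteq> 0"
      using param[OF U] by (elim exE conjE)
    note t = target[OF V I(3,4)]
    have "openin (top_of_set UNIV) {x \<in> I. cline (h x) \<in> V}"
      using conjunct1[OF t] openin_open_eq[OF I(1)] by simp
    moreover have "smooth_on {x \<in> I. cline (h x) \<in> V} (\<psi> \<circ> inv_into U \<phi>)"
      by (rule smooth_on_cong[OF conjunct2[OF t]]) (simp add: chart_inverseD(2)[OF I(2)])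
    ultimately show "openin (top_of_set UNIV) (\<phi> ` (U \<inter> V)) \<and>
        smooth_on (\<phi> ` (U \<inter> V)) (\<psi> \<circ> inv_into U \<phi>)"
      unfolding chart_inverseD(3)[OF I(2)] by blast
  qed
qed (rule subspace_UNIV)

text \<open>An inversion sends the sphere without its centre to a hyperplane, so a single slice
  chart cannot cover the orbit and each point gets its own.\<close>

lemma embedded_orbit:
  fixes w :: "complex ^ ('n::finite)"
  assumes w: "w \<noteq> 0"
  shows "embedded_submanifold (DIM(complex ^ 'n) - 1) CP
    (orbit (unitary_group base_vec) proj_action (cline (alift None w)))"
  unfolding embedded_submanifold_def orbit_alift
proof (intro conjI ballI)
  let ?O = "{cline (alift None v) | v :: complex ^ 'n. norm v = norm w}"
  show "?O \<subseteq> points CP" by (auto simp: points_CP)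
  fix p assume "p \<in> ?O"
  then obtain v where p: "p = cline (alift None v)" and v: "norm v = norm w" by blast
  \<comment> \<open>The antipode of \<open>v\<close> lies on the same sphere and differs from
    \<open>v\<close>, so the point \<open>p\<close> stays in the chart.\<close>
  let ?c = "- v"
  let ?I = "- {(1 / (2 * (?c \<bullet> ?c))) *\<^sub>R ?c}"
  have v0: "v \<noteq> 0" "?c \<noteq> 0" using w v by auto
  have mem: "cline (alift None x) \<in> ?O \<longleftrightarrow> norm x = norm w" for x
    by (auto dest!: arg_cong[of _ _ "cp_chart None"])
  note ch = chart_inverse_slice[of ?c]
  have "slice_chart ?c ` (slice_dom ?c \<inter> ?O) = slice_chart ?c ` slice_dom ?c \<inter> {x. ?c \<bullet> x = 0}"
    unfolding chart_inverseD(3,4)[OF ch] mem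
    using norm_inversion_inv[of _ ?c] v0(2) v by auto
  moreover have "p \<in> slice_dom ?c"
  proof -
    have "v \<noteq> - v" using v0(1) by (simp add: eq_neg_iff_add_eq_0 scaleR_2[symmetric])
    then show ?thesis unfolding slice_dom_def p by blast
  qed
  moreover have "slice_dom ?c \<subseteq> points CP" by (auto simp: slice_dom_def points_CP)
  moreover have "subspace {x. ?c \<bullet> x = 0}" by (rule subspace_hyperplane)
  moreover have "dim {x. ?c \<bullet> x = 0} = DIM(complex ^ 'n) - 1"
    by (rule dim_hyperplane[OF v0(2)])
  ultimately show "\<exists>W \<theta> L. p \<in> W \<and> W \<subseteq> points CP \<and> smooth_atlas UNIV (insert (W, \<theta>) CP) \<and>
      subspace L \<and> dim L = DIM(complex ^ 'n) - 1 \<and> \<theta> ` (W \<inter> ?O) = \<theta> ` W \<inter> L"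
    using smooth_atlas_insert_slice[of ?c] by blast
qed

lemma cohomogeneity_one_conformal:
  "cohomogeneity_one TYPE(complex ^ ('n option) ^ ('n option)) CP
     (conformal_metric a :: (_, complex ^ ('n::finite)) metric)"
  unfolding cohomogeneity_one_def
proof (intro exI conjI ballI allI impI)
  let ?e = "base_vec :: complex ^ 'n option"
  show "lie_group (unitary_group ?e) (skew_killing ?e) (unitary_atlas ?e)"
    by (rule lie_group_unitary)
  show "compact_space (atlas_topology (skew_killing ?e) (unitary_atlas ?e))"
    by (rule compact_space_unitary)
  show "smooth_action (unitary_group ?e) (skew_killing ?e) (unitary_atlas ?e)
      (CP :: (_, complex ^ 'n) atlas) proj_action"
    by (rule smooth_action_proj)
  show "metric_preserving CP (conformal_metric a :: (_, complex ^ 'n) metric) (proj_action A)"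
    if "A \<in> carrier (unitary_group ?e)" for A
    using that
    by (intro metric_preserving_unitary[of A]) (auto simp: herm_unitary unitary_base_comp proj_action_cline)
  show "principal_point (unitary_group ?e) (points (CP :: (_, complex ^ 'n) atlas)) proj_action
      (cline (alift None (axis undefined 1)))"
    by (rule principal_point_exists)
  show "embedded_submanifold (DIM(complex ^ 'n) - 1) CP (orbit (unitary_group ?e) proj_action p)"
    if "principal_point (unitary_group ?e) (points (CP :: (_, complex ^ 'n) atlas)) proj_action p" for p
    using principal_alift[OF that] embedded_orbit by metis
qed

theorem proposition2p16:
  shows "\<exists>(g :: ((complex ^ (('n::finite) option)) set, complex ^ 'n) metric) f.
           riemannian_metric CP g \<and>
           cohomogeneity_one TYPE(complex ^ ('n option) ^ ('n option)) CP g \<and>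
           smooth_density CP f \<and> weighted_sec_pos CP g f \<and> \<not> sec_nonneg CP g"
proof -
  \<comment> \<open>The least curvature at the base point is \<open>\<kappa> - 4 a = - 1 / 10\<close>, and the Hessian of the
    density is \<open>2 / 10\<close> there.\<close>
  define \<kappa> a where "\<kappa> = min_curvature TYPE('n)" and "a = \<kappa> / 4 + 1 / 40"
  have \<kappa>: "\<kappa> = 1 \<or> \<kappa> = 4" by (simp add: \<kappa>_def min_curvature_def)
  have pos: "\<kappa> - 4 * a * (1 - s) - 4 * a\<^sup>2 * s * (1 - s) + (1 / 10) * (2 - 4 * s - 4 * a * s * (1 - s)) > 0"
    if s: "0 \<le> s" "s \<le> 1" for s :: real
  proof (cases "\<kappa> = 1")
    case True
    \<comment> \<open>The expanded expression for \<open>a = 11 / 40\<close>, in which no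
      coefficient is negative.\<close>
    have "0 < 1 / 10 + (7 / 10 - 4125 / 10000) * s + 4125 / 10000 * s\<^sup>2"
      using s by (intro add_pos_nonneg) auto
    then show ?thesis by (simp add: a_def True power2_eq_square field_simps)
  next
    case False
    \<comment> \<open>For \<open>a = 41 / 40\<close> the expression is
      \<open>1 / 10 - 0.9125 s + 4.6125 s^2\<close>. Its minimum is close to
      \<open>s = 1 / 10\<close>, and squaring around that rounded value leaves a positive
      remainder.\<close>
    have "0 < (s - 1 / 10)\<^sup>2 * (46125 / 10000) + 53875 / 1000000 + (1 / 100) * s"
      using s by (intro add_pos_nonneg add_nonneg_pos) auto
    then show ?thesis using \<kappa> False by (simp add: a_def power2_eq_square field_simps)
  qed
  have a: "a \<ge> 0" "4 * a > \<kappa>" using \<kappa> by (auto simp: a_def)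
  have "weighted_sec_pos CP (conformal_metric a :: (_, complex ^ 'n) metric)
      (\<lambda>L. (1 / 10) * line_height L)"
    using a(1) pos unfolding \<kappa>_def by (intro weighted_sec_pos_conformal) simp_all
  moreover have "\<not> sec_nonneg CP (conformal_metric a :: (_, complex ^ 'n) metric)"
    using a(2) unfolding \<kappa>_def by (rule not_sec_nonneg_conformal)
  ultimately show ?thesis
    using riemannian_conformal_metric cohomogeneity_one_conformal height_density by blast
qed

end
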